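(* Let $A=(a_{ij})$ be an $n\times n$ matrix with non-negative integer entries and $\det A\neq 0$, such that ${}^t\mathbf e A^{-1}\mathbf e=1$, where $\mathbf e=(1,\dots,1)$ (i.e. the sum of all entries of $A^{-1}$ equals $1$). Assume that the weights $q_j$ and the numbers $q'_k$ attached to $A$ (see context) are all strictly positive, and that $X_A$ is irreducible. Then the rational map $q_A\circ\phi_A: X_d\to\overline{M}_A$ is birationally equivalent to the quotient map $X_d\to X_d/\Gamma(\mathbf q')$. Hence $X_d/\Gamma(\mathbf q')$ is birational to $\overline{M}_A$.
   Context: Everything is over $\mathbb C$. For $A=(a_{ij})\in M_n(\mathbb Z_{\ge 0})$ with $\det A\ne0$, let $d$ be the smallest positive integer such that $B=(b_{ij}):=dA^{-1}$ has integer entries. Put $\mathbf q=(q_1,\dots,q_n):=B\mathbf e$ and $\mathbf q'=(q'_1,\dots,q'_n):={}^tB\,\mathbf e$, so $q_j=\sum_k b_{jk}$ and $q'_k=\sum_j b_{jk}$. The condition ${}^t\mathbf eA^{-1}\mathbf e=1$ means $\sum_j q_j=d=\sum_k q_k'$. $W\mathbb P^{n-1}(q_1,\dots,q_n)$ is the weighted projective space $(\mathbb C^n\setminus\{0\})/\sim$ with $(x_1,\dots,x_n)\sim(\lambda^{q_1}x_1,\dots,\lambda^{q_n}x_n)$ for $\lambda\in\mathbb C^*$. $F_A:=\sum_{i=1}^n\prod_{j=1}^n x_j^{a_{ij}}$ and $X_A:=\{F_A=0\}\subset W\mathbb P^{n-1}(q_1,\dots,q_n)$. $X_d:=\{\sum_{i=1}^n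 y_i^d=0\}\subset\mathbb P^{n-1}$ is the Fermat variety. The rational map $\phi_A:\mathbb P^{n-1}\to W\mathbb P^{n-1}(q_1,\dots,q_n)$ is $(y_1:\dots:y_n)\mapsto(x_1:\dots:x_n)$ with $x_j=\prod_{k}y_k^{b_{jk}}$; it maps $X_d$ to $X_A$. The rational map $q_A:W\mathbb P^{n-1}(q_1,\dots,q_n)\to\mathbb P^n$ is $$(x_1:\dots:x_n)\mapsto(u_0:\dots:u_n)=\Big(\prod_j x_j:\prod_j x_j^{a_{1j}}:\dots:\prod_j x_j^{a_{nj}}\Big).$$ On $X_d$ the composition is $q_A\circ\phi_A(y)=(\prod_k y_k^{q'_k}:y_1^d:\dots:y_n^d)$. The Shioda quotient $\overline{M}_A\subset\mathbb P^n$ is the closure of the image of $X_d$ under $q_A\circ\phi_A$. Let $\zeta$ be a primitive $d$-th root of unity. For $\mathbf k\in(\mathbb Z/d\mathbb Z)^n$ let $g_{\mathbf k}(y_1:\dots:y_n)=(\zeta^{k_1}y_1:\dots:\zeta^{k_n}y_n)$. Then $$\Gamma(\mathbf q'):=\Big\{g_{\mathbf k}:\ \sum_j k_jq'_j\equiv0 \bmod d\Big\}\Big/\langle g_{(1,\dots,1)}\rangle,$$ a finite group acting on $X_d$. Two rational maps $f_i:X\to Y_i$ ($i=1,2$) of algebraic varieties are birationally equivalent if there are Zariski open (dense) subsets $U\subset X$, $U_i\subset Y_i$ and an isomorphism $\phi:U_1\to U_2$ with $\phi\circ f_1=f_2$ on $U$. *)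

theory Defs
  imports "HOL-Analysis.Analysis" "HOL-Algebra.Generated_Groups" "HOL-Number_Theory.Cong"
begin

section \<open>Spaces with functions\<close>

text \<open>
  Complex algebraic varieties are modelled as spaces with functions: a topological space together
  with, for every open set \<open>U\<close>, a predicate selecting the regular functions on \<open>U\<close>.
  HOL functions are total, so only the values of a regular function on \<open>U\<close> are meaningful.
\<close>

record 'a fspace =
  topo :: "'a topology"
  regular :: "'a set \<Rightarrow> ('a \<Rightarrow> complex) \<Rightarrow> bool"

abbreviation points :: "'a fspace \<Rightarrow> 'a set" where
  "points X \<equiv> topspace (topo X)"

definition dense_open :: "'a fspace \<Rightarrow> 'a set \<Rightarrow> bool" where
  "dense_open X U \<longleftrightarrow> openin (topo X) U \<and> topo X closure_of U = points X"

definition irreducible_space :: "'a fspace \<Rightarrow> bool" where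
  "irreducible_space X \<longleftrightarrow> points X \<noteq> {} \<and>
     (\<forall>C D. closedin (topo X) C \<and> closedin (topo X) D \<and> C \<union> D = points X
            \<longrightarrow> C = points X \<or> D = points X)"

text \<open>The induced structure on a locally closed subset \<open>S\<close>: a function is regular iff it is locally
  the restriction of a regular function on an open set of the ambient space.\<close>

definition subspace_of :: "'a fspace \<Rightarrow> 'a set \<Rightarrow> 'a fspace" where
  "subspace_of X S =
    \<lparr>topo = subtopology (topo X) S,
     regular = (\<lambda>U f. \<forall>p\<in>U. \<exists>V g. openin (topo X) V \<and> p \<in> V \<and> V \<inter> S \<subseteq> U \<and> regular X V g \<and>
                                 (\<forall>x\<in>V \<inter> S. f x = g x))\<rparr>"

text \<open>The quotient by an equivalence relation: a set \<open>V\<close> of classes is open iff its preimage, which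
  is \<open>\<Union>V\<close>, is open, and \<open>f\<close> is regular on \<open>V\<close> iff its pullback along the projection is regular.
  For the quotients used below (\<open>\<complex>\<^sup>n - {0}\<close> by a weighted action of the multiplicative group,
  and a projective variety by a finite group) this is the geometric quotient.\<close>

definition quotient_topology :: "'a topology \<Rightarrow> ('a \<times> 'a) set \<Rightarrow> 'a set topology" where
  "quotient_topology T R = topology (\<lambda>V. V \<subseteq> topspace T // R \<and> openin T (\<Union>V))"

definition quotient_space :: "'a fspace \<Rightarrow> ('a \<times> 'a) set \<Rightarrow> 'a set fspace" where
  "quotient_space X R =
    \<lparr>topo = quotient_topology (topo X) R,
     regular = (\<lambda>V f. regular X (\<Union>V) (\<lambda>x. f (R `` {x})))\<rparr>"

definition morphism :: "'a fspace \<Rightarrow> 'b fspace \<Rightarrow> ('a \<Rightarrow> 'b) \<Rightarrow> bool" where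
  "morphism X Y f \<longleftrightarrow> continuous_map (topo X) (topo Y) f \<and>
     (\<forall>V g. openin (topo Y) V \<and> regular Y V g
            \<longrightarrow> regular X {x \<in> points X. f x \<in> V} (g \<circ> f))"

definition isomorphism :: "'a fspace \<Rightarrow> 'b fspace \<Rightarrow> ('a \<Rightarrow> 'b) \<Rightarrow> bool" where
  "isomorphism X Y f \<longleftrightarrow> morphism X Y f \<and>
     (\<exists>g. morphism Y X g \<and> (\<forall>x\<in>points X. g (f x) = x) \<and> (\<forall>y\<in>points Y. f (g y) = y))"

text \<open>A rational map is given by a representative, a morphism on a dense open subset, encoded as a
  partial function whose domain is that subset. Birational equivalence does not depend on the
  choice of representatives.\<close>

definition rational_map :: "'a fspace \<Rightarrow> 'b fspace \<Rightarrow> ('a \<rightharpoonup> 'b) \<Rightarrow> bool" where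
  "rational_map X Y f \<longleftrightarrow> dense_open X (dom f) \<and>
     morphism (subspace_of X (dom f)) Y (\<lambda>x. the (f x))"

definition birationally_equivalent_maps ::
  "'a fspace \<Rightarrow> 'b fspace \<Rightarrow> 'c fspace \<Rightarrow> ('a \<rightharpoonup> 'b) \<Rightarrow> ('a \<rightharpoonup> 'c) \<Rightarrow> bool" where
  "birationally_equivalent_maps X Y1 Y2 f1 f2 \<longleftrightarrow>
     rational_map X Y1 f1 \<and> rational_map X Y2 f2 \<and>
     (\<exists>U U1 U2 \<phi>. dense_open X U \<and> dense_open Y1 U1 \<and> dense_open Y2 U2 \<and>
        U \<subseteq> dom f1 \<inter> dom f2 \<and>
        isomorphism (subspace_of Y1 U1) (subspace_of Y2 U2) \<phi> \<and>
        (\<forall>x\<in>U. the (f1 x) \<in> U1 \<and> \<phi> (the (f1 x)) = the (f2 x)))"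

definition birational :: "'a fspace \<Rightarrow> 'b fspace \<Rightarrow> bool" where
  "birational X Y \<longleftrightarrow> (\<exists>U V \<phi>. dense_open X U \<and> dense_open Y V \<and>
     isomorphism (subspace_of X U) (subspace_of Y V) \<phi>)"

lemma istopology_quotient:
  "istopology (\<lambda>V. V \<subseteq> topspace T // R \<and> openin T (\<Union>V))" if "equiv (topspace T) R"
  unfolding istopology_def
proof (intro conjI allI impI)
  fix V W assume V: "V \<subseteq> topspace T // R \<and> openin T (\<Union>V)"
    and W: "W \<subseteq> topspace T // R \<and> openin T (\<Union>W)"
  have "\<Union>(V \<inter> W) = \<Union>V \<inter> \<Union>W"
    using V W quotient_disj[OF that] by blast
  then show "V \<inter> W \<subseteq> topspace T // R" "openin T (\<Union>(V \<inter> W))"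
    using V W by auto
next
  fix K assume K: "\<forall>V\<in>K. V \<subseteq> topspace T // R \<and> openin T (\<Union>V)"
  then show "\<Union>K \<subseteq> topspace T // R" by blast
  have "\<Union>(\<Union>K) = \<Union>(Union ` K)" by blast
  then show "openin T (\<Union>(\<Union>K))" using K by auto
qed

section \<open>Affine and weighted projective space\<close>

inductive_set poly_functions :: "(complex ^ 'n \<Rightarrow> complex) set" where
  const: "(\<lambda>x. c) \<in> poly_functions"
| coord: "(\<lambda>x. x $ j) \<in> poly_functions"
| add: "f \<in> poly_functions \<Longrightarrow> g \<in> poly_functions \<Longrightarrow> (\<lambda>x. f x + g x) \<in> poly_functions"
| mult: "f \<in> poly_functions \<Longrightarrow> g \<in> poly_functions \<Longrightarrow> (\<lambda>x. f x * g x) \<in> poly_functions"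

definition zariski_open :: "(complex ^ 'n) set \<Rightarrow> bool" where
  "zariski_open U \<longleftrightarrow> (\<exists>F \<subseteq> poly_functions. U = {x. \<exists>f\<in>F. f x \<noteq> 0})"

lemma istopology_zariski_open: "istopology zariski_open"
  unfolding istopology_def
proof (intro conjI allI impI)
  fix U V :: "(complex ^ 'n) set"
  assume "zariski_open U" "zariski_open V"
  then obtain F G where F: "F \<subseteq> poly_functions" "U = {x. \<exists>f\<in>F. f x \<noteq> 0}"
    and G: "G \<subseteq> poly_functions" "V = {x. \<exists>f\<in>G. f x \<noteq> 0}"
    unfolding zariski_open_def by blast
  let ?H = "(\<lambda>(f, g). \<lambda>x. f x * g x) ` (F \<times> G)"
  have "?H \<subseteq> poly_functions"
    using F G by (auto intro: poly_functions.mult)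
  moreover have "U \<inter> V = {x. \<exists>h\<in>?H. h x \<noteq> 0}"
    unfolding F(2) G(2) by auto
  ultimately show "zariski_open (U \<inter> V)"
    unfolding zariski_open_def by blast
next
  fix K :: "(complex ^ 'n) set set"
  assume "\<forall>U\<in>K. zariski_open U"
  then have "\<forall>U\<in>K. \<exists>F. F \<subseteq> poly_functions \<and> U = {x. \<exists>f\<in>F. f x \<noteq> 0}"
    unfolding zariski_open_def .
  then obtain F where F: "\<forall>U\<in>K. F U \<subseteq> poly_functions \<and> U = {x. \<exists>f\<in>F U. f x \<noteq> 0}"
    by (rule bchoice[THEN exE])
  have "(\<Union>U\<in>K. F U) \<subseteq> poly_functions"
  proof (rule UN_least)
    fix U assume "U \<in> K"
    from bspec[OF F this] show "F U \<subseteq> poly_functions" by (rule conjunct1)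
  qed
  moreover have "\<Union>K = {x. \<exists>f\<in>(\<Union>U\<in>K. F U). f x \<noteq> 0}"
  proof -
    have "x \<in> U \<longleftrightarrow> (\<exists>f\<in>F U. f x \<noteq> 0)" if "U \<in> K" for x U
      by (subst bspec[OF F that, THEN conjunct2]) (rule mem_Collect_eq)
    then show ?thesis by blast
  qed
  ultimately show "zariski_open (\<Union>K)"
    unfolding zariski_open_def by (intro exI[of _ "\<Union>U\<in>K. F U"] conjI)
qed

definition affine_space :: "(complex ^ 'n) fspace" where
  "affine_space =
    \<lparr>topo = topology zariski_open,
     regular = (\<lambda>U f. \<forall>p\<in>U. \<exists>V. zariski_open V \<and> p \<in> V \<and> V \<subseteq> U \<and>
        (\<exists>g\<in>poly_functions. \<exists>h\<in>poly_functions. \<forall>x\<in>V. h x \<noteq> 0 \<and> f x = g x / h x))\<rparr>"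

definition weighted_rel :: "int ^ 'n \<Rightarrow> ((complex ^ 'n) \<times> (complex ^ 'n)) set" where
  "weighted_rel q = {(x, y). x \<noteq> 0 \<and> y \<noteq> 0 \<and>
     (\<exists>l. l \<noteq> 0 \<and> (\<forall>j. y $ j = l powi (q $ j) * x $ j))}"

lemma equiv_weighted_rel: "equiv (- {0}) (weighted_rel q)"
proof (rule equivI)
  show "refl_on (- {0}) (weighted_rel q)"
    unfolding refl_on_def weighted_rel_def by (auto intro!: exI[of _ 1])
  show "sym (weighted_rel q)"
  proof (rule symI)
    fix x y assume "(x, y) \<in> weighted_rel q"
    then obtain l where l: "x \<noteq> 0" "y \<noteq> 0" "l \<noteq> 0" "\<forall>j. y $ j = l powi (q $ j) * x $ j"
      unfolding weighted_rel_def by blast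
    then have "\<forall>j. x $ j = (inverse l) powi (q $ j) * y $ j"
      by (simp add: power_int_inverse)
    with l show "(y, x) \<in> weighted_rel q"
      unfolding weighted_rel_def by (auto intro!: exI[of _ "inverse l"])
  qed
  show "trans (weighted_rel q)"
  proof (rule transI)
    fix x y z assume "(x, y) \<in> weighted_rel q" "(y, z) \<in> weighted_rel q"
    then obtain l m where l: "x \<noteq> 0" "y \<noteq> 0" "l \<noteq> 0" "\<forall>j. y $ j = l powi (q $ j) * x $ j"
      and m: "z \<noteq> 0" "m \<noteq> 0" "\<forall>j. z $ j = m powi (q $ j) * y $ j"
      unfolding weighted_rel_def by blast
    then have "\<forall>j. z $ j = (m * l) powi (q $ j) * x $ j"
      by (simp add: power_int_mult_distrib)
    with l m show "(x, z) \<in> weighted_rel q"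
      unfolding weighted_rel_def by (auto intro!: exI[of _ "m * l"])
  qed
  show "weighted_rel q \<subseteq> (- {0}) \<times> (- {0})"
    unfolding weighted_rel_def by auto
qed

definition weighted_proj :: "int ^ 'n \<Rightarrow> (complex ^ 'n) set fspace" where
  "weighted_proj q = quotient_space (subspace_of affine_space (- {0})) (weighted_rel q)"

text \<open>Ordinary projective space has all weights 1; its homogeneous coordinates are indexed by \<open>'n\<close>.\<close>

abbreviation proj_space :: "(complex ^ 'n) set fspace" where
  "proj_space \<equiv> weighted_proj 1"

section \<open>The data attached to a matrix\<close>

definition A_inv :: "nat ^ 'n ^ 'n \<Rightarrow> rat ^ 'n ^ 'n" where
  "A_inv A = matrix_inv (map_matrix of_nat A)"

definition d_of :: "nat ^ 'n ^ 'n \<Rightarrow> nat" where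
  "d_of A = (LEAST d. 0 < d \<and> (\<forall>i j. of_nat d * A_inv A $ i $ j \<in> \<int>))"

text \<open>The floor only converts to type \<^typ>\<open>int\<close>: its argument is an integer by the choice of
  \<open>d\<close>.\<close>

definition B_of :: "nat ^ 'n ^ 'n \<Rightarrow> int ^ 'n ^ 'n" where
  "B_of A = (\<chi> i j. \<lfloor>of_nat (d_of A) * A_inv A $ i $ j\<rfloor>)"

definition q_of :: "nat ^ 'n ^ 'n \<Rightarrow> int ^ 'n" where
  "q_of A = B_of A *v 1"

definition q'_of :: "nat ^ 'n ^ 'n \<Rightarrow> int ^ 'n" where
  "q'_of A = transpose (B_of A) *v 1"

definition F_poly :: "nat ^ 'n ^ 'n \<Rightarrow> complex ^ 'n \<Rightarrow> complex" where
  "F_poly A x = (\<Sum>i\<in>UNIV. \<Prod>j\<in>UNIV. x $ j ^ (A $ i $ j))"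

definition X_A :: "nat ^ 'n ^ 'n \<Rightarrow> (complex ^ 'n) set fspace" where
  "X_A A = subspace_of (weighted_proj (q_of A))
     {p \<in> points (weighted_proj (q_of A)). \<forall>x\<in>p. F_poly A x = 0}"

definition fermat :: "nat \<Rightarrow> (complex ^ 'n) set fspace" where
  "fermat d = subspace_of proj_space
     {p \<in> points proj_space. \<forall>y\<in>p. (\<Sum>i\<in>UNIV. y $ i ^ d) = 0}"

section \<open>The rational maps and the Shioda quotient\<close>

text \<open>The entries of \<open>B\<close> may be negative, so the monomial map is represented on the open set where
  all coordinates are nonzero. A map on classes is the image of the representatives, closed up
  under the target relation.\<close>

definition phi_A :: "nat ^ 'n ^ 'n \<Rightarrow> (complex ^ 'n) set \<rightharpoonup> (complex ^ 'n) set" where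
  "phi_A A p =
    (if p \<in> points proj_space \<and> (\<forall>y\<in>p. \<forall>k. y $ k \<noteq> 0)
     then Some (weighted_rel (q_of A) `` ((\<lambda>y. \<chi> j. \<Prod>k\<in>UNIV. y $ k powi (B_of A $ j $ k)) ` p))
     else None)"

text \<open>The target projective space of dimension \<open>n\<close> has its coordinates indexed by \<open>'n option\<close>: \<open>None\<close>
  stands for the index 0 and \<open>Some i\<close> for the index \<open>i\<close>.\<close>

definition u_coords :: "nat ^ 'n ^ 'n \<Rightarrow> complex ^ 'n \<Rightarrow> complex ^ 'n option" where
  "u_coords A x = (\<chi> i. case i of None \<Rightarrow> (\<Prod>j\<in>UNIV. x $ j)
                                | Some i \<Rightarrow> (\<Prod>j\<in>UNIV. x $ j ^ (A $ i $ j)))"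

definition q_A :: "nat ^ 'n ^ 'n \<Rightarrow> (complex ^ 'n) set \<rightharpoonup> (complex ^ 'n option) set" where
  "q_A A p =
    (if p \<in> points (weighted_proj (q_of A)) \<and> (\<forall>x\<in>p. u_coords A x \<noteq> 0)
     then Some (weighted_rel 1 `` (u_coords A ` p)) else None)"

definition shioda_map :: "nat ^ 'n ^ 'n \<Rightarrow> (complex ^ 'n) set \<rightharpoonup> (complex ^ 'n option) set" where
  "shioda_map A = q_A A \<circ>\<^sub>m (phi_A A |` points (fermat (d_of A)))"

definition shioda_quotient :: "nat ^ 'n ^ 'n \<Rightarrow> (complex ^ 'n option) set fspace" where
  "shioda_quotient A =
     subspace_of proj_space (topo proj_space closure_of ran (shioda_map A))"

section \<open>The group and its quotient\<close>

definition primitive_root :: "nat \<Rightarrow> complex \<Rightarrow> bool" where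
  "primitive_root d z \<longleftrightarrow> z ^ d = 1 \<and> (\<forall>m. 0 < m \<and> m < d \<longrightarrow> z ^ m \<noteq> 1)"

text \<open>For a primitive \<open>d\<close>-th root of unity \<open>z\<close> the linear map \<open>g_map z k\<close> determines \<open>k\<close> exactly
  modulo \<open>d\<close>, so the integer vectors \<open>k\<close> index \<open>(\<int>/d\<int>)\<^sup>n\<close>.\<close>

definition g_map :: "complex \<Rightarrow> int ^ 'n \<Rightarrow> complex ^ 'n \<Rightarrow> complex ^ 'n" where
  "g_map z k y = (\<chi> j. z powi (k $ j) * y $ j)"

definition diag_group :: "nat \<Rightarrow> complex \<Rightarrow> int ^ 'n \<Rightarrow> (complex ^ 'n \<Rightarrow> complex ^ 'n) monoid" where
  "diag_group d z q' =
    \<lparr>carrier = {g_map z k |k. [(\<Sum>j\<in>UNIV. k $ j * q' $ j) = 0] (mod int d)},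
     mult = (\<circ>), one = id\<rparr>"

definition Gam :: "nat \<Rightarrow> complex \<Rightarrow> int ^ 'n \<Rightarrow> (complex ^ 'n \<Rightarrow> complex ^ 'n) set monoid" where
  "Gam d z q' = diag_group d z q' Mod generate (diag_group d z q') {g_map z 1}"

text \<open>The elements of a coset differ by scalars, so they all send the projective point \<open>p\<close>, a set of
  vectors, to the same point.\<close>

definition act :: "(complex ^ 'n \<Rightarrow> complex ^ 'n) set \<Rightarrow> (complex ^ 'n) set \<Rightarrow> (complex ^ 'n) set" where
  "act C p = (\<Union>g\<in>C. g ` p)"

definition orbit_rel ::
  "nat \<Rightarrow> complex \<Rightarrow> int ^ 'n \<Rightarrow> ((complex ^ 'n) set \<times> (complex ^ 'n) set) set" where
  "orbit_rel d z q' = {(p, act C p) |p C. p \<in> points (fermat d) \<and> C \<in> carrier (Gam d z q')}"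

definition fermat_quotient ::
  "nat \<Rightarrow> complex \<Rightarrow> int ^ 'n \<Rightarrow> (complex ^ 'n) set set fspace" where
  "fermat_quotient d z q' = quotient_space (fermat d) (orbit_rel d z q')"

definition fermat_quotient_map ::
  "nat \<Rightarrow> complex \<Rightarrow> int ^ 'n \<Rightarrow> (complex ^ 'n) set \<rightharpoonup> (complex ^ 'n) set set" where
  "fermat_quotient_map d z q' = (\<lambda>p. Some (orbit_rel d z q' `` {p})) |` points (fermat d)"

end

theory Submission
  imports Defs
begin

text \<open>
  On the part of the Fermat variety where all coordinates are nonzero the composite map sends \<open>y\<close> to
  the class of \<open>(\<Prod>k. y\<^sub>k powi q'\<^sub>k, y\<^sub>1 ^ d, \<dots>, y\<^sub>n ^ d)\<close>; its fibres there are exactly the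
  \<open>\<Gamma>(q')\<close>-orbits. With \<open>g = gcd(q'\<^sub>1, \<dots>, q'\<^sub>n)\<close> the image is cut out of the torus by
  \<open>\<Sum>i. u\<^sub>i = 0\<close> and \<open>u\<^sub>0 ^ (d/g) = \<Prod>i. u\<^sub>i ^ (q'\<^sub>i/g)\<close>, so it is open in its closure. The induced
  bijection from orbits to the image has a regular inverse: an invariant regular function is locally a
  quotient of polynomials, averaging over the finite group (after multiplication by a polynomial that
  separates the points of an orbit) makes numerator and denominator invariant, and invariant
  polynomials are Laurent polynomials in the coordinates of the composite map, because the subgroup
  generated by \<open>q'\<close> in \<open>(\<int>/d\<int>)\<^sup>n\<close> is its own double annihilator. The torus part is dense in the
  Fermat variety.
\<close>

section \<open>Regular functions on affine space\<close>

text \<open>The condition that the entries of the inverse matrix sum to 1 enters as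
  \<open>\<Sum>j. q' $ j = d\<close>. It makes every coordinate of the composite map homogeneous of
  degree \<open>d\<close>, so that the map descends to classes. The inverse is the hard part.
  Averaging a local denominator over the group may give a function that vanishes at the chosen
  point. A factor that is nonzero at the chosen representative and zero at its other translates
  leaves a single nonzero summand there. The averages need not be homogeneous, so they are evaluated
  at a normalized representative of each class. Polynomials are only functions here, without
  coefficients. This suffices: every polynomial is some linear combination of monomials, each
  monomial is an eigenvector of the diagonal group, and averaging is linear. The exponent
  \<open>d/g\<close> in the equation of the image has this origin: \<open>d\<close>-th roots of
  \<open>u\<^sub>1, ..., u\<^sub>n\<close> may be changed by a vector \<open>k\<close> of exponents
  of \<open>z\<close>, which multiplies \<open>u\<^sub>0\<close> by
  \<open>z powi (\<Sum>j. k $ j * q' $ j)\<close>, and these factors are exactly the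
  \<open>d/g\<close>-th roots of unity.\<close>

lemma openin_zariski [simp]: "openin (topology zariski_open) = zariski_open"
  by (rule topology_inverse'[OF istopology_zariski_open])

lemma poly_functions_prod:
  "finite S \<Longrightarrow> (\<And>i. i \<in> S \<Longrightarrow> f i \<in> poly_functions) \<Longrightarrow> (\<lambda>x. \<Prod>i\<in>S. f i x) \<in> poly_functions"
  by (induction S rule: finite_induct) (auto intro: poly_functions.intros)

lemma poly_functions_sum:
  "finite S \<Longrightarrow> (\<And>i. i \<in> S \<Longrightarrow> f i \<in> poly_functions) \<Longrightarrow> (\<lambda>x. \<Sum>i\<in>S. f i x) \<in> poly_functions"
  by (induction S rule: finite_induct) (auto intro: poly_functions.intros)

lemma poly_functions_power: "f \<in> poly_functions \<Longrightarrow> (\<lambda>x. f x ^ m) \<in> poly_functions"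
  by (induction m) (auto intro: poly_functions.intros)

lemma poly_functions_diff:
  assumes "f \<in> poly_functions" "g \<in> poly_functions"
  shows "(\<lambda>x. f x - g x) \<in> poly_functions"
proof -
  have "(\<lambda>x. f x + (\<lambda>x. -1) x * g x) \<in> poly_functions"
    by (intro poly_functions.intros assms)
  then show ?thesis by simp
qed

lemma continuous_on_poly_function:
  "f \<in> poly_functions \<Longrightarrow> continuous_on UNIV (f :: complex ^ 'n \<Rightarrow> complex)"
  by (induction rule: poly_functions.induct) (auto intro!: continuous_intros)

lemma zariski_open_nonzero: "w \<in> poly_functions \<Longrightarrow> zariski_open {x. w x \<noteq> 0}"
  unfolding zariski_open_def by (intro exI[of _ "{w}"]) auto

text \<open>Non-vanishing sets of single polynomials form a base. For the converse the defining
  family is taken as large as possible: all polynomials whose non-vanishing set lies in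
  \<open>U\<close>.\<close>

lemma zariski_open_iff:
  "zariski_open U \<longleftrightarrow> (\<forall>p\<in>U. \<exists>b\<in>poly_functions. b p \<noteq> 0 \<and> (\<forall>x. b x \<noteq> 0 \<longrightarrow> x \<in> U))"
proof
  assume "zariski_open U"
  then obtain F where F: "F \<subseteq> poly_functions" "U = {x. \<exists>f\<in>F. f x \<noteq> 0}"
    unfolding zariski_open_def by blast
  show "\<forall>p\<in>U. \<exists>b\<in>poly_functions. b p \<noteq> 0 \<and> (\<forall>x. b x \<noteq> 0 \<longrightarrow> x \<in> U)"
    using F(1) unfolding F(2) by blast
next
  assume *: "\<forall>p\<in>U. \<exists>b\<in>poly_functions. b p \<noteq> 0 \<and> (\<forall>x. b x \<noteq> 0 \<longrightarrow> x \<in> U)"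
  show "zariski_open U"
    unfolding zariski_open_def
    by (rule exI[of _ "{b \<in> poly_functions. \<forall>x. b x \<noteq> 0 \<longrightarrow> x \<in> U}"]) (use * in blast)
qed

lemma zariski_openE:
  assumes "zariski_open U" "p \<in> U"
  obtains b where "b \<in> poly_functions" "b p \<noteq> 0" "\<forall>x. b x \<noteq> 0 \<longrightarrow> x \<in> U"
  using bspec[OF iffD1[OF zariski_open_iff assms(1)] assms(2)] by (elim bexE conjE) (rule that)

lemma zariski_open_Int: "zariski_open U \<Longrightarrow> zariski_open V \<Longrightarrow> zariski_open (U \<inter> V)"
  using istopology_zariski_open unfolding istopology_def by blast

lemma zariski_open_UNIV: "zariski_open UNIV"
  unfolding zariski_open_iff by (auto intro!: bexI[of _ "\<lambda>x. 1"] poly_functions.const)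

lemma topspace_zariski [simp]: "topspace (topology zariski_open) = UNIV"
  using zariski_open_UNIV unfolding topspace_def by auto

lemma topo_affine_space [simp]: "topo affine_space = topology zariski_open"
  by (simp add: affine_space_def)

lemma zariski_open_minus_zero: "zariski_open (- {0})"
  unfolding zariski_open_iff
proof
  fix p :: "complex ^ 'n" assume "p \<in> - {0}"
  then obtain j where "p $ j \<noteq> 0" by (auto simp: vec_eq_iff)
  then show "\<exists>b\<in>poly_functions. b p \<noteq> 0 \<and> (\<forall>x. b x \<noteq> 0 \<longrightarrow> x \<in> - {0})"
    by (intro bexI[of _ "\<lambda>x. x $ j"]) (auto intro: poly_functions.coord)
qed

lemma zariski_open_torus: "zariski_open {x. \<forall>j. x $ j \<noteq> 0}"
proof -
  have "(\<lambda>x. \<Prod>j\<in>UNIV. x $ j) \<in> poly_functions"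
    by (intro poly_functions_prod poly_functions.coord) auto
  from zariski_open_nonzero[OF this] show ?thesis by simp
qed

lemma rational_atI:
  assumes "a \<in> poly_functions" "b \<in> poly_functions" "b p \<noteq> 0"
    "\<And>x. b x \<noteq> 0 \<Longrightarrow> x \<in> U \<and> f x = a x / b x"
  shows "\<exists>a\<in>poly_functions. \<exists>b\<in>poly_functions.
    b p \<noteq> 0 \<and> (\<forall>x. b x \<noteq> 0 \<longrightarrow> x \<in> U \<and> f x = a x / b x)"
  by (intro bexI[of _ a] bexI[of _ b] conjI allI impI assms)

text \<open>Multiplying numerator and denominator by a polynomial that cuts out the neighbourhood
  lets the denominator \<open>b\<close> describe the neighbourhood as well. Local arguments then
  handle two polynomials and no open set.\<close>

lemma regular_affine_iff:
  "regular affine_space U f \<longleftrightarrow>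
    (\<forall>p\<in>U. \<exists>a\<in>poly_functions. \<exists>b\<in>poly_functions.
       b p \<noteq> 0 \<and> (\<forall>x. b x \<noteq> 0 \<longrightarrow> x \<in> U \<and> f x = a x / b x))"
  (is "?L \<longleftrightarrow> ?R")
proof
  assume L: ?L
  show ?R
  proof
    fix p assume "p \<in> U"
    then obtain V g h where V: "zariski_open V" "p \<in> V" "V \<subseteq> U"
      and gh: "g \<in> poly_functions" "h \<in> poly_functions" "\<forall>x\<in>V. h x \<noteq> 0 \<and> f x = g x / h x"
      using L unfolding affine_space_def by fastforce
    obtain w where w: "w \<in> poly_functions" "w p \<noteq> 0" "\<And>x. w x \<noteq> 0 \<Longrightarrow> x \<in> V"
      using V unfolding zariski_open_iff by blast
    show "\<exists>a\<in>poly_functions. \<exists>b\<in>poly_functions.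
       b p \<noteq> 0 \<and> (\<forall>x. b x \<noteq> 0 \<longrightarrow> x \<in> U \<and> f x = a x / b x)"
      by (intro rational_atI[of "\<lambda>x. w x * g x" "\<lambda>x. w x * h x"])
        (use V gh w in \<open>auto intro: poly_functions.mult\<close>)
  qed
next
  assume R: ?R
  show ?L unfolding affine_space_def
  proof (simp, intro ballI)
    fix p assume "p \<in> U"
    then obtain a b where "a \<in> poly_functions" "b \<in> poly_functions" "b p \<noteq> 0"
      "\<forall>x. b x \<noteq> 0 \<longrightarrow> x \<in> U \<and> f x = a x / b x" using R by blast
    then show "\<exists>V. zariski_open V \<and> p \<in> V \<and> V \<subseteq> U \<and>
        (\<exists>g\<in>poly_functions. \<exists>h\<in>poly_functions. \<forall>x\<in>V. h x \<noteq> 0 \<and> f x = g x / h x)"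
      by (intro exI[of _ "{x. b x \<noteq> 0}"]) (auto intro: zariski_open_nonzero)
  qed
qed

lemma regular_affineE:
  assumes "regular affine_space U f" "p \<in> U"
  obtains a b where "a \<in> poly_functions" "b \<in> poly_functions" "b p \<noteq> 0"
    "\<forall>x. b x \<noteq> 0 \<longrightarrow> x \<in> U" "\<forall>x. b x \<noteq> 0 \<longrightarrow> f x = a x / b x"
proof -
  obtain a b where ab: "a \<in> poly_functions" "b \<in> poly_functions" "b p \<noteq> 0"
    "\<forall>x. b x \<noteq> 0 \<longrightarrow> x \<in> U \<and> f x = a x / b x"
    using bspec[OF iffD1[OF regular_affine_iff assms(1)] assms(2)] by (elim bexE conjE) (rule that)
  show thesis
    by (rule that[OF ab(1-3)]) (use ab(4) in simp_all)
qed

text \<open>The local description keeps each neighbourhood inside \<open>U\<close>, so regularity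
  already contains openness. Several openness proofs below go through a regular function for this
  reason.\<close>

lemma regular_affine_imp_open: "regular affine_space U f \<Longrightarrow> zariski_open U"
  unfolding zariski_open_iff
  by (meson regular_affineE)

lemma regular_affine_cong:
  "(\<And>x. x \<in> U \<Longrightarrow> f x = g x) \<Longrightarrow> regular affine_space U f \<longleftrightarrow> regular affine_space U g"
  unfolding regular_affine_iff by (intro ball_cong bex_cong refl) auto

lemma regular_affine_poly:
  assumes "zariski_open U" and f: "f \<in> poly_functions"
  shows "regular affine_space U f"
  unfolding regular_affine_iff
proof
  fix p assume "p \<in> U"
  obtain b where b: "b \<in> poly_functions" "b p \<noteq> 0" "\<forall>x. b x \<noteq> 0 \<longrightarrow> x \<in> U"
    by (rule zariski_openE[OF assms(1) \<open>p \<in> U\<close>])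
  show "\<exists>a\<in>poly_functions. \<exists>b\<in>poly_functions.
       b p \<noteq> 0 \<and> (\<forall>x. b x \<noteq> 0 \<longrightarrow> x \<in> U \<and> f x = a x / b x)"
    by (rule rational_atI[of "\<lambda>x. f x * b x" b, OF poly_functions.mult[OF f b(1)] b(1,2)])
      (use b(3) in simp)
qed

lemma regular_affine_subset:
  assumes "regular affine_space U f" "zariski_open V" "V \<subseteq> U"
  shows "regular affine_space V f"
  unfolding regular_affine_iff
proof
  fix p assume p: "p \<in> V"
  obtain c where c: "c \<in> poly_functions" "c p \<noteq> 0" "\<forall>x. c x \<noteq> 0 \<longrightarrow> x \<in> V"
    by (rule zariski_openE[OF assms(2) p])
  from p assms(3) have "p \<in> U" by blast
  obtain a b where "a \<in> poly_functions" "b \<in> poly_functions" "b p \<noteq> 0"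
    "\<forall>x. b x \<noteq> 0 \<longrightarrow> x \<in> U" "\<forall>x. b x \<noteq> 0 \<longrightarrow> f x = a x / b x"
    by (rule regular_affineE[OF assms(1) \<open>p \<in> U\<close>])
  note ab = this
  show "\<exists>a\<in>poly_functions. \<exists>b\<in>poly_functions.
       b p \<noteq> 0 \<and> (\<forall>x. b x \<noteq> 0 \<longrightarrow> x \<in> V \<and> f x = a x / b x)"
  proof (rule rational_atI[of "\<lambda>x. c x * a x" "\<lambda>x. c x * b x"])
    show "c p * b p \<noteq> 0" using ab(3) c(2) by simp
  next
    fix x assume "c x * b x \<noteq> 0"
    then have "c x \<noteq> 0" "b x \<noteq> 0" by auto
    with c(3)[rule_format, OF this(1)] ab(5)[rule_format, OF this(2)]
    show "x \<in> V \<and> f x = c x * a x / (c x * b x)" by simp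
  qed (intro poly_functions.mult ab c)+
qed

lemma regular_affine_add:
  assumes f: "regular affine_space U f" and g: "regular affine_space U g"
  shows "regular affine_space U (\<lambda>x. f x + g x)"
  unfolding regular_affine_iff
proof
  fix p assume p: "p \<in> U"
  obtain a b where "a \<in> poly_functions" "b \<in> poly_functions" "b p \<noteq> 0"
    "\<forall>x. b x \<noteq> 0 \<longrightarrow> x \<in> U" "\<forall>x. b x \<noteq> 0 \<longrightarrow> f x = a x / b x"
    by (rule regular_affineE[OF f p])
  note ab = this
  obtain a' b' where "a' \<in> poly_functions" "b' \<in> poly_functions" "b' p \<noteq> 0"
    "\<forall>x. b' x \<noteq> 0 \<longrightarrow> x \<in> U" "\<forall>x. b' x \<noteq> 0 \<longrightarrow> g x = a' x / b' x"
    by (rule regular_affineE[OF g p])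
  note ab' = this
  show "\<exists>a\<in>poly_functions. \<exists>b\<in>poly_functions.
       b p \<noteq> 0 \<and> (\<forall>x. b x \<noteq> 0 \<longrightarrow> x \<in> U \<and> f x + g x = a x / b x)"
  proof (rule rational_atI[of "\<lambda>x. a x * b' x + a' x * b x" "\<lambda>x. b x * b' x"])
    show "b p * b' p \<noteq> 0" using ab(3) ab'(3) by simp
  next
    fix x assume "b x * b' x \<noteq> 0"
    then have "b x \<noteq> 0" "b' x \<noteq> 0" by auto
    with ab(4,5)[rule_format, OF this(1)] ab'(5)[rule_format, OF this(2)]
    show "x \<in> U \<and> f x + g x = (a x * b' x + a' x * b x) / (b x * b' x)"
      by (simp add: add_frac_eq)
  qed (intro poly_functions.add poly_functions.mult ab ab')+
qed

lemma regular_affine_mult: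
  assumes f: "regular affine_space U f" and g: "regular affine_space U g"
  shows "regular affine_space U (\<lambda>x. f x * g x)"
  unfolding regular_affine_iff
proof
  fix p assume p: "p \<in> U"
  obtain a b where "a \<in> poly_functions" "b \<in> poly_functions" "b p \<noteq> 0"
    "\<forall>x. b x \<noteq> 0 \<longrightarrow> x \<in> U" "\<forall>x. b x \<noteq> 0 \<longrightarrow> f x = a x / b x"
    by (rule regular_affineE[OF f p])
  note ab = this
  obtain a' b' where "a' \<in> poly_functions" "b' \<in> poly_functions" "b' p \<noteq> 0"
    "\<forall>x. b' x \<noteq> 0 \<longrightarrow> x \<in> U" "\<forall>x. b' x \<noteq> 0 \<longrightarrow> g x = a' x / b' x"
    by (rule regular_affineE[OF g p])
  note ab' = this
  show "\<exists>a\<in>poly_functions. \<exists>b\<in>poly_functions.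
       b p \<noteq> 0 \<and> (\<forall>x. b x \<noteq> 0 \<longrightarrow> x \<in> U \<and> f x * g x = a x / b x)"
  proof (rule rational_atI[of "\<lambda>x. a x * a' x" "\<lambda>x. b x * b' x"])
    show "b p * b' p \<noteq> 0" using ab(3) ab'(3) by simp
  next
    fix x assume "b x * b' x \<noteq> 0"
    then have "b x \<noteq> 0" "b' x \<noteq> 0" by auto
    with ab(4,5)[rule_format, OF this(1)] ab'(5)[rule_format, OF this(2)]
    show "x \<in> U \<and> f x * g x = (a x * a' x) / (b x * b' x)"
      by (simp add: add_frac_eq)
  qed (intro poly_functions.add poly_functions.mult ab ab')+
qed

lemma regular_affine_inverse:
  assumes f: "regular affine_space U f"
  shows "regular affine_space {x \<in> U. f x \<noteq> 0} (\<lambda>x. inverse (f x))"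
  unfolding regular_affine_iff
proof
  fix p assume p: "p \<in> {x \<in> U. f x \<noteq> 0}"
  then have "p \<in> U" by simp
  obtain a b where "a \<in> poly_functions" "b \<in> poly_functions" "b p \<noteq> 0"
    "\<forall>x. b x \<noteq> 0 \<longrightarrow> x \<in> U" "\<forall>x. b x \<noteq> 0 \<longrightarrow> f x = a x / b x"
    by (rule regular_affineE[OF f \<open>p \<in> U\<close>])
  note ab = this
  show "\<exists>a\<in>poly_functions. \<exists>b\<in>poly_functions.
       b p \<noteq> 0 \<and> (\<forall>x. b x \<noteq> 0 \<longrightarrow> x \<in> {x \<in> U. f x \<noteq> 0} \<and> inverse (f x) = a x / b x)"
  \<comment> \<open>The inverse of \<open>a / b\<close> is written as \<open>b * b / (a * b)\<close>
    and not as \<open>b / a\<close>: the denominator must also force \<open>b x \<noteq> 0\<close>,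
    since \<open>f\<close> is known to equal \<open>a / b\<close> only there.\<close>
  proof (rule rational_atI[of "\<lambda>x. b x * b x" "\<lambda>x. a x * b x"])
    show "a p * b p \<noteq> 0" using p ab(3) ab(5)[rule_format, OF ab(3)] by auto
  next
    fix x assume "a x * b x \<noteq> 0"
    then show "x \<in> {x \<in> U. f x \<noteq> 0} \<and> inverse (f x) = b x * b x / (a x * b x)"
      using ab(4,5)[rule_format, of x] by auto
  qed (intro poly_functions.mult ab)+
qed

lemma zariski_open_regular_nonzero:
  "regular affine_space U f \<Longrightarrow> zariski_open {x \<in> U. f x \<noteq> 0}"
  by (blast intro: regular_affine_inverse regular_affine_imp_open)

lemma regular_affine_const: "zariski_open U \<Longrightarrow> regular affine_space U (\<lambda>x. c)"
  by (intro regular_affine_poly poly_functions.const)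

lemma regular_affine_prod:
  assumes "zariski_open U" "finite S" "\<And>i. i \<in> S \<Longrightarrow> regular affine_space U (f i)"
  shows "regular affine_space U (\<lambda>x. \<Prod>i\<in>S. f i x)"
  using assms(2,3)
  by (induction S rule: finite_induct) (auto intro: regular_affine_mult regular_affine_const[OF assms(1)])

lemma regular_affine_power:
  assumes "regular affine_space U f"
  shows "regular affine_space U (\<lambda>x. f x ^ m)"
  by (induction m) (auto intro: assms regular_affine_mult regular_affine_const regular_affine_imp_open)

lemma regular_affine_power_int:
  assumes f: "regular affine_space U f" "\<And>x. x \<in> U \<Longrightarrow> f x \<noteq> 0"
  shows "regular affine_space U (\<lambda>x. f x powi m)"
proof -
  have "{x \<in> U. f x \<noteq> 0} = U" using f(2) by auto
  then have "regular affine_space U (\<lambda>x. inverse (f x))"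
    using regular_affine_inverse[OF f(1)] by simp
  then show ?thesis
    unfolding power_int_def by (cases "m \<ge> 0") (simp_all add: regular_affine_power f)
qed

lemma regular_affine_poly_compose:
  assumes U: "zariski_open U" and psi: "\<And>j. regular affine_space U (\<lambda>x. \<psi> x $ j)"
  shows "P \<in> poly_functions \<Longrightarrow> regular affine_space U (\<lambda>x. P (\<psi> x))"
proof (induction rule: poly_functions.induct)
  case (const c)
  show ?case by (rule regular_affine_const[OF U])
next
  case (coord j)
  show ?case by (rule psi)
next
  case (add f g)
  from regular_affine_add[OF add.IH] show ?case .
next
  case (mult f g)
  from regular_affine_mult[OF mult.IH] show ?case .
qed

lemma zariski_open_vimage:
  assumes U: "zariski_open U" and psi: "\<And>j. regular affine_space U (\<lambda>x. \<psi> x $ j)"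
    and W: "zariski_open W"
  shows "zariski_open {x \<in> U. \<psi> x \<in> W}"
  unfolding zariski_open_iff
proof
  fix p assume p: "p \<in> {x \<in> U. \<psi> x \<in> W}"
  then obtain b where b: "b \<in> poly_functions" "b (\<psi> p) \<noteq> 0" "\<And>x. b x \<noteq> 0 \<Longrightarrow> x \<in> W"
    using W unfolding zariski_open_iff by blast
  have "zariski_open {x \<in> U. b (\<psi> x) \<noteq> 0}"
    by (rule zariski_open_regular_nonzero[OF regular_affine_poly_compose[OF U psi b(1)]])
  then obtain c where "c \<in> poly_functions" "c p \<noteq> 0" "\<And>x. c x \<noteq> 0 \<Longrightarrow> x \<in> {x \<in> U. b (\<psi> x) \<noteq> 0}"
    by (rule zariski_openE[of _ p]) (use b p in auto)
  then show "\<exists>c\<in>poly_functions. c p \<noteq> 0 \<and> (\<forall>x. c x \<noteq> 0 \<longrightarrow> x \<in> {x \<in> U. \<psi> x \<in> W})"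
    using b(3) by blast
qed

text \<open>Near \<open>\<psi> p\<close> the function is \<open>a / b\<close>. Both polynomials pull
  back to regular functions, and their quotient is regular where \<open>b \<circ> \<psi>\<close> is
  nonzero.\<close>

lemma regular_affine_compose:
  assumes U: "zariski_open U" and psi: "\<And>j. regular affine_space U (\<lambda>x. \<psi> x $ j)"
    and f: "regular affine_space W f"
  shows "regular affine_space {x \<in> U. \<psi> x \<in> W} (\<lambda>x. f (\<psi> x))"
  unfolding regular_affine_iff
proof
  fix p assume p: "p \<in> {x \<in> U. \<psi> x \<in> W}"
  then have "\<psi> p \<in> W" by simp
  obtain a b where ab: "a \<in> poly_functions" "b \<in> poly_functions" "b (\<psi> p) \<noteq> 0"
    "\<forall>x. b x \<noteq> 0 \<longrightarrow> x \<in> W" "\<forall>x. b x \<noteq> 0 \<longrightarrow> f x = a x / b x"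
    by (rule regular_affineE[OF f \<open>\<psi> p \<in> W\<close>])
  let ?V = "{x \<in> U. b (\<psi> x) \<noteq> 0}"
  have r: "regular affine_space U (\<lambda>x. b (\<psi> x))" "regular affine_space U (\<lambda>x. a (\<psi> x))"
    by (intro regular_affine_poly_compose[OF U psi] ab)+
  have V: "zariski_open ?V" by (rule zariski_open_regular_nonzero[OF r(1)])
  have rV: "regular affine_space ?V (\<lambda>x. a (\<psi> x) * inverse (b (\<psi> x)))"
    by (intro regular_affine_mult regular_affine_inverse r regular_affine_subset[OF r(2) V]) auto
  have pV: "p \<in> ?V" using p ab by auto
  obtain a' b' where ab': "a' \<in> poly_functions" "b' \<in> poly_functions" "b' p \<noteq> 0"
    "\<forall>x. b' x \<noteq> 0 \<longrightarrow> x \<in> ?V" "\<forall>x. b' x \<noteq> 0 \<longrightarrow> a (\<psi> x) * inverse (b (\<psi> x)) = a' x / b' x"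
    by (rule regular_affineE[OF rV pV])
  then show "\<exists>a\<in>poly_functions. \<exists>b\<in>poly_functions.
       b p \<noteq> 0 \<and> (\<forall>x. b x \<noteq> 0 \<longrightarrow> x \<in> {x \<in> U. \<psi> x \<in> W} \<and> f (\<psi> x) = a x / b x)"
    using ab(4,5) by (intro bexI[of _ a'] bexI[of _ b']) (auto simp: divide_inverse)
qed

section \<open>Quotients and subspaces\<close>

lemma openin_quotient:
  assumes "equiv (topspace T) R"
  shows "openin (quotient_topology T R) V \<longleftrightarrow> V \<subseteq> topspace T // R \<and> openin T (\<Union>V)"
  unfolding quotient_topology_def
  by (subst topology_inverse'[OF istopology_quotient[OF assms]]) (rule refl)

lemma topspace_quotient:
  assumes "equiv (topspace T) R"
  shows "topspace (quotient_topology T R) = topspace T // R"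
proof
  show "topspace (quotient_topology T R) \<subseteq> topspace T // R"
    using openin_quotient[OF assms] openin_topspace by blast
  have "openin (quotient_topology T R) (topspace T // R)"
    unfolding openin_quotient[OF assms] using Union_quotient[OF assms] by simp
  then show "topspace T // R \<subseteq> topspace (quotient_topology T R)"
    by (rule openin_subset)
qed

lemma topo_subspace_of [simp]: "topo (subspace_of X S) = subtopology (topo X) S"
  by (simp add: subspace_of_def)

lemma topo_quotient_space [simp]: "topo (quotient_space X R) = quotient_topology (topo X) R"
  by (simp add: quotient_space_def)

lemma regular_quotient_space:
  "regular (quotient_space X R) V f \<longleftrightarrow> regular X (\<Union>V) (\<lambda>x. f (R `` {x}))"
  by (simp add: quotient_space_def)

lemma regular_subspace_of:
  "regular (subspace_of X S) U f \<longleftrightarrow>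
    (\<forall>p\<in>U. \<exists>V g. openin (topo X) V \<and> p \<in> V \<and> V \<inter> S \<subseteq> U \<and> regular X V g \<and> (\<forall>x\<in>V \<inter> S. f x = g x))"
  by (simp add: subspace_of_def)

lemma regular_subspace_ofE:
  assumes "regular (subspace_of X S) U f" "p \<in> U"
  obtains V g where "openin (topo X) V" "p \<in> V" "V \<inter> S \<subseteq> U" "regular X V g" "\<forall>x\<in>V \<inter> S. f x = g x"
  using bspec[OF iffD1[OF regular_subspace_of assms(1)] assms(2)] by (elim exE conjE) (rule that)

text \<open>Transitivity of induced structures, so that pieces of the Fermat variety and of the
  image can be studied directly inside projective space. The assumption on \<open>U\<close> keeps
  its points inside the shrunken neighbourhoods \<open>V \<inter> S\<close>.\<close>

lemma regular_subspace_of_subspace_of: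
  assumes "T \<subseteq> S" "U \<subseteq> S"
  shows "regular (subspace_of (subspace_of X S) T) U f \<longleftrightarrow> regular (subspace_of X T) U f"
    (is "?L \<longleftrightarrow> ?R")
proof
  assume L: ?L
  show ?R unfolding regular_subspace_of
  proof
    fix p assume "p \<in> U"
    obtain V g where "openin (topo (subspace_of X S)) V" and V: "p \<in> V" "V \<inter> T \<subseteq> U"
      "regular (subspace_of X S) V g" "\<forall>x\<in>V \<inter> T. f x = g x"
      by (rule regular_subspace_ofE[OF L \<open>p \<in> U\<close>])
    obtain W h where W: "openin (topo X) W" "p \<in> W" "W \<inter> S \<subseteq> V" "regular X W h"
      "\<forall>x\<in>W \<inter> S. g x = h x"
      by (rule regular_subspace_ofE[OF V(3,1)])
    show "\<exists>V g. openin (topo X) V \<and> p \<in> V \<and> V \<inter> T \<subseteq> U \<and> regular X V g \<and> (\<forall>x\<in>V \<inter> T. f x = g x)"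
    proof (intro exI[of _ W] exI[of _ h] conjI W)
      show "W \<inter> T \<subseteq> U" using V(2) W(3) assms(1) by blast
      show "\<forall>x\<in>W \<inter> T. f x = h x"
      proof
        fix x assume "x \<in> W \<inter> T"
        then have "x \<in> W \<inter> S" "x \<in> V \<inter> T" using W(3) assms(1) by auto
        then show "f x = h x" using V(4) W(5) by simp
      qed
    qed
  qed
next
  assume R: ?R
  show ?L unfolding regular_subspace_of[of "subspace_of X S"]
  proof
    fix p assume p: "p \<in> U"
    obtain V g where V: "openin (topo X) V" "p \<in> V" "V \<inter> T \<subseteq> U" "regular X V g"
      "\<forall>x\<in>V \<inter> T. f x = g x"
      by (rule regular_subspace_ofE[OF R p])
    have "regular (subspace_of X S) (V \<inter> S) g"
      unfolding regular_subspace_of using V(1,4) by (intro ballI exI[of _ V] exI[of _ g]) auto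
    moreover have "openin (topo (subspace_of X S)) (V \<inter> S)"
      using V(1) by (auto simp: openin_subtopology)
    ultimately show "\<exists>V g. openin (topo (subspace_of X S)) V \<and> p \<in> V \<and> V \<inter> T \<subseteq> U \<and>
        regular (subspace_of X S) V g \<and> (\<forall>x\<in>V \<inter> T. f x = g x)"
      using V(2,3,5) p assms(2) by (intro exI[of _ "V \<inter> S"] exI[of _ g]) auto
  qed
qed

lemma dense_openI:
  assumes "openin (topo X) U"
    and "\<And>V. openin (topo X) V \<Longrightarrow> V \<noteq> {} \<Longrightarrow> U \<inter> V \<noteq> {}"
  shows "dense_open X U"
  unfolding dense_open_def
proof
  show "topo X closure_of U = points X"
  proof (rule antisym[OF closure_of_subset_topspace], rule subsetI)
    fix p assume "p \<in> points X"
    then show "p \<in> topo X closure_of U"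
      unfolding in_closure_of using assms(2) by blast
  qed
qed fact

lemma dense_open_points: "dense_open X (points X)"
  by (simp add: dense_open_def)

lemma isomorphism_sym:
  assumes "isomorphism X Y f"
  shows "\<exists>g. isomorphism Y X g"
  using assms unfolding isomorphism_def by blast

section \<open>Projective space\<close>

text \<open>The projective point with homogeneous coordinates \<open>y\<close>. It is empty for
  \<open>y = 0\<close>, because \<open>weighted_rel\<close> relates nonzero vectors only.\<close>

definition hom_class :: "complex ^ 'n \<Rightarrow> (complex ^ 'n) set" where
  "hom_class y = weighted_rel 1 `` {y}"

lemma hom_class_eq: "y \<noteq> 0 \<Longrightarrow> hom_class y = {l *s y |l. l \<noteq> 0}"
  by (auto simp: hom_class_def weighted_rel_def vec_eq_iff)

lemma hom_class_eq_iff: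
  assumes "x \<noteq> 0" "y \<noteq> 0"
  shows "hom_class x = hom_class y \<longleftrightarrow> (\<exists>l. l \<noteq> 0 \<and> y = l *s x)"
proof -
  have "hom_class x = hom_class y \<longleftrightarrow> (x, y) \<in> weighted_rel 1"
    unfolding hom_class_def using equiv_class_eq_iff[OF equiv_weighted_rel] assms
    by (metis ComplI singletonD)
  also have "\<dots> \<longleftrightarrow> (\<exists>l. l \<noteq> 0 \<and> y = l *s x)"
    using assms by (auto simp: weighted_rel_def vec_eq_iff)
  finally show ?thesis .
qed

lemma self_in_hom_class: "y \<noteq> 0 \<Longrightarrow> y \<in> hom_class y"
  by (auto simp: hom_class_eq intro: exI[of _ 1])

lemma hom_class_smult: "y \<noteq> 0 \<Longrightarrow> l \<noteq> 0 \<Longrightarrow> hom_class (l *s y) = hom_class y"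
  by (subst eq_commute, subst hom_class_eq_iff) auto

lemma hom_class_mem:
  assumes "y \<noteq> 0" "x \<in> hom_class y"
  shows "hom_class x = hom_class y"
proof -
  obtain l where "l \<noteq> 0" "x = l *s y"
    using assms(2) unfolding hom_class_eq[OF assms(1)] by blast
  then show ?thesis using hom_class_smult[OF assms(1)] by simp
qed

lemma points_weighted_proj: "points (weighted_proj q) = (- {0}) // weighted_rel q"
  unfolding weighted_proj_def topo_quotient_space topo_subspace_of topo_affine_space
  by (subst topspace_quotient) (simp_all add: equiv_weighted_rel)

lemma points_proj_space: "points proj_space = hom_class ` (- {0})"
  unfolding points_weighted_proj quotient_def hom_class_def by auto

lemma hom_class_in_points: "y \<noteq> 0 \<Longrightarrow> hom_class y \<in> points proj_space"
  by (simp add: points_proj_space)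

lemma points_proj_spaceE:
  assumes "p \<in> points proj_space"
  obtains y where "y \<noteq> 0" "p = hom_class y"
  using assms unfolding points_proj_space by blast

lemma openin_minus_zero:
  "openin (subtopology (topology zariski_open) (- {0})) U \<longleftrightarrow> zariski_open U \<and> 0 \<notin> U"
  by (subst openin_open_subtopology) (auto simp: zariski_open_minus_zero)

lemma openin_proj_space:
  "openin (topo proj_space) V \<longleftrightarrow> V \<subseteq> points proj_space \<and> zariski_open (\<Union>V)"
proof -
  have "0 \<notin> \<Union>V" if "V \<subseteq> points proj_space"
    using that unfolding points_proj_space by (force simp: hom_class_eq)
  then show ?thesis
    unfolding points_weighted_proj
    unfolding weighted_proj_def topo_quotient_space topo_subspace_of topo_affine_space
    by (subst openin_quotient) (auto simp add: equiv_weighted_rel openin_minus_zero points_weighted_proj)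
qed

lemma mem_Union_proj:
  assumes "V \<subseteq> points proj_space" "y \<noteq> 0"
  shows "y \<in> \<Union>V \<longleftrightarrow> hom_class y \<in> V"
proof
  assume "y \<in> \<Union>V"
  then obtain p where p: "p \<in> V" "y \<in> p" by blast
  then obtain x where x: "x \<noteq> 0" "p = hom_class x"
    using assms(1) points_proj_spaceE by blast
  show "hom_class y \<in> V" using hom_class_mem[OF x(1)] p x(2) by simp
qed (use self_in_hom_class assms(2) in blast)

lemma Union_proj_nonzero: "V \<subseteq> points proj_space \<Longrightarrow> y \<in> \<Union>V \<Longrightarrow> y \<noteq> 0"
  unfolding points_proj_space by (force simp: hom_class_eq)

lemma Union_image_hom_class:
  assumes "0 \<notin> U" "\<And>l y. l \<noteq> 0 \<Longrightarrow> y \<in> U \<Longrightarrow> l *s y \<in> U"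
  shows "\<Union>(hom_class ` U) = U"
proof -
  have "hom_class y \<subseteq> U" "y \<in> hom_class y" if "y \<in> U" for y
  proof -
    have "y \<noteq> 0" using that assms(1) by auto
    then show "hom_class y \<subseteq> U" "y \<in> hom_class y"
      using that assms(2) by (auto simp: hom_class_eq intro: exI[of _ 1])
  qed
  then show ?thesis by blast
qed

text \<open>A scaling-invariant set avoiding the origin is the union of its classes, so a Zariski
  open cone is the same thing as an open set of projective points.\<close>

lemma openin_image_hom_class:
  assumes "zariski_open U" "0 \<notin> U" "\<And>l y. l \<noteq> 0 \<Longrightarrow> y \<in> U \<Longrightarrow> l *s y \<in> U"
  shows "openin (topo proj_space) (hom_class ` U)"
proof -
  have "\<Union>(hom_class ` U) = U" by (rule Union_image_hom_class[OF assms(2,3)])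
  then show ?thesis
    unfolding openin_proj_space using assms(1,2) by (auto intro!: hom_class_in_points)
qed

text \<open>The punctured space is open in affine space, so passing to it does not change which
  functions are local quotients of polynomials. Regularity on projective space is thereby checked on
  the cone, without affine charts.\<close>

lemma regular_proj_space:
  assumes V: "openin (topo proj_space) V"
  shows "regular proj_space V g \<longleftrightarrow> regular affine_space (\<Union>V) (\<lambda>x. g (hom_class x))"
proof -
  let ?G = "\<lambda>x. g (hom_class x)"
  have V': "V \<subseteq> points proj_space" "zariski_open (\<Union>V)"
    using V by (auto simp: openin_proj_space)
  have nz: "\<Union>V \<inter> - {0} = \<Union>V" using Union_proj_nonzero[OF V'(1)] by auto
  have "regular (subspace_of affine_space (- {0})) (\<Union>V) ?G \<longleftrightarrow> regular affine_space (\<Union>V) ?G"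
    (is "?L \<longleftrightarrow> ?R")
  proof
    assume R: ?R
    show ?L unfolding regular_subspace_of
    proof
      fix p assume "p \<in> \<Union>V"
      then show "\<exists>W h. openin (topo affine_space) W \<and> p \<in> W \<and> W \<inter> - {0} \<subseteq> \<Union>V \<and>
          regular affine_space W h \<and> (\<forall>x\<in>W \<inter> - {0}. ?G x = h x)"
        using R V'(2) by (intro exI[of _ "\<Union>V"] exI[of _ ?G]) auto
    qed
  next
    assume L: ?L
    show ?R unfolding regular_affine_iff
    proof
      fix p assume p: "p \<in> \<Union>V"
      obtain W h where "openin (topo affine_space) W" and W: "p \<in> W" "W \<inter> - {0} \<subseteq> \<Union>V"
        "regular affine_space W h" "\<forall>x\<in>W \<inter> - {0}. ?G x = h x"
        by (rule regular_subspace_ofE[OF L p])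
      have *: "regular affine_space (W \<inter> - {0}) h"
        by (intro regular_affine_subset[OF W(3)] zariski_open_Int zariski_open_minus_zero
          regular_affine_imp_open[OF W(3)]) auto
      have "p \<noteq> 0" using Union_proj_nonzero[OF V'(1) p] .
      then have p': "p \<in> W \<inter> - {0}" using W(1) by simp
      obtain a b where ab: "a \<in> poly_functions" "b \<in> poly_functions" "b p \<noteq> 0"
        "\<forall>x. b x \<noteq> 0 \<longrightarrow> x \<in> W \<inter> - {0}" "\<forall>x. b x \<noteq> 0 \<longrightarrow> h x = a x / b x"
        by (rule regular_affineE[OF * p'])
      show "\<exists>a\<in>poly_functions. \<exists>b\<in>poly_functions.
         b p \<noteq> 0 \<and> (\<forall>x. b x \<noteq> 0 \<longrightarrow> x \<in> \<Union>V \<and> ?G x = a x / b x)"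
      proof (rule rational_atI[OF ab(1-3)])
        fix x assume "b x \<noteq> 0"
        then have "x \<in> W \<inter> - {0}" "h x = a x / b x" using ab(4,5) by simp_all
        then show "x \<in> \<Union>V \<and> ?G x = a x / b x" using W(2,4) by auto
      qed
    qed
  qed
  then show ?thesis
    unfolding weighted_proj_def regular_quotient_space hom_class_def .
qed

section \<open>Monomials and the group action\<close>

lemma prod_power_int_distrib:
  fixes f :: "'a \<Rightarrow> 'b :: field"
  assumes "finite S"
  shows "(\<Prod>i\<in>S. f i) powi m = (\<Prod>i\<in>S. f i powi m)"
  using assms by (induction S rule: finite_induct) (auto simp: power_int_mult_distrib)

lemma power_int_sum_exponent:
  fixes x :: "'b :: field"
  assumes "finite S" "x \<noteq> 0"
  shows "x powi (\<Sum>i\<in>S. f i) = (\<Prod>i\<in>S. x powi f i)"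
  using assms by (induction S rule: finite_induct) (auto simp: power_int_add)

text \<open>Bezout for a finite family: the old coefficients are scaled by one coefficient of the
  two-term identity, and the new element receives the other.\<close>

lemma Gcd_eq_int_combination:
  fixes f :: "'a \<Rightarrow> int"
  assumes "finite S"
  shows "\<exists>w. (\<Sum>j\<in>S. w j * f j) = Gcd (f ` S)"
  using assms
proof (induction S rule: finite_induct)
  case empty
  show ?case by simp
next
  case (insert a S)
  then obtain w where w: "(\<Sum>j\<in>S. w j * f j) = Gcd (f ` S)" by blast
  obtain u v where uv: "u * f a + v * Gcd (f ` S) = gcd (f a) (Gcd (f ` S))"
    using bezout_int by blast
  have "(\<Sum>j\<in>S. (if j = a then u else v * w j) * f j) = (\<Sum>j\<in>S. v * (w j * f j))"
    using insert.hyps by (intro sum.cong) auto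
  then have "(\<Sum>j\<in>insert a S. (if j = a then u else v * w j) * f j) = Gcd (f ` insert a S)"
    using insert.hyps w uv by (simp add: sum_distrib_left[symmetric])
  then show ?case by (rule exI[of _ "\<lambda>j. if j = a then u else v * w j"])
qed

text \<open>Linear combinations of monomials, built one term at a time. The induction rule reduces a
  linear statement about polynomials to single monomials, and the presentation of a polynomial need
  not be unique.\<close>

inductive_set monomial_span :: "(complex ^ 'n \<Rightarrow> complex) set" where
  zero: "(\<lambda>y. 0) \<in> monomial_span"
| step: "f \<in> monomial_span \<Longrightarrow> (\<lambda>y. c * (\<Prod>j\<in>UNIV. y $ j ^ m j) + f y) \<in> monomial_span"

lemma monomial_span_add:
  assumes "f \<in> monomial_span" "g \<in> monomial_span"
  shows "(\<lambda>y. f y + g y) \<in> monomial_span"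
  using assms(1)
proof (induction rule: monomial_span.induct)
  case zero
  show ?case using assms(2) by simp
next
  case (step f c m)
  from monomial_span.step[OF step.IH, of c m] show ?case by (simp add: add.assoc)
qed

lemma monomial_span_monomial_mult:
  assumes "f \<in> monomial_span"
  shows "(\<lambda>y. c * (\<Prod>j\<in>UNIV. y $ j ^ m j) * f y) \<in> monomial_span"
  using assms
proof (induction rule: monomial_span.induct)
  case zero
  show ?case using monomial_span.zero by simp
next
  case (step f c' m')
  have "(\<lambda>y. (c * c') * (\<Prod>j\<in>UNIV. y $ j ^ (m j + m' j)) + c * (\<Prod>j\<in>UNIV. y $ j ^ m j) * f y)
      \<in> monomial_span"
    by (rule monomial_span.step[OF step.IH])
  then show ?case by (simp add: power_add prod.distrib algebra_simps)
qed

lemma monomial_span_mult: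
  assumes "f \<in> monomial_span" "g \<in> monomial_span"
  shows "(\<lambda>y. f y * g y) \<in> monomial_span"
  using assms(1)
proof (induction rule: monomial_span.induct)
  case zero
  show ?case using monomial_span.zero by simp
next
  case (step f c m)
  from monomial_span_add[OF monomial_span_monomial_mult[OF assms(2), of c m] step.IH]
  show ?case by (simp add: distrib_right)
qed

lemma poly_functions_subset_monomial_span: "poly_functions \<subseteq> monomial_span"
proof
  fix f :: "complex ^ 'n \<Rightarrow> complex" assume "f \<in> poly_functions"
  then show "f \<in> monomial_span"
  proof (induction rule: poly_functions.induct)
    case (const c)
    from monomial_span.step[OF monomial_span.zero, of c "\<lambda>_. 0"] show ?case by simp
  next
    case (coord j)
    have "(\<Prod>i\<in>UNIV. y $ i ^ (if i = j then 1 else 0)) = y $ j" for y :: "complex ^ 'n"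
      by (subst prod.remove[of _ j]) auto
    with monomial_span.step[OF monomial_span.zero, of 1 "\<lambda>i. if i = j then 1 else 0"]
    show ?case by simp
  qed (auto intro: monomial_span_add monomial_span_mult)
qed

text \<open>The lift of the composite map to vectors; \<open>None\<close> carries the coordinate
  \<open>u\<^sub>0\<close>.\<close>

definition uhat :: "nat \<Rightarrow> int ^ 'n \<Rightarrow> complex ^ 'n \<Rightarrow> complex ^ 'n option" where
  "uhat d q' y = (\<chi> i. case i of None \<Rightarrow> (\<Prod>k\<in>UNIV. y $ k powi (q' $ k)) | Some i \<Rightarrow> y $ i ^ d)"

lemma uhat_nth [simp]:
  "uhat d q' y $ None = (\<Prod>k\<in>UNIV. y $ k powi (q' $ k))"
  "uhat d q' y $ Some i = y $ i ^ d"
  by (simp_all add: uhat_def)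

text \<open>The composite map and the group depend on the matrix only through \<open>d\<close> and
  \<open>q'\<close>, so the geometry is developed for these alone.\<close>

locale fermat_weights =
  fixes d :: nat and z :: complex and q' :: "int ^ 'n"
  assumes d_pos: "0 < d" and root: "primitive_root d z"
    and sum_q': "(\<Sum>j\<in>UNIV. q' $ j) = int d" and q'_pos: "\<And>k. 0 < q' $ k"
begin

section \<open>Powers of the primitive root of unity\<close>

lemma z_nonzero: "z \<noteq> 0"
  using root d_pos unfolding primitive_root_def by (metis power_eq_0_iff zero_neq_one)

lemma z_powi_eq_1_iff: "z powi m = 1 \<longleftrightarrow> int d dvd m"
proof
  assume "int d dvd m"
  then obtain k where "m = int d * k" by blast
  then show "z powi m = 1"
    using root by (simp add: power_int_mult primitive_root_def)
next
  assume *: "z powi m = 1"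
  define r where "r = nat (m mod int d)"
  have "m = int d * (m div int d) + int r"
    using d_pos by (simp add: r_def)
  then have "z powi m = z powi (int d * (m div int d) + int r)" by (rule arg_cong)
  also have "\<dots> = (z ^ d) powi (m div int d) * z ^ r"
    using z_nonzero by (simp add: power_int_add power_int_mult)
  finally have "z powi m = (z ^ d) powi (m div int d) * z ^ r" .
  then have "z ^ r = 1" using * root by (simp add: primitive_root_def)
  moreover have "r < d" using d_pos by (simp add: r_def nat_less_iff)
  ultimately have "r = 0" using root unfolding primitive_root_def by auto
  moreover have "0 \<le> m mod int d" using d_pos by simp
  ultimately show "int d dvd m" by (simp add: r_def dvd_eq_mod_eq_0)
qed

lemma z_powi_eq_iff: "z powi m = z powi m' \<longleftrightarrow> int d dvd (m - m')"
  using z_powi_eq_1_iff[of "m - m'"] z_nonzero by (simp add: power_int_diff)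

text \<open>By counting: the powers with exponent below \<open>d\<close> are \<open>d\<close>
  distinct roots of unity, and there are only \<open>d\<close> of them.\<close>

lemma root_of_unity_powi:
  assumes "x ^ d = 1"
  obtains l where "x = z powi l"
proof -
  have "inj_on (\<lambda>l. z ^ l) {..<d}"
  proof (rule inj_onI)
    fix a b assume ab: "a \<in> {..<d}" "b \<in> {..<d}" "z ^ a = z ^ b"
    then have "int d dvd (int a - int b)" by (simp flip: z_powi_eq_iff)
    moreover from this have "int d dvd (int b - int a)" by (simp add: dvd_diff_commute)
    ultimately show "a = b"
      using ab(1,2) zdvd_imp_le[of "int d" "int a - int b"] zdvd_imp_le[of "int d" "int b - int a"]
      by (cases a b rule: linorder_cases) auto
  qed
  then have "card ((\<lambda>l. z ^ l) ` {..<d}) = d" by (simp add: card_image)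
  moreover have "(\<lambda>l. z ^ l) ` {..<d} \<subseteq> {x. x ^ d = 1}"
    using root by (auto simp: primitive_root_def power_commutes simp flip: power_mult)
      (metis mult.commute power_mult power_one)
  moreover have "card {x :: complex. x ^ d = 1} = d" "finite {x :: complex. x ^ d = 1}"
    using card_roots_unity_eq finite_roots_unity d_pos by auto
  ultimately have "(\<lambda>l. z ^ l) ` {..<d} = {x. x ^ d = 1}"
    by (metis card_subset_eq)
  then obtain l where "x = z ^ l" using assms by blast
  then show thesis using that[of "int l"] by simp
qed

section \<open>The greatest common divisor of the weights and the double annihilator\<close>

definition weight_gcd :: int where "weight_gcd = Gcd (range (\<lambda>j. q' $ j))"

lemma weight_gcd_dvd_q': "weight_gcd dvd q' $ j"
  unfolding weight_gcd_def by (rule Gcd_dvd) simp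

lemma weight_gcd_dvd_d: "weight_gcd dvd int d"
  using weight_gcd_dvd_q' sum_q' by (metis dvd_sum)

lemma weight_gcd_pos: "0 < weight_gcd"
proof -
  have "weight_gcd \<noteq> 0" using weight_gcd_dvd_d d_pos by auto
  moreover have "weight_gcd \<ge> 0" unfolding weight_gcd_def by simp
  ultimately show ?thesis by simp
qed

lemma weight_gcd_combination: obtains w where "(\<Sum>j\<in>UNIV. w j * q' $ j) = weight_gcd"
  using Gcd_eq_int_combination[of UNIV "\<lambda>j. q' $ j"] unfolding weight_gcd_def by auto

text \<open>The subgroup of \<open>(\<int>/d\<int>)\<^sup>n\<close> generated by \<open>q'\<close>
  is recovered from the vectors orthogonal to it. Two kinds of test vectors suffice, both built from
  a Bezout combination \<open>w\<close> with
  \<open>\<Sum>j. w j * q' $ j = weight_gcd\<close>.\<close>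

lemma double_annihilator:
  assumes "\<And>k. int d dvd (\<Sum>j\<in>UNIV. k j * q' $ j) \<Longrightarrow> int d dvd (\<Sum>j\<in>UNIV. k j * m j)"
  obtains t r where "\<forall>j. m j = t * q' $ j + int d * r j"
proof -
  obtain w where w: "(\<Sum>j\<in>UNIV. w j * q' $ j) = weight_gcd" by (rule weight_gcd_combination)
  \<comment> \<open>First test vector: \<open>d/g\<close> times \<open>w\<close> pairs with
    \<open>q'\<close> to exactly \<open>d\<close>. Its pairing with \<open>m\<close> shows that
    \<open>g\<close> divides \<open>\<Sum>j. w j * m j\<close>, and the quotient is the multiplier
    \<open>t\<close>.\<close>
  have "(\<Sum>j\<in>UNIV. (int d div weight_gcd * w j) * q' $ j) = int d div weight_gcd * weight_gcd"
    unfolding w[symmetric] by (simp add: sum_distrib_left mult.assoc)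
  also have "\<dots> = int d" using weight_gcd_dvd_d by simp
  finally have "int d dvd (\<Sum>j\<in>UNIV. (int d div weight_gcd * w j) * m j)" by (intro assms) simp
  also have "(\<Sum>j\<in>UNIV. (int d div weight_gcd * w j) * m j) = int d div weight_gcd * (\<Sum>j\<in>UNIV. w j * m j)"
    by (simp add: sum_distrib_left mult.assoc)
  finally have "int d div weight_gcd * weight_gcd dvd int d div weight_gcd * (\<Sum>j\<in>UNIV. w j * m j)"
    using weight_gcd_dvd_d by simp
  moreover have "int d div weight_gcd \<noteq> 0"
    using weight_gcd_dvd_d d_pos by (metis dvd_div_eq_0_iff of_nat_0_less_iff less_irrefl)
  ultimately have "weight_gcd dvd (\<Sum>j\<in>UNIV. w j * m j)" by simp
  then obtain t where t: "(\<Sum>j\<in>UNIV. w j * m j) = weight_gcd * t" by blast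
  have "\<exists>r. m j = t * q' $ j + int d * r" for j
  proof -
    \<comment> \<open>Second test vector: the \<open>j\<close>-th unit vector corrected by a
      multiple of \<open>w\<close> so that its pairing with \<open>q'\<close> is 0. Its pairing with
      \<open>m\<close> is \<open>m j - t * q' $ j\<close>.\<close>
    let ?k = "\<lambda>i. (if i = j then 1 else 0) - q' $ j div weight_gcd * w i"
    have k: "(\<Sum>i\<in>UNIV. ?k i * f i) = f j - q' $ j div weight_gcd * (\<Sum>i\<in>UNIV. w i * f i)" for f
    proof -
      have "(\<Sum>i\<in>UNIV. ?k i * f i)
          = (\<Sum>i\<in>UNIV. if i = j then f i else 0) - (\<Sum>i\<in>UNIV. q' $ j div weight_gcd * (w i * f i))"
        unfolding sum_subtractf[symmetric] by (intro sum.cong) (auto simp: algebra_simps)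
      then show ?thesis by (simp add: sum_distrib_left)
    qed
    have "int d dvd (\<Sum>i\<in>UNIV. ?k i * m i)"
      by (rule assms) (use weight_gcd_dvd_q' in \<open>simp add: k w\<close>)
    then have "int d dvd m j - q' $ j div weight_gcd * (weight_gcd * t)" by (simp add: k t)
    also have "q' $ j div weight_gcd * (weight_gcd * t) = t * q' $ j"
      using weight_gcd_dvd_q'[of j] by (metis dvd_div_mult_self mult.assoc mult.commute)
    finally show ?thesis by (metis add_diff_cancel_left' diff_add_cancel dvdE add.commute)
  qed
  then have "\<forall>j. \<exists>r. m j = t * q' $ j + int d * r" by (rule allI)
  then obtain r where "\<forall>j. m j = t * q' $ j + int d * r j" by (rule choice[THEN exE])
  then show thesis by (rule that)
qed

text \<open>Reduced exponents, one for each element of the diagonal group before scalars are divided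
  out, so that sums over the group are finite and count each element once.\<close>

definition annihilator :: "(int ^ 'n) set" where
  "annihilator = {k. (\<forall>j. 0 \<le> k $ j \<and> k $ j < int d) \<and> int d dvd (\<Sum>j\<in>UNIV. k $ j * q' $ j)}"

lemma finite_annihilator: "finite annihilator"
proof (rule finite_subset)
  show "annihilator \<subseteq> vec_lambda ` (PiE UNIV (\<lambda>_. {0..<int d}))"
  proof
    fix k assume "k \<in> annihilator"
    then have "vec_nth k \<in> PiE UNIV (\<lambda>_. {0..<int d})" by (auto simp: annihilator_def)
    then have "vec_lambda (vec_nth k) \<in> vec_lambda ` (PiE UNIV (\<lambda>_. {0..<int d}))" by (rule imageI)
    then show "k \<in> vec_lambda ` (PiE UNIV (\<lambda>_. {0..<int d}))" by simp
  qed
  show "finite (vec_lambda ` (PiE UNIV (\<lambda>_ :: 'n. {0..<int d})))"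
    by (intro finite_imageI finite_PiE) auto
qed

lemma zero_in_annihilator: "0 \<in> annihilator"
  using d_pos by (simp add: annihilator_def)

lemma sum_mod_dvd_iff:
  "int d dvd (\<Sum>j\<in>UNIV. (f j mod int d) * h j) \<longleftrightarrow> int d dvd (\<Sum>j\<in>UNIV. f j * h j)"
proof -
  have "(\<Sum>j\<in>UNIV. (f j mod int d) * h j) mod int d = (\<Sum>j\<in>UNIV. f j * h j) mod int d"
    by (subst (1 2) mod_sum_eq[symmetric]) (simp add: mod_mult_left_eq)
  then show ?thesis by (simp add: dvd_eq_mod_eq_0)
qed

lemma annihilator_shift:
  assumes "k \<in> annihilator" "int d dvd (\<Sum>j\<in>UNIV. k0 j * q' $ j)"
  shows "(\<chi> j. (k $ j + k0 j) mod int d) \<in> annihilator"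
proof -
  have "int d dvd (\<Sum>j\<in>UNIV. (k $ j + k0 j) * q' $ j)"
    using assms by (simp add: annihilator_def distrib_right sum.distrib)
  then show ?thesis using d_pos by (simp add: annihilator_def sum_mod_dvd_iff)
qed

text \<open>Orthogonality of characters: translation by \<open>k0\<close> permutes the group and
  multiplies the sum by \<open>z powi (\<Sum>j. k0 j * m j)\<close>, which differs from 1.\<close>

lemma sum_character_annihilator:
  assumes "int d dvd (\<Sum>j\<in>UNIV. k0 j * q' $ j)" "\<not> int d dvd (\<Sum>j\<in>UNIV. k0 j * m j)"
  shows "(\<Sum>k\<in>annihilator. z powi (\<Sum>j\<in>UNIV. k $ j * m j)) = 0"
proof -
  let ?c = "\<lambda>k :: 'n \<Rightarrow> int. \<Sum>j\<in>UNIV. k j * m j"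
  have "(\<Sum>k\<in>annihilator. z powi ?c (vec_nth k)) = (\<Sum>k\<in>annihilator. z powi (?c (vec_nth k) + ?c k0))"
  proof (rule sum.reindex_bij_witness[of _ "\<lambda>k. \<chi> j. (k $ j + k0 j) mod int d"
        "\<lambda>k. \<chi> j. (k $ j + - k0 j) mod int d"])
    fix k assume k: "k \<in> annihilator"
    then have r: "k $ j mod int d = k $ j" for j by (simp add: annihilator_def)
    show "(\<chi> j. ((\<chi> j. (k $ j + - k0 j) mod int d) $ j + k0 j) mod int d) = k"
      by (simp add: vec_eq_iff mod_add_left_eq r)
    show "(\<chi> j. (k $ j + - k0 j) mod int d) \<in> annihilator"
      by (rule annihilator_shift[OF k]) (use assms(1) in \<open>simp add: sum_negf\<close>)
    have "int d dvd (\<Sum>j\<in>UNIV. ((k $ j + - k0 j) mod int d + k0 j - k $ j) * m j)"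
    proof (intro dvd_sum dvd_mult2)
      fix j
      have "(k $ j + - k0 j) mod int d = (k $ j - k0 j) - int d * ((k $ j - k0 j) div int d)"
        by (simp add: minus_mult_div_eq_mod)
      then show "int d dvd (k $ j + - k0 j) mod int d + k0 j - k $ j" by simp
    qed
    then show "z powi (?c (vec_nth (\<chi> j. (k $ j + - k0 j) mod int d)) + ?c k0) = z powi ?c (vec_nth k)"
      unfolding z_powi_eq_iff
      by (simp add: sum.distrib[symmetric] sum_subtractf[symmetric] algebra_simps)
  next
    fix k assume k: "k \<in> annihilator"
    then have r: "k $ j mod int d = k $ j" for j by (simp add: annihilator_def)
    show "(\<chi> j. ((\<chi> j. (k $ j + k0 j) mod int d) $ j + - k0 j) mod int d) = k"
      by (simp add: vec_eq_iff mod_diff_left_eq r)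
    show "(\<chi> j. (k $ j + k0 j) mod int d) \<in> annihilator"
      by (rule annihilator_shift[OF k assms(1)])
  qed
  also have "\<dots> = z powi ?c k0 * (\<Sum>k\<in>annihilator. z powi ?c (vec_nth k))"
    using z_nonzero by (simp add: power_int_add sum_distrib_left mult.commute)
  finally have "(1 - z powi ?c k0) * (\<Sum>k\<in>annihilator. z powi ?c (vec_nth k)) = 0"
    by (simp add: left_diff_distrib)
  then show ?thesis using assms(2) by (auto simp: z_powi_eq_1_iff[symmetric])
qed

section \<open>Averages of polynomials over the diagonal group\<close>

lemma g_map_nth [simp]: "g_map z k y $ j = z powi (k $ j) * y $ j"
  by (simp add: g_map_def)

lemma monomial_g_map:
  "(\<Prod>j\<in>UNIV. g_map z k y $ j ^ m j) = z powi (\<Sum>j\<in>UNIV. k $ j * int (m j)) * (\<Prod>j\<in>UNIV. y $ j ^ m j)"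
  by (simp add: power_int_sum_exponent z_nonzero power_mult_distrib prod.distrib power_int_mult)

text \<open>A monomial either averages to zero over the finite group or is itself a Laurent monomial in the
  coordinates of \<open>uhat\<close>.\<close>

lemma average_factors_through_uhat:
  assumes "P \<in> poly_functions"
  obtains Q where "regular affine_space {u. \<forall>i. u $ i \<noteq> 0} Q"
    "\<forall>y. (\<forall>j. y $ j \<noteq> 0) \<longrightarrow> (\<Sum>k\<in>annihilator. P (g_map z k y)) = Q (uhat d q' y)"
proof -
  let ?T = "{u :: complex ^ 'n option. \<forall>i. u $ i \<noteq> 0}"
  have mono: "\<exists>Q. regular affine_space ?T Q \<and> (\<forall>y. (\<forall>j. y $ j \<noteq> 0) \<longrightarrow>
      (\<Sum>k\<in>annihilator. \<Prod>j\<in>UNIV. g_map z k y $ j ^ m j) = Q (uhat d q' y))" for m :: "'n \<Rightarrow> nat"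
  \<comment> \<open>The split is whether the character attached to \<open>m\<close> is nontrivial on
    the group, where the average vanishes, or trivial, where the monomial is invariant.\<close>
  proof (cases "\<exists>k. int d dvd (\<Sum>j\<in>UNIV. k j * q' $ j) \<and> \<not> int d dvd (\<Sum>j\<in>UNIV. k j * int (m j))")
    case True
    then obtain k0 where "int d dvd (\<Sum>j\<in>UNIV. k0 j * q' $ j)"
      "\<not> int d dvd (\<Sum>j\<in>UNIV. k0 j * int (m j))" by (elim exE conjE)
    then have "(\<Sum>k\<in>annihilator. z powi (\<Sum>j\<in>UNIV. k $ j * int (m j))) = 0"
      by (rule sum_character_annihilator)
    then have "(\<Sum>k\<in>annihilator. \<Prod>j\<in>UNIV. g_map z k y $ j ^ m j) = 0" for y
      unfolding monomial_g_map sum_distrib_right[symmetric] by simp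
    then show ?thesis
      by (intro exI[of _ "\<lambda>u. 0"]) (auto intro: regular_affine_const zariski_open_torus)
  next
    case False
    then have F: "int d dvd (\<Sum>j\<in>UNIV. k j * int (m j))"
      if "int d dvd (\<Sum>j\<in>UNIV. k j * q' $ j)" for k using that by metis
    obtain t r where m: "\<forall>j. int (m j) = t * q' $ j + int d * r j"
      using double_annihilator[OF F] .
    \<comment> \<open>The exponents \<open>t\<close> and \<open>r j\<close> of
      \<open>double_annihilator\<close> may be negative, so \<open>?Q\<close> is a Laurent monomial
      and regular only where all coordinates are nonzero.\<close>
    let ?Q = "\<lambda>u :: complex ^ 'n option. of_nat (card annihilator) * (u $ None powi t * (\<Prod>j\<in>UNIV. u $ Some j powi r j))"
    have "regular affine_space ?T ?Q"
      by (intro regular_affine_mult regular_affine_const zariski_open_torus regular_affine_prod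
          regular_affine_power_int regular_affine_poly poly_functions.coord) auto
    moreover have "(\<Sum>k\<in>annihilator. \<Prod>j\<in>UNIV. g_map z k y $ j ^ m j) = ?Q (uhat d q' y)" if y: "\<forall>j. y $ j \<noteq> 0" for y
    proof -
      have "z powi (\<Sum>j\<in>UNIV. k $ j * int (m j)) = 1" if "k \<in> annihilator" for k
        unfolding z_powi_eq_1_iff by (rule F) (use that in \<open>simp add: annihilator_def\<close>)
      then have "(\<Sum>k\<in>annihilator. \<Prod>j\<in>UNIV. g_map z k y $ j ^ m j) = of_nat (card annihilator) * (\<Prod>j\<in>UNIV. y $ j ^ m j)"
        unfolding monomial_g_map by simp
      also have "(\<Prod>j\<in>UNIV. y $ j ^ m j) = (\<Prod>j\<in>UNIV. (y $ j powi q' $ j) powi t * (y $ j ^ d) powi r j)"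
      proof (rule prod.cong[OF refl])
        fix j
        have "y $ j ^ m j = y $ j powi (q' $ j * t + int d * r j)"
          unfolding mult.commute[of _ t] m[rule_format, symmetric] by simp
        then show "y $ j ^ m j = (y $ j powi q' $ j) powi t * (y $ j ^ d) powi r j"
          using y by (simp add: power_int_add power_int_mult)
      qed
      finally show ?thesis by (simp add: prod.distrib prod_power_int_distrib)
    qed
    ultimately show ?thesis by (intro exI[of _ ?Q] conjI allI impI)
  qed
  have "P \<in> monomial_span" using assms poly_functions_subset_monomial_span by blast
  then have "\<exists>Q. regular affine_space ?T Q \<and> (\<forall>y. (\<forall>j. y $ j \<noteq> 0) \<longrightarrow>
      (\<Sum>k\<in>annihilator. P (g_map z k y)) = Q (uhat d q' y))"
  proof (induction rule: monomial_span.induct)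
    case zero
    show ?case by (intro exI[of _ "\<lambda>u. 0"]) (auto intro: regular_affine_const zariski_open_torus)
  next
    case (step f c m)
    obtain Q where Q: "regular affine_space ?T Q"
      "\<forall>y. (\<forall>j. y $ j \<noteq> 0) \<longrightarrow> (\<Sum>k\<in>annihilator. f (g_map z k y)) = Q (uhat d q' y)"
      using step.IH by (elim exE conjE)
    obtain Q' where Q': "regular affine_space ?T Q'" "\<forall>y. (\<forall>j. y $ j \<noteq> 0) \<longrightarrow>
      (\<Sum>k\<in>annihilator. \<Prod>j\<in>UNIV. g_map z k y $ j ^ m j) = Q' (uhat d q' y)"
      using mono[of m] by (elim exE conjE)
    have "regular affine_space ?T (\<lambda>u. c * Q' u + Q u)"
      by (intro regular_affine_add regular_affine_mult regular_affine_const zariski_open_torus Q Q')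
    moreover have "\<forall>y. (\<forall>j. y $ j \<noteq> 0) \<longrightarrow>
        (\<Sum>k\<in>annihilator. c * (\<Prod>j\<in>UNIV. g_map z k y $ j ^ m j) + f (g_map z k y)) = c * Q' (uhat d q' y) + Q (uhat d q' y)"
    proof (intro allI impI)
      fix y :: "complex ^ 'n" assume y: "\<forall>j. y $ j \<noteq> 0"
      show "(\<Sum>k\<in>annihilator. c * (\<Prod>j\<in>UNIV. g_map z k y $ j ^ m j) + f (g_map z k y)) = c * Q' (uhat d q' y) + Q (uhat d q' y)"
        unfolding sum.distrib sum_distrib_left[symmetric]
          mp[OF spec[OF Q(2)] y] mp[OF spec[OF Q'(2)] y] ..
    qed
    ultimately show ?case by (intro exI[of _ "\<lambda>u. c * Q' u + Q u"] conjI)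
  qed
  then show thesis by (elim exE conjE) (rule that)
qed

end

section \<open>The torus part of the Fermat variety\<close>

lemma torus_nonzero: "\<forall>j. y $ j \<noteq> 0 \<Longrightarrow> y \<noteq> (0 :: complex ^ 'm)"
  by auto

context fermat_weights
begin

definition fermat_cone :: "(complex ^ 'n) set" where
  "fermat_cone = {y. y \<noteq> 0 \<and> (\<Sum>i\<in>UNIV. y $ i ^ d) = 0}"

definition torus_cone :: "(complex ^ 'n) set" where
  "torus_cone = {y. (\<forall>j. y $ j \<noteq> 0) \<and> (\<Sum>i\<in>UNIV. y $ i ^ d) = 0}"

definition torus_part :: "(complex ^ 'n) set set" where
  "torus_part = hom_class ` torus_cone"

lemma torus_cone_subset: "torus_cone \<subseteq> fermat_cone"
  by (auto simp: torus_cone_def fermat_cone_def)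

lemma sum_powers_smult:
  fixes y :: "complex ^ 'n"
  shows "(\<Sum>i\<in>UNIV. (l *s y) $ i ^ d) = l ^ d * (\<Sum>i\<in>UNIV. y $ i ^ d)"
  by (simp add: power_mult_distrib sum_distrib_left)

lemma fermat_points_alt:
  "{p \<in> points proj_space. \<forall>y\<in>p. (\<Sum>i\<in>UNIV. y $ i ^ d) = 0} = hom_class ` fermat_cone"
proof (intro equalityI subsetI)
  fix p :: "(complex ^ 'n) set"
  assume p: "p \<in> {p \<in> points proj_space. \<forall>y\<in>p. (\<Sum>i\<in>UNIV. y $ i ^ d) = 0}"
  then have "p \<in> points proj_space" by simp
  then obtain y where y: "y \<noteq> 0" "p = hom_class y" by (rule points_proj_spaceE)
  then have "y \<in> fermat_cone"
    using p self_in_hom_class[OF y(1)] by (simp add: fermat_cone_def)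
  then show "p \<in> hom_class ` fermat_cone" using y by simp
next
  fix p :: "(complex ^ 'n) set"
  assume "p \<in> hom_class ` fermat_cone"
  then obtain y where y: "y \<noteq> 0" "(\<Sum>i\<in>UNIV. y $ i ^ d) = 0" "p = hom_class y"
    unfolding fermat_cone_def by blast
  have "(\<Sum>i\<in>UNIV. x $ i ^ d) = 0" if x: "x \<in> hom_class y" for x
  proof -
    obtain l where "x = l *s y" using x unfolding hom_class_eq[OF y(1)] by blast
    then show ?thesis by (simp only: sum_powers_smult y(2) mult_zero_right)
  qed
  then show "p \<in> {p \<in> points proj_space. \<forall>y\<in>p. (\<Sum>i\<in>UNIV. y $ i ^ d) = 0}"
    using y hom_class_in_points[OF y(1)] by simp
qed

lemma points_fermat: "points (fermat d) = hom_class ` fermat_cone"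
proof -
  have "points (fermat d) = points proj_space \<inter> hom_class ` fermat_cone"
    unfolding fermat_def fermat_points_alt by simp
  moreover have "hom_class ` fermat_cone \<subseteq> points proj_space"
    by (auto simp: fermat_cone_def hom_class_in_points)
  ultimately show ?thesis by blast
qed

lemma fermat_eq: "fermat d = subspace_of proj_space (points (fermat d) :: (complex ^ 'n) set set)"
  unfolding points_fermat unfolding fermat_def fermat_points_alt ..

lemma openin_fermat:
  fixes U :: "(complex ^ 'n) set set"
  shows "openin (topo (fermat d)) U \<longleftrightarrow> (\<exists>V. openin (topo proj_space) V \<and> U = V \<inter> points (fermat d))"
  by (subst fermat_eq) (auto simp: openin_subtopology)

lemma fermat_cone_smult: "y \<in> fermat_cone \<Longrightarrow> l \<noteq> 0 \<Longrightarrow> l *s y \<in> fermat_cone"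
  unfolding fermat_cone_def mem_Collect_eq sum_powers_smult by simp

lemma torus_cone_smult: "y \<in> torus_cone \<Longrightarrow> l \<noteq> 0 \<Longrightarrow> l *s y \<in> torus_cone"
  unfolding torus_cone_def mem_Collect_eq sum_powers_smult by simp

lemma torus_cone_nth: "y \<in> torus_cone \<Longrightarrow> y $ j \<noteq> 0"
  by (simp add: torus_cone_def)

lemma torus_cone_nonzero: "y \<in> torus_cone \<Longrightarrow> y \<noteq> 0"
  using torus_cone_subset by (auto simp: fermat_cone_def)

lemma torus_part_subset: "torus_part \<subseteq> points (fermat d)"
  unfolding torus_part_def points_fermat using torus_cone_subset by blast

lemma torus_partE:
  assumes "p \<in> torus_part"
  obtains y where "y \<in> torus_cone" "p = hom_class y"
  using assms unfolding torus_part_def by blast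

definition torus_points :: "(complex ^ 'n) set set" where
  "torus_points = hom_class ` {y. \<forall>j. y $ j \<noteq> 0}"

lemma torus_part_eq: "torus_part = torus_points \<inter> points (fermat d)"
proof (intro equalityI subsetI IntI)
  fix p assume "p \<in> torus_points \<inter> points (fermat d)"
  then obtain y x where y: "\<forall>j. y $ j \<noteq> 0" "p = hom_class y" and x: "x \<in> fermat_cone" "p = hom_class x"
    unfolding torus_points_def points_fermat by blast
  have "hom_class x = hom_class y" using x y by simp
  then obtain l where l: "l \<noteq> 0" "y = l *s x"
    using hom_class_eq_iff[of x y] x(1) torus_nonzero[OF y(1)] by (auto simp: fermat_cone_def)
  then have "y \<in> fermat_cone" using fermat_cone_smult[OF x(1)] by simp
  then have "y \<in> torus_cone" using y(1) by (simp add: fermat_cone_def torus_cone_def)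
  then show "p \<in> torus_part" using y(2) by (simp add: torus_part_def)
qed (use torus_part_subset in \<open>auto simp: torus_part_def torus_points_def torus_cone_def\<close>)

lemma openin_torus_points: "openin (topo proj_space) torus_points"
  unfolding torus_points_def
  by (rule openin_image_hom_class[OF zariski_open_torus]) auto

lemma openin_torus_part: "openin (topo (fermat d)) torus_part"
  unfolding openin_fermat torus_part_eq using openin_torus_points by blast

text \<open>A point of the Fermat variety is the limit for \<open>t \<rightarrow> 0\<close> of points of the torus part: put \<open>t\<close>
  into its zero coordinates and restore the equation by moving one nonzero coordinate. Polynomials
  are continuous for the classical topology, so classical limits are Zariski limits.\<close>

lemma torus_cone_dense:
  assumes x: "x \<in> fermat_cone" and b: "b \<in> poly_functions" "b x \<noteq> 0"
  obtains y where "y \<in> torus_cone" "b y \<noteq> 0"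
proof -
  have "x \<noteq> 0" using x by (simp add: fermat_cone_def)
  then obtain i where i: "x $ i \<noteq> 0" by (auto simp: vec_eq_iff)
  \<comment> \<open>Replacing the \<open>N\<close> zero coordinates by \<open>t\<close> adds
    \<open>N * t ^ d\<close> to the Fermat sum. Multiplying \<open>x $ i\<close> by a
    \<open>d\<close>-th root of \<open>e t\<close> subtracts the same amount. Since
    \<open>e 0 = 1\<close>, the principal logarithm is continuous there and the chosen root tends to
    1.\<close>
  define N :: complex where "N = of_nat (card {j. x $ j = 0})"
  define e where "e t = 1 - N * (t / x $ i) ^ d" for t
  define \<gamma> :: "complex \<Rightarrow> complex ^ 'n" where
    "\<gamma> t = (\<chi> j. if x $ j = 0 then t else if j = i then x $ j * exp (Ln (e t) / of_nat d) else x $ j)" for t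
  have e0: "e 0 = 1" using d_pos by (simp add: e_def)
  have ce: "isCont e 0" unfolding e_def using i by (intro continuous_intros) auto
  have g0: "\<gamma> 0 = x" using e0 by (simp add: \<gamma>_def vec_eq_iff)
  have "(\<gamma> \<longlongrightarrow> x) (at 0)"
  proof (rule vec_tendstoI)
    fix j
    have "((\<lambda>t. x $ j * exp (Ln (e t) / of_nat d)) \<longlongrightarrow> x $ j * exp (Ln (e 0) / of_nat d)) (at 0)"
      using ce d_pos by (intro tendsto_intros) (auto simp: e0 isCont_def)
    then show "((\<lambda>t. \<gamma> t $ j) \<longlongrightarrow> x $ j) (at 0)"
      by (cases "x $ j = 0"; cases "j = i") (auto simp: \<gamma>_def e0)
  qed
  moreover have "isCont b x"
    using continuous_on_poly_function[OF b(1)] by (simp add: continuous_on_eq_continuous_at)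
  ultimately have "((\<lambda>t. b (\<gamma> t)) \<longlongrightarrow> b x) (at 0)"
    by (rule isCont_tendsto_compose[rotated])
  then have "\<forall>\<^sub>F t in at 0. b (\<gamma> t) \<noteq> 0" using b(2) by (rule tendsto_imp_eventually_ne)
  moreover have "\<forall>\<^sub>F t in at 0. e t \<noteq> 0"
    using ce e0 unfolding isCont_def by (intro tendsto_imp_eventually_ne) auto
  moreover have "\<forall>\<^sub>F t in at (0::complex). t \<noteq> 0" by (rule eventually_neq_at_within)
  ultimately have "\<forall>\<^sub>F t in at 0. b (\<gamma> t) \<noteq> 0 \<and> e t \<noteq> 0 \<and> t \<noteq> 0"
    by (intro eventually_conj)
  then obtain t where t: "b (\<gamma> t) \<noteq> 0" "e t \<noteq> 0" "t \<noteq> 0"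
    using eventually_happens'[OF at_neq_bot] by blast
  have rt: "exp (Ln (e t) / of_nat d) ^ d = e t"
    using t(2) d_pos by (simp flip: exp_of_nat_mult)
  have ei: "x $ i ^ d * e t = x $ i ^ d - N * t ^ d"
    using i by (simp add: e_def power_divide right_diff_distrib)
  have "\<gamma> t $ j ^ d = x $ j ^ d + (if x $ j = 0 then t ^ d else 0) - (if j = i then N * t ^ d else 0)" for j
    using i d_pos rt ei by (cases "x $ j = 0"; cases "j = i") (auto simp: \<gamma>_def power_mult_distrib)
  then have "(\<Sum>j\<in>UNIV. \<gamma> t $ j ^ d) = (\<Sum>j\<in>UNIV. x $ j ^ d) + (\<Sum>j\<in>UNIV. if x $ j = 0 then t ^ d else 0) - N * t ^ d"
    by (simp add: sum.distrib sum_subtractf)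
  also have "(\<Sum>j\<in>UNIV. if x $ j = 0 then t ^ d else 0) = N * t ^ d"
    by (simp add: sum.If_cases N_def)
  finally have "(\<Sum>j\<in>UNIV. \<gamma> t $ j ^ d) = 0" using x by (simp add: fermat_cone_def)
  moreover have "\<forall>j. \<gamma> t $ j \<noteq> 0" using t(3) by (simp add: \<gamma>_def)
  ultimately show thesis using t(1) by (intro that[of "\<gamma> t"]) (simp_all add: torus_cone_def)
qed

lemma dense_open_torus_part: "dense_open (fermat d) torus_part"
proof (rule dense_openI[OF openin_torus_part])
  fix U :: "(complex ^ 'n) set set"
  assume "openin (topo (fermat d)) U" "U \<noteq> {}"
  then obtain V p where V: "openin (topo proj_space) V" "U = V \<inter> points (fermat d)" and p: "p \<in> U"
    unfolding openin_fermat by blast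
  then obtain x where x: "x \<in> fermat_cone" "p = hom_class x" unfolding points_fermat by blast
  have V': "V \<subseteq> points proj_space" "zariski_open (\<Union>V)" using V(1) by (simp_all add: openin_proj_space)
  have "x \<in> \<Union>V"
    using mem_Union_proj[OF V'(1), of x] x p V(2) by (simp add: fermat_cone_def)
  then obtain b where b: "b \<in> poly_functions" "b x \<noteq> 0" "\<forall>y. b y \<noteq> 0 \<longrightarrow> y \<in> \<Union>V"
    by (rule zariski_openE[OF V'(2)])
  obtain y where y: "y \<in> torus_cone" "b y \<noteq> 0"
    by (rule torus_cone_dense[OF x(1) b(1,2)])
  have "hom_class y \<in> V"
    using mem_Union_proj[OF V'(1) torus_cone_nonzero[OF y(1)]] b(3) y(2) by simp
  moreover have "hom_class y \<in> torus_part" using y(1) by (simp add: torus_part_def)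
  ultimately show "torus_part \<inter> U \<noteq> {}" using V(2) torus_part_subset by blast
qed

section \<open>The composite monomial map\<close>

definition umap :: "(complex ^ 'n) set \<Rightarrow> (complex ^ 'n option) set" where
  "umap p = weighted_rel 1 `` (uhat d q' ` p)"

lemma uhat_nonzero:
  assumes "\<forall>j. y $ j \<noteq> 0"
  shows "uhat d q' y $ i \<noteq> 0" "uhat d q' y \<noteq> 0"
proof -
  show *: "uhat d q' y $ i \<noteq> 0" for i using assms by (cases i) auto
  then show "uhat d q' y \<noteq> 0" by (intro torus_nonzero allI)
qed

text \<open>The coordinate \<open>None\<close> has degree \<open>\<Sum>k. q' $ k = d\<close>, the
  same as the powers \<open>y $ i ^ d\<close>.\<close>

lemma uhat_smult:
  assumes "l \<noteq> 0"
  shows "uhat d q' (l *s y) = l ^ d *s uhat d q' y"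
proof -
  have "(\<Prod>k\<in>UNIV. l powi (q' $ k)) = l ^ d"
    using power_int_sum_exponent[of UNIV l "\<lambda>k. q' $ k"] assms by (simp add: sum_q')
  then have "uhat d q' (l *s y) $ i = (l ^ d *s uhat d q' y) $ i" for i
    by (cases i) (simp_all add: power_mult_distrib power_int_mult_distrib prod.distrib)
  then show ?thesis by (simp add: vec_eq_iff)
qed

lemma umap_hom_class:
  assumes y: "\<forall>j. y $ j \<noteq> 0"
  shows "umap (hom_class y) = hom_class (uhat d q' y)"
proof -
  have "umap (hom_class y) = (\<Union>x\<in>hom_class y. hom_class (uhat d q' x))"
    by (auto simp: umap_def hom_class_def)
  also have "\<dots> = (\<Union>x\<in>hom_class y. hom_class (uhat d q' y))"
  proof (rule SUP_cong[OF refl])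
    fix x assume "x \<in> hom_class y"
    then obtain l where l: "l \<noteq> 0" "x = l *s y"
      unfolding hom_class_eq[OF torus_nonzero[OF y]] by blast
    then show "hom_class (uhat d q' x) = hom_class (uhat d q' y)"
      by (simp add: uhat_smult hom_class_smult uhat_nonzero(2)[OF y])
  qed
  also have "\<dots> = hom_class (uhat d q' y)"
    using self_in_hom_class[OF torus_nonzero[OF y]] by blast
  finally show ?thesis .
qed

lemma regular_uhat_nth: "regular affine_space {y. \<forall>j. y $ j \<noteq> 0} (\<lambda>y. uhat d q' y $ i)"
proof (cases i)
  case None
  then show ?thesis
    by simp (intro regular_affine_prod zariski_open_torus regular_affine_power_int
        regular_affine_poly poly_functions.coord, auto)
next
  case (Some j)
  then show ?thesis
    by simp (intro regular_affine_power zariski_open_torus regular_affine_poly poly_functions.coord)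
qed

lemma umap_vimage_eq:
  assumes "V \<subseteq> points proj_space"
  shows "{p \<in> torus_points. umap p \<in> V} = hom_class ` {y \<in> {y. \<forall>j. y $ j \<noteq> 0}. uhat d q' y \<in> \<Union>V}"
proof -
  have "umap (hom_class y) \<in> V \<longleftrightarrow> uhat d q' y \<in> \<Union>V" if "\<forall>j. y $ j \<noteq> 0" for y
    unfolding umap_hom_class[OF that] mem_Union_proj[OF assms uhat_nonzero(2)[OF that]] ..
  then show ?thesis unfolding torus_points_def by blast
qed

lemma Union_umap_vimage:
  assumes "V \<subseteq> points proj_space"
  shows "\<Union>{p \<in> torus_points. umap p \<in> V} = {y \<in> {y. \<forall>j. y $ j \<noteq> 0}. uhat d q' y \<in> \<Union>V}"
  unfolding umap_vimage_eq[OF assms]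
proof (rule Union_image_hom_class)
  fix l :: complex and y :: "complex ^ 'n"
  assume l: "l \<noteq> 0" and y: "y \<in> {y \<in> {y. \<forall>j. y $ j \<noteq> 0}. uhat d q' y \<in> \<Union>V}"
  then have y': "\<forall>j. y $ j \<noteq> 0" "hom_class (uhat d q' y) \<in> V"
    using mem_Union_proj[OF assms] uhat_nonzero(2)[of y] by auto
  have ly: "\<forall>j. (l *s y) $ j \<noteq> 0" using l y'(1) by simp
  have "hom_class (uhat d q' (l *s y)) = hom_class (uhat d q' y)"
    using l by (simp add: uhat_smult hom_class_smult uhat_nonzero(2)[OF y'(1)])
  then have "uhat d q' (l *s y) \<in> \<Union>V"
    using y'(2) mem_Union_proj[OF assms uhat_nonzero(2)[OF ly]] by simp
  then show "l *s y \<in> {y \<in> {y. \<forall>j. y $ j \<noteq> 0}. uhat d q' y \<in> \<Union>V}" using ly by simp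
qed auto

lemma openin_umap_vimage:
  assumes "openin (topo proj_space) V"
  shows "openin (topo proj_space) {p \<in> torus_points. umap p \<in> V}"
proof -
  have V: "V \<subseteq> points proj_space" "zariski_open (\<Union>V)"
    using assms by (simp_all add: openin_proj_space)
  have "{p \<in> torus_points. umap p \<in> V} \<subseteq> points proj_space"
    using openin_subset[OF openin_torus_points] by blast
  then show ?thesis
    unfolding openin_proj_space Union_umap_vimage[OF V(1)]
    by (intro conjI zariski_open_vimage zariski_open_torus regular_uhat_nth V(2))
qed

lemma regular_umap_comp:
  assumes V: "openin (topo proj_space) V" and h: "regular proj_space V h"
  shows "regular proj_space {p \<in> torus_points. umap p \<in> V} (h \<circ> umap)"
proof -
  have V': "V \<subseteq> points proj_space" using V by (simp add: openin_proj_space)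
  have "regular affine_space {y \<in> {y. \<forall>j. y $ j \<noteq> 0}. uhat d q' y \<in> \<Union>V} (\<lambda>y. h (hom_class (uhat d q' y)))"
    by (rule regular_affine_compose[OF zariski_open_torus regular_uhat_nth])
      (use h regular_proj_space[OF V] in simp)
  then show ?thesis
    unfolding regular_proj_space[OF openin_umap_vimage[OF V]] Union_umap_vimage[OF V']
    by (rule iffD1[OF regular_affine_cong, rotated]) (simp add: umap_hom_class)
qed

text \<open>The target \<open>S\<close> is left free because two are needed: the closure of the
  image for the rational map, and the image itself for the isomorphism.\<close>

lemma morphism_umap:
  assumes S: "umap ` torus_part \<subseteq> S" "S \<subseteq> points proj_space"
  shows "morphism (subspace_of (fermat d) torus_part) (subspace_of proj_space S) umap"
proof -
  have pts: "points (subspace_of (fermat d) torus_part) = torus_part"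
    using torus_part_subset by auto
  have op: "openin (topo (fermat d)) {p \<in> torus_part. umap p \<in> V}" if "openin (topo proj_space) V" for V
    unfolding openin_fermat torus_part_eq
    using openin_umap_vimage[OF that] by (intro exI[of _ "{p \<in> torus_points. umap p \<in> V}"]) auto
  show ?thesis unfolding morphism_def
  proof (intro conjI allI impI)
    have "continuous_map (subtopology (topo (fermat d)) torus_part) (topo proj_space) umap"
      unfolding continuous_map_def
    proof (intro conjI allI impI)
      show "umap \<in> topspace (subtopology (topo (fermat d)) torus_part) \<rightarrow> points proj_space"
        using S by auto
      fix V assume "openin (topo proj_space) (V :: (complex ^ 'n option) set set)"
      then have "openin (topo (fermat d)) {p \<in> torus_part. umap p \<in> V}" by (rule op)
      then have "openin (subtopology (topo (fermat d)) torus_part) {p \<in> torus_part. umap p \<in> V}"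
        unfolding openin_subtopology by (intro exI conjI) auto
      then show "openin (subtopology (topo (fermat d)) torus_part)
          {x \<in> topspace (subtopology (topo (fermat d)) torus_part). umap x \<in> V}"
        using pts by simp
    qed
    then show "continuous_map (topo (subspace_of (fermat d) torus_part)) (topo (subspace_of proj_space S)) umap"
      using S by (auto simp: continuous_map_in_subtopology image_subset_iff)
  next
    fix V h
    assume V: "openin (topo (subspace_of proj_space S)) V \<and> regular (subspace_of proj_space S) V h"
    then have h: "regular (subspace_of proj_space S) V h" ..
    have "regular (subspace_of proj_space torus_part) {x \<in> torus_part. umap x \<in> V} (h \<circ> umap)"
      unfolding regular_subspace_of
    proof
      fix p assume p: "p \<in> {x \<in> torus_part. umap x \<in> V}"
      then have "umap p \<in> V" by simp
      then obtain W k where W: "openin (topo proj_space) W" "umap p \<in> W" "W \<inter> S \<subseteq> V"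
        "regular proj_space W k" "\<forall>x\<in>W \<inter> S. h x = k x"
        by (rule regular_subspace_ofE[OF h])
      have "(h \<circ> umap) x = (k \<circ> umap) x" if "x \<in> {p \<in> torus_points. umap p \<in> W} \<inter> torus_part" for x
        using that W(5) S(1) by auto
      moreover have "p \<in> {p \<in> torus_points. umap p \<in> W}"
        using p W(2) by (auto simp: torus_part_eq)
      moreover have "{p \<in> torus_points. umap p \<in> W} \<inter> torus_part \<subseteq> {x \<in> torus_part. umap x \<in> V}"
        using W(3) S(1) by auto
      ultimately show "\<exists>V' g. openin (topo proj_space) V' \<and> p \<in> V' \<and>
          V' \<inter> torus_part \<subseteq> {x \<in> torus_part. umap x \<in> V} \<and> regular proj_space V' g \<and>
          (\<forall>x\<in>V' \<inter> torus_part. (h \<circ> umap) x = g x)"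
        by (intro exI[of _ "{p \<in> torus_points. umap p \<in> W}"] exI[of _ "k \<circ> umap"] conjI ballI
            openin_umap_vimage regular_umap_comp W(1,4))
    qed
    then show "regular (subspace_of (fermat d) torus_part)
        {x \<in> points (subspace_of (fermat d) torus_part). umap x \<in> V} (h \<circ> umap)"
      unfolding pts
      by (subst fermat_eq, subst regular_subspace_of_subspace_of) (use torus_part_subset in auto)
  qed
qed

section \<open>Orbits\<close>

text \<open>The condition of \<open>annihilator\<close> without reduction modulo \<open>d\<close>,
  hence closed under addition and negation of integer vectors.\<close>

definition annihilates :: "int ^ 'n \<Rightarrow> bool" where
  "annihilates k \<longleftrightarrow> int d dvd (\<Sum>j\<in>UNIV. k $ j * q' $ j)"

lemma annihilates_add: "annihilates k \<Longrightarrow> annihilates l \<Longrightarrow> annihilates (k + l)"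
  by (simp add: annihilates_def distrib_right sum.distrib)

lemma annihilates_minus: "annihilates k \<Longrightarrow> annihilates (- k)"
  by (simp add: annihilates_def sum_negf)

lemma annihilates_zero: "annihilates 0"
  by (simp add: annihilates_def)

lemma annihilates_const: "annihilates (\<chi> j. c)"
  by (simp add: annihilates_def sum_distrib_left[symmetric] sum_q')

lemma g_map_g_map: "g_map z k (g_map z l y) = g_map z (k + l) y"
  by (simp add: vec_eq_iff power_int_add z_nonzero)

lemma g_map_comp: "g_map z k \<circ> g_map z l = g_map z (k + l)"
  by (rule ext) (simp add: g_map_g_map)

lemma g_map_zero [simp]: "g_map z 0 = id"
  by (rule ext) (simp add: vec_eq_iff)

lemma g_map_smult: "g_map z k (l *s y) = l *s g_map z k y"
  by (simp add: vec_eq_iff)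

lemma g_map_nonzero_iff: "g_map z k y = 0 \<longleftrightarrow> y = 0"
  using z_nonzero by (simp add: vec_eq_iff)

lemma g_map_power: "g_map z k y $ j ^ d = y $ j ^ d"
proof -
  have "(z powi (k $ j)) ^ d = 1"
    using z_powi_eq_1_iff[of "k $ j * int d"] by (simp add: power_int_mult)
  then show ?thesis by (simp add: power_mult_distrib)
qed

lemma g_map_fermat_cone: "y \<in> fermat_cone \<Longrightarrow> g_map z k y \<in> fermat_cone"
  unfolding fermat_cone_def mem_Collect_eq g_map_power g_map_nonzero_iff .

lemma g_map_torus_cone: "y \<in> torus_cone \<Longrightarrow> g_map z k y \<in> torus_cone"
  unfolding torus_cone_def mem_Collect_eq g_map_power using z_nonzero by simp

section \<open>The quotient group in terms of exponent vectors\<close>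

lemma group_diag_group: "group (diag_group d z q')"
proof -
  have car: "carrier (diag_group d z q') = {g_map z k |k. annihilates k}"
    by (simp add: diag_group_def annihilates_def cong_0_iff)
  show ?thesis
  proof (rule groupI)
    fix x assume "x \<in> carrier (diag_group d z q')"
    then obtain k where k: "x = g_map z k" "annihilates k" unfolding car by blast
    show "\<exists>y\<in>carrier (diag_group d z q'). y \<otimes>\<^bsub>diag_group d z q'\<^esub> x = \<one>\<^bsub>diag_group d z q'\<^esub>"
      unfolding car using annihilates_minus[OF k(2)]
      by (intro bexI[of _ "g_map z (- k)"]) (auto simp: diag_group_def k(1) g_map_comp)
  next
    fix x y assume "x \<in> carrier (diag_group d z q')" "y \<in> carrier (diag_group d z q')"
    then obtain k l where "x = g_map z k" "annihilates k" "y = g_map z l" "annihilates l"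
      unfolding car by blast
    then show "x \<otimes>\<^bsub>diag_group d z q'\<^esub> y \<in> carrier (diag_group d z q')"
      unfolding car using annihilates_add[of k l] by (auto simp: diag_group_def g_map_comp)
  next
    show "\<one>\<^bsub>diag_group d z q'\<^esub> \<in> carrier (diag_group d z q')"
      unfolding car using annihilates_zero by (auto simp: diag_group_def intro!: exI[of _ 0])
  qed (auto simp: diag_group_def comp_assoc)
qed

text \<open>The generator multiplies every coordinate by \<open>z\<close>, so the subgroup consists
  of scalar maps, which fix every projective point.\<close>

lemma generate_scalars:
  assumes "h \<in> generate (diag_group d z q') {g_map z 1}"
  shows "\<exists>c. h = g_map z (\<chi> j. c)"
  using assms
proof (induction rule: generate.induct)
  case one
  show ?case by (rule exI[of _ 0]) (simp add: diag_group_def zero_vec_def[symmetric])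
next
  case (incl h)
  then show ?case by (intro exI[of _ 1]) (simp add: one_vec_def)
next
  case (inv h)
  then have h: "h = g_map z (\<chi> j. 1)" by (simp add: one_vec_def)
  interpret group "diag_group d z q'" by (rule group_diag_group)
  have "g_map z (\<chi> j. -1) \<otimes>\<^bsub>diag_group d z q'\<^esub> h = \<one>\<^bsub>diag_group d z q'\<^esub>"
    unfolding h by (rule ext) (simp add: diag_group_def g_map_g_map vec_eq_iff)
  moreover have "g_map z (\<chi> j. c) \<in> carrier (diag_group d z q')" for c
    using annihilates_const[of c] by (auto simp: diag_group_def annihilates_def cong_0_iff)
  ultimately have "inv\<^bsub>diag_group d z q'\<^esub> h = g_map z (\<chi> j. -1)"
    using h by (intro inv_equality) auto
  then show ?case by blast
next
  case (eng h1 h2)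
  then obtain c1 c2 where "h1 = g_map z (\<chi> j. c1)" "h2 = g_map z (\<chi> j. c2)" by blast
  then have "h1 \<otimes>\<^bsub>diag_group d z q'\<^esub> h2 = g_map z (\<chi> j. c1 + c2)"
    by (simp add: diag_group_def g_map_comp plus_vec_def)
  then show ?case by blast
qed

lemma act_coset:
  assumes "y \<noteq> 0"
  shows "act (generate (diag_group d z q') {g_map z 1} #>\<^bsub>diag_group d z q'\<^esub> g_map z k) (hom_class y)
    = hom_class (g_map z k y)" (is "act (?N #>\<^bsub>?G\<^esub> _) _ = _")
proof -
  have y': "g_map z k y \<noteq> 0" using assms by (simp add: g_map_nonzero_iff)
  have im: "(h \<circ> g_map z k) ` hom_class y = hom_class (g_map z k y)" if h: "h \<in> ?N" for h
  proof -
    obtain c where c: "h = g_map z (\<chi> j. c)" using generate_scalars[OF h] by blast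
    have hc: "h x = z powi c *s x" for x by (simp add: c vec_eq_iff)
    have "(h \<circ> g_map z k) ` hom_class y = {(z powi c * l) *s g_map z k y |l. l \<noteq> 0}"
      unfolding hom_class_eq[OF assms] by (force simp: hc g_map_smult)
    also have "\<dots> = {l *s g_map z k y |l. l \<noteq> 0}"
    proof (intro equalityI subsetI)
      fix x assume "x \<in> {l *s g_map z k y |l. l \<noteq> 0}"
      then obtain l where "x = l *s g_map z k y" "l \<noteq> 0" by blast
      then show "x \<in> {(z powi c * l) *s g_map z k y |l. l \<noteq> 0}"
        using z_nonzero by (auto intro!: exI[of _ "l / z powi c"])
    qed (use z_nonzero in auto)
    finally show ?thesis unfolding hom_class_eq[OF y'] .
  qed
  have "act (?N #>\<^bsub>?G\<^esub> g_map z k) (hom_class y) = (\<Union>h\<in>?N. (h \<circ> g_map z k) ` hom_class y)"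
    by (auto simp: act_def r_coset_def diag_group_def)
  also have "\<dots> = (\<Union>h\<in>?N. hom_class (g_map z k y))" by (rule SUP_cong[OF refl im])
  also have "\<dots> = hom_class (g_map z k y)" using generate.one[of ?G] by blast
  finally show ?thesis .
qed

text \<open>Eliminates cosets: by \<open>act_coset\<close> the action of a coset is that of any
  representative, so orbits are described by exponent vectors alone.\<close>

lemma orbit_rel_eq:
  "orbit_rel d z q' = {(hom_class y, hom_class (g_map z k y)) |y k. y \<in> fermat_cone \<and> annihilates k}"
proof -
  let ?G = "diag_group d z q'"
  let ?N = "generate ?G {g_map z 1}"
  have car: "carrier (Gam d z q') = {?N #>\<^bsub>?G\<^esub> g_map z k |k. annihilates k}"
    by (auto simp: Gam_def FactGroup_def RCOSETS_def diag_group_def annihilates_def cong_0_iff)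
  have act: "act (?N #>\<^bsub>?G\<^esub> g_map z k) (hom_class y) = hom_class (g_map z k y)"
    if "y \<in> fermat_cone" for y k
    using that by (intro act_coset) (simp add: fermat_cone_def)
  show ?thesis
  proof (intro equalityI subsetI)
    fix x assume "x \<in> orbit_rel d z q'"
    then obtain p C where x: "x = (p, act C p)" and p: "p \<in> points (fermat d)"
      and C: "C \<in> carrier (Gam d z q')"
      unfolding orbit_rel_def by (elim CollectE exE conjE)
    from p obtain y where y: "p = hom_class y" "y \<in> fermat_cone"
      unfolding points_fermat by (rule imageE)
    from C obtain k where k: "C = ?N #>\<^bsub>?G\<^esub> g_map z k" "annihilates k"
      unfolding car by (elim CollectE exE conjE)
    have "x = (hom_class y, hom_class (g_map z k y))"
      unfolding x y(1) k(1) act[OF y(2)] ..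
    then show "x \<in> {(hom_class y, hom_class (g_map z k y)) |y k. y \<in> fermat_cone \<and> annihilates k}"
      by (intro CollectI exI[of _ y] exI[of _ k] conjI y(2) k(2))
  next
    fix x assume "x \<in> {(hom_class y, hom_class (g_map z k y)) |y k. y \<in> fermat_cone \<and> annihilates k}"
    then obtain y k where x: "x = (hom_class y, hom_class (g_map z k y))"
      and y: "y \<in> fermat_cone" and k: "annihilates k" by (elim CollectE exE conjE)
    have "?N #>\<^bsub>?G\<^esub> g_map z k \<in> carrier (Gam d z q')"
      unfolding car by (intro CollectI exI[of _ k] conjI refl k)
    moreover have "hom_class y \<in> points (fermat d)"
      unfolding points_fermat by (rule imageI[OF y])
    moreover have "x = (hom_class y, act (?N #>\<^bsub>?G\<^esub> g_map z k) (hom_class y))"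
      unfolding x act[OF y] ..
    ultimately show "x \<in> orbit_rel d z q'"
      unfolding orbit_rel_def
      by (intro CollectI exI[of _ "hom_class y"] exI[of _ "?N #>\<^bsub>?G\<^esub> g_map z k"] conjI)
  qed
qed

lemma g_map_hom_class_cong:
  assumes "x \<noteq> 0" "y \<noteq> 0" "hom_class x = hom_class y"
  shows "hom_class (g_map z k x) = hom_class (g_map z k y)"
proof -
  obtain l where "l \<noteq> 0" "y = l *s x" using assms by (auto simp: hom_class_eq_iff)
  then show ?thesis using assms(1) by (simp add: g_map_smult hom_class_smult g_map_nonzero_iff)
qed

text \<open>The representative of the first point may be prescribed, because the diagonal maps
  commute with scalars.\<close>

lemma orbit_rel_iff:
  assumes "y \<in> fermat_cone"
  shows "(hom_class y, p) \<in> orbit_rel d z q' \<longleftrightarrow> (\<exists>k. annihilates k \<and> p = hom_class (g_map z k y))"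
proof
  assume "(hom_class y, p) \<in> orbit_rel d z q'"
  then obtain x k where "x \<in> fermat_cone" "annihilates k" "hom_class y = hom_class x"
    "p = hom_class (g_map z k x)" unfolding orbit_rel_eq by blast
  moreover from this have "hom_class (g_map z k x) = hom_class (g_map z k y)"
    using assms by (intro g_map_hom_class_cong) (auto simp: fermat_cone_def)
  ultimately show "\<exists>k. annihilates k \<and> p = hom_class (g_map z k y)"
    by (intro exI[of _ k]) simp
next
  assume "\<exists>k. annihilates k \<and> p = hom_class (g_map z k y)"
  then show "(hom_class y, p) \<in> orbit_rel d z q'" unfolding orbit_rel_eq using assms by blast
qed

lemma equiv_orbit_rel: "equiv (points (fermat d)) (orbit_rel d z q')"
proof (rule equivI)
  show "orbit_rel d z q' \<subseteq> points (fermat d) \<times> points (fermat d)"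
    unfolding orbit_rel_eq points_fermat using g_map_fermat_cone by auto
  show "refl_on (points (fermat d)) (orbit_rel d z q')"
  proof (rule refl_onI)
    fix p assume "p \<in> points (fermat d :: (complex ^ 'n) set fspace)"
    then obtain y where "y \<in> fermat_cone" "p = hom_class y" unfolding points_fermat by blast
    then show "(p, p) \<in> orbit_rel d z q'"
      using annihilates_zero by (auto simp: orbit_rel_iff intro!: exI[of _ 0])
  qed
  show "sym (orbit_rel d z q')"
  proof (rule symI)
    fix p p' assume "(p, p') \<in> orbit_rel d z q'"
    then obtain y k where y: "y \<in> fermat_cone" "annihilates k" "p = hom_class y"
      "p' = hom_class (g_map z k y)" unfolding orbit_rel_eq by blast
    then show "(p', p) \<in> orbit_rel d z q'"
      using annihilates_minus[OF y(2)]
      by (auto simp: orbit_rel_iff[OF g_map_fermat_cone] g_map_g_map intro!: exI[of _ "- k"])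
  qed
  show "trans (orbit_rel d z q')"
  proof (rule transI)
    fix p p' p'' assume *: "(p, p') \<in> orbit_rel d z q'" "(p', p'') \<in> orbit_rel d z q'"
    from *(1) obtain y k where y: "y \<in> fermat_cone" "annihilates k" "p = hom_class y"
      "p' = hom_class (g_map z k y)" unfolding orbit_rel_eq by blast
    from *(2) obtain l where l: "annihilates l" "p'' = hom_class (g_map z l (g_map z k y))"
      unfolding y(4) orbit_rel_iff[OF g_map_fermat_cone[OF y(1)]] by blast
    show "(p, p'') \<in> orbit_rel d z q'"
      unfolding y(3) orbit_rel_iff[OF y(1)] l(2) g_map_g_map
      using annihilates_add[OF l(1) y(2)] by blast
  qed
qed

lemma uhat_g_map:
  assumes "annihilates k"
  shows "uhat d q' (g_map z k y) = uhat d q' y"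
proof -
  have "(\<Prod>j\<in>UNIV. (z powi (k $ j)) powi (q' $ j)) = z powi (\<Sum>j\<in>UNIV. k $ j * q' $ j)"
    by (simp add: power_int_sum_exponent z_nonzero power_int_mult)
  also have "\<dots> = 1" using assms by (simp add: z_powi_eq_1_iff annihilates_def)
  finally have "uhat d q' (g_map z k y) $ i = uhat d q' y $ i" for i
    by (cases i) (simp_all add: power_int_mult_distrib prod.distrib g_map_power del: g_map_nth,
        simp add: power_int_mult_distrib prod.distrib)
  then show ?thesis by (simp add: vec_eq_iff)
qed

text \<open>If two images agree, rescaling one representative makes the vectors \<open>uhat\<close>
  equal. Equal \<open>d\<close>-th powers force the coordinates to differ by powers of
  \<open>z\<close>, and equality in the coordinate \<open>None\<close> says that the exponents pair
  to 0 with \<open>q'\<close> modulo \<open>d\<close>.\<close>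

lemma umap_eq_iff:
  assumes "p \<in> torus_part" "p' \<in> torus_part"
  shows "umap p = umap p' \<longleftrightarrow> (p, p') \<in> orbit_rel d z q'"
proof
  obtain y where y: "y \<in> torus_cone" "p = hom_class y" using assms(1) by (rule torus_partE)
  obtain y' where y': "y' \<in> torus_cone" "p' = hom_class y'" using assms(2) by (rule torus_partE)
  note nz = torus_cone_nth[OF y(1)] torus_cone_nth[OF y'(1)]
  have yf: "y \<in> fermat_cone" using y(1) torus_cone_subset by blast
  {
    assume "(p, p') \<in> orbit_rel d z q'"
    then obtain k where k: "annihilates k" "p' = hom_class (g_map z k y)"
      unfolding y(2) orbit_rel_iff[OF yf] by blast
    have "\<forall>j. g_map z k y $ j \<noteq> 0" using nz z_nonzero by simp
    then show "umap p = umap p'"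
      using nz unfolding y(2) k(2) by (simp only: umap_hom_class uhat_g_map[OF k(1)] simp_thms)
  next
    assume "umap p = umap p'"
    then have "hom_class (uhat d q' y) = hom_class (uhat d q' y')"
      using nz unfolding y(2) y'(2) by (simp add: umap_hom_class)
    then obtain l where l: "l \<noteq> 0" "uhat d q' y' = l *s uhat d q' y"
      using hom_class_eq_iff[of "uhat d q' y" "uhat d q' y'"] uhat_nonzero(2) nz by blast
    \<comment> \<open>A \<open>d\<close>-th root of \<open>l\<close>. By homogeneity it moves the
      factor \<open>l\<close> into the representative \<open>y\<close>.\<close>
    define \<mu> where "\<mu> = exp (Ln l / of_nat d)"
    have mu: "\<mu> ^ d = l" "\<mu> \<noteq> 0"
      using l(1) d_pos by (simp_all add: \<mu>_def flip: exp_of_nat_mult)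
    have u: "uhat d q' y' = uhat d q' (\<mu> *s y)"
      using l(2) mu by (simp add: uhat_smult)
    have "\<exists>m. y' $ j = z powi m * (\<mu> *s y) $ j" for j
    proof -
      have "y' $ j ^ d = (\<mu> *s y) $ j ^ d"
        using arg_cong[OF u, of "\<lambda>u. u $ Some j"] by simp
      then have "(y' $ j / (\<mu> *s y) $ j) ^ d = 1"
        using nz mu by (simp add: power_divide)
      then obtain m where "y' $ j / (\<mu> *s y) $ j = z powi m" by (rule root_of_unity_powi)
      then show ?thesis using nz mu by (auto simp: field_simps)
    qed
    then obtain m where m: "\<forall>j. y' $ j = z powi (m j) * (\<mu> *s y) $ j" by metis
    define k :: "int ^ 'n" where "k = (\<chi> j. m j)"
    have k: "y' = g_map z k (\<mu> *s y)" using m by (simp add: vec_eq_iff k_def)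
    define w where "w = (\<Prod>j\<in>UNIV. (\<mu> *s y) $ j powi q' $ j)"
    have "w \<noteq> 0" using nz mu by (simp add: w_def)
    moreover have "(\<Prod>j\<in>UNIV. y' $ j powi q' $ j) = w"
      using arg_cong[OF u, of "\<lambda>u. u $ None"] by (simp add: w_def)
    moreover have "(\<Prod>j\<in>UNIV. y' $ j powi q' $ j) = z powi (\<Sum>j\<in>UNIV. k $ j * q' $ j) * w"
      unfolding k g_map_nth power_int_mult_distrib prod.distrib w_def
      by (simp add: power_int_sum_exponent z_nonzero power_int_mult)
    ultimately have "z powi (\<Sum>j\<in>UNIV. k $ j * q' $ j) = 1" by simp
    then have "annihilates k" unfolding annihilates_def z_powi_eq_1_iff .
    moreover have "p' = hom_class (g_map z k y)"
      unfolding y'(2) k g_map_smult using mu torus_cone_nonzero[OF y(1)]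
      by (simp add: hom_class_smult g_map_nonzero_iff)
    ultimately show "(p, p') \<in> orbit_rel d z q'"
      unfolding y(2) orbit_rel_iff[OF yf] by blast
  }
qed

end

section \<open>The inverse of the induced map on orbits\<close>

context fermat_weights
begin

text \<open>A product of one linear factor for each \<open>k \<noteq> 0\<close>, vanishing at the
  translate by \<open>k\<close>. The factor uses a coordinate in which \<open>k\<close> is nonzero,
  hence nonzero modulo \<open>d\<close>, so that coordinate of \<open>y0\<close> really moves.
  Vectors are separated, not projective points: scalar multiples of \<open>y0\<close> in the orbit
  are zeros too.\<close>

lemma orbit_separating_polynomial:
  assumes "y0 \<in> torus_cone"
  obtains c where "c \<in> poly_functions" "c y0 \<noteq> 0" "\<forall>k\<in>annihilator - {0}. c (g_map z k y0) = 0"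
proof -
  define J where "J k = (SOME j. k $ j \<noteq> 0)" for k :: "int ^ 'n"
  have J: "k $ J k \<noteq> 0" if "k \<noteq> 0" for k
    unfolding J_def by (rule someI_ex) (use that in \<open>simp add: vec_eq_iff\<close>)
  define c where "c y = (\<Prod>k\<in>annihilator - {0}. y $ J k - g_map z k y0 $ J k)" for y
  show thesis
  proof (rule that[of c])
    show "c \<in> poly_functions"
      unfolding c_def
      by (intro poly_functions_prod poly_functions_diff poly_functions.coord poly_functions.const)
        (simp add: finite_annihilator)
    have "y0 $ J k - g_map z k y0 $ J k \<noteq> 0" if k: "k \<in> annihilator - {0}" for k
    proof
      assume "y0 $ J k - g_map z k y0 $ J k = 0"
      then have "z powi (k $ J k) = 1" using torus_cone_nth[OF assms, of "J k"] by simp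
      then have "int d dvd k $ J k" by (simp add: z_powi_eq_1_iff)
      moreover have "0 \<le> k $ J k" "k $ J k < int d" "k $ J k \<noteq> 0"
        using k J[of k] by (simp_all add: annihilator_def)
      ultimately show False using zdvd_imp_le[of "int d" "k $ J k"] by linarith
    qed
    then show "c y0 \<noteq> 0" unfolding c_def by (simp add: finite_annihilator)
    show "\<forall>k\<in>annihilator - {0}. c (g_map z k y0) = 0"
    proof
      fix k assume "k \<in> annihilator - {0}"
      then show "c (g_map z k y0) = 0"
        unfolding c_def by (intro prod_zero) (auto simp: finite_annihilator)
    qed
  qed
qed

text \<open>One local statement with two uses: \<open>V\<close> shows that the induced map on orbits
  is open onto its image, and \<open>h'\<close> that invariant functions are regular functions of
  the image point.\<close>

lemma fermat_local_inverse:
  assumes U: "openin (topo (fermat d)) U"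
    and sat: "\<And>p p'. (p, p') \<in> orbit_rel d z q' \<Longrightarrow> p \<in> U \<Longrightarrow> p' \<in> U"
    and h: "regular (fermat d) U h"
    and inv: "\<And>p p'. (p, p') \<in> orbit_rel d z q' \<Longrightarrow> h p = h p'"
    and p0: "p0 \<in> U" "p0 \<in> torus_part"
  obtains V h' where "openin (topo proj_space) V" "umap p0 \<in> V" "regular proj_space V h'"
    "\<forall>p\<in>torus_part. umap p \<in> V \<longrightarrow> p \<in> U \<and> h' (umap p) = h p"
proof -
  obtain y0 where y0: "y0 \<in> torus_cone" "p0 = hom_class y0" using p0(2) by (rule torus_partE)
  have h': "regular (subspace_of proj_space (points (fermat d))) U h" using h fermat_eq by simp
  obtain W k where W: "openin (topo proj_space) W" "p0 \<in> W" "W \<inter> points (fermat d) \<subseteq> U"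
    "regular proj_space W k" "\<forall>x\<in>W \<inter> points (fermat d). h x = k x"
    by (rule regular_subspace_ofE[OF h' p0(1)])
  have W': "W \<subseteq> points proj_space" using W(1) by (simp add: openin_proj_space)
  have k: "regular affine_space (\<Union>W) (\<lambda>x. k (hom_class x))"
    using W(4) regular_proj_space[OF W(1)] by simp
  have "y0 \<in> \<Union>W"
    using mem_Union_proj[OF W' torus_cone_nonzero[OF y0(1)]] W(2) y0(2) by simp
  then obtain a b where ab: "a \<in> poly_functions" "b \<in> poly_functions" "b y0 \<noteq> 0"
    "\<forall>x. b x \<noteq> 0 \<longrightarrow> x \<in> \<Union>W" "\<forall>x. b x \<noteq> 0 \<longrightarrow> k (hom_class x) = a x / b x"
    by (rule regular_affineE[OF k])
  have loc: "hom_class y \<in> U \<and> h (hom_class y) = a y / b y" if y: "y \<in> torus_cone" "b y \<noteq> 0" for y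
  proof -
    have "hom_class y \<in> W"
      using mem_Union_proj[OF W' torus_cone_nonzero[OF y(1)]] ab(4) y(2) by simp
    moreover have "hom_class y \<in> points (fermat d)"
      using y(1) torus_part_subset by (auto simp: torus_part_def)
    ultimately show ?thesis using W(3,5) ab(5) y(2) by auto
  qed
  obtain c where c: "c \<in> poly_functions" "c y0 \<noteq> 0" "\<forall>k\<in>annihilator - {0}. c (g_map z k y0) = 0"
    by (rule orbit_separating_polynomial[OF y0(1)])
  \<comment> \<open>The extra factor \<open>b\<close> makes \<open>h * s = r\<close> hold also where \<open>b\<close> vanishes.\<close>
  define s where "s y = c y * (b y * b y)" for y
  define r where "r y = c y * (a y * b y)" for y
  have s: "s \<in> poly_functions" and r: "r \<in> poly_functions"
    unfolding s_def[abs_def] r_def[abs_def] by (intro poly_functions.mult ab c)+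
  have hs: "h (hom_class y) * s y = r y" if "y \<in> torus_cone" for y
    using loc[OF that] by (cases "b y = 0") (simp_all add: s_def r_def)
  let ?T = "{u :: complex ^ 'n option. \<forall>i. u $ i \<noteq> 0}"
  define S where "S y = (\<Sum>k\<in>annihilator. s (g_map z k y))" for y
  define R where "R y = (\<Sum>k\<in>annihilator. r (g_map z k y))" for y
  obtain Q where Q: "regular affine_space ?T Q"
    "\<forall>y. (\<forall>j. y $ j \<noteq> 0) \<longrightarrow> (\<Sum>k\<in>annihilator. s (g_map z k y)) = Q (uhat d q' y)"
    by (rule average_factors_through_uhat[OF s])
  obtain P where P: "regular affine_space ?T P"
    "\<forall>y. (\<forall>j. y $ j \<noteq> 0) \<longrightarrow> (\<Sum>k\<in>annihilator. r (g_map z k y)) = P (uhat d q' y)"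
    by (rule average_factors_through_uhat[OF r])
  have SQ: "S y = Q (uhat d q' y)" and RP: "R y = P (uhat d q' y)" if "y \<in> torus_cone" for y
    using that Q(2) P(2) unfolding S_def R_def torus_cone_def by simp_all
  have annih: "annihilates k" if "k \<in> annihilator" for k using that by (simp add: annihilator_def annihilates_def)
  have orb: "(hom_class y, hom_class (g_map z k y)) \<in> orbit_rel d z q'"
    if "y \<in> torus_cone" "k \<in> annihilator" for y k
    using that annih torus_cone_subset unfolding orbit_rel_eq by blast
  \<comment> \<open>\<open>h\<close> takes the same value at all translates of \<open>y\<close>, so
    the identity \<open>h * s = r\<close> may be summed over the group with \<open>h\<close> as a
    common factor.\<close>
  have hS: "h (hom_class y) * S y = R y" if y: "y \<in> torus_cone" for y
    unfolding S_def R_def sum_distrib_left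
  proof (rule sum.cong[OF refl])
    fix k assume k: "k \<in> annihilator"
    show "h (hom_class y) * s (g_map z k y) = r (g_map z k y)"
      using hs[OF g_map_torus_cone[OF y], of k] inv[OF orb[OF y k]] by simp
  qed
  \<comment> \<open>A nonzero average has a nonzero summand. At that translate \<open>b\<close> is
    nonzero, so it lies in \<open>U\<close>, and saturation carries this back to
    \<open>y\<close>.\<close>
  have SU: "hom_class y \<in> U" if y: "y \<in> torus_cone" and "S y \<noteq> 0" for y
  proof -
    obtain k where k: "k \<in> annihilator" "s (g_map z k y) \<noteq> 0"
      using \<open>S y \<noteq> 0\<close> unfolding S_def by (auto elim: sum.not_neutral_contains_not_neutral)
    then have "hom_class (g_map z k y) \<in> U"
      using loc[OF g_map_torus_cone[OF y]] by (auto simp: s_def)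
    moreover have "(hom_class (g_map z k y), hom_class y) \<in> orbit_rel d z q'"
      using orb[OF y k(1)] equiv_orbit_rel by (meson equivE symE)
    ultimately show ?thesis using sat by blast
  qed
  \<comment> \<open>At \<open>y0\<close> the factor \<open>c\<close> kills every summand except the
    one for \<open>k = 0\<close>, so the averaged denominator does not vanish there.\<close>
  have "S y0 = s (g_map z 0 y0) + (\<Sum>k\<in>annihilator - {0}. s (g_map z k y0))"
    unfolding S_def by (rule sum.remove[OF finite_annihilator zero_in_annihilator])
  also have "(\<Sum>k\<in>annihilator - {0}. s (g_map z k y0)) = 0"
    by (rule sum.neutral) (use c(3) in \<open>simp add: s_def\<close>)
  finally have S0: "S y0 \<noteq> 0" using ab(3) c(2) by (simp add: s_def)
  \<comment> \<open>Dehomogenization: \<open>\<nu> u\<close> is the representative of the class of \<open>u\<close> that agrees with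
    \<open>uhat d q' y0\<close> in one coordinate.\<close>
  define i :: 'n where "i = undefined"
  define \<nu> where "\<nu> u = (y0 $ i ^ d / u $ Some i) *s u" for u :: "complex ^ 'n option"
  have nu_T: "\<nu> u \<in> ?T" if "u \<in> ?T" for u
    using that torus_cone_nth[OF y0(1), of i] by (simp add: \<nu>_def)
  have nu_smult: "\<nu> (l *s u) = \<nu> u" if "l \<noteq> 0" for l u
    using that by (simp add: \<nu>_def vec_eq_iff)
  have nu_reg: "regular affine_space ?T (\<lambda>u. \<nu> u $ j)" for j
  proof -
    have "regular affine_space ?T (\<lambda>u. y0 $ i ^ d * u $ Some i powi (-1) * u $ j)"
      by (intro regular_affine_mult regular_affine_const regular_affine_power_int zariski_open_torus
          regular_affine_poly poly_functions.coord) auto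
    then show ?thesis by (simp add: \<nu>_def divide_inverse)
  qed
  have T: "{u \<in> ?T. \<nu> u \<in> ?T} = ?T" using nu_T by blast
  \<comment> \<open>\<open>P\<close> and \<open>Q\<close> need not be homogeneous. Composed with
    \<open>\<nu>\<close> they are constant along each class and so define functions on projective
    space.\<close>
  have Qn: "regular affine_space ?T (\<lambda>u. Q (\<nu> u))"
    using regular_affine_compose[OF zariski_open_torus nu_reg Q(1)] unfolding T .
  have Pn: "regular affine_space ?T (\<lambda>u. P (\<nu> u))"
    using regular_affine_compose[OF zariski_open_torus nu_reg P(1)] unfolding T .
  let ?O = "{u \<in> ?T. Q (\<nu> u) \<noteq> 0}"
  have O_open: "zariski_open ?O" by (rule zariski_open_regular_nonzero[OF Qn])
  have O_smult: "l *s u \<in> ?O" if "l \<noteq> 0" "u \<in> ?O" for l u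
    using that by (simp add: nu_smult)
  have O_0: "0 \<notin> ?O" by simp
  define V where "V = hom_class ` ?O"
  have V: "openin (topo proj_space) V"
    unfolding V_def by (rule openin_image_hom_class[OF O_open O_0 O_smult])
  have UV: "\<Union>V = ?O" unfolding V_def by (rule Union_image_hom_class[OF O_0 O_smult])
  define h' where "h' p = (let u = SOME u. u \<in> p in P (\<nu> u) * inverse (Q (\<nu> u)))" for p
  have h'_eq: "h' (hom_class u) = P (\<nu> u) * inverse (Q (\<nu> u))" if "u \<in> ?T" for u
  proof -
    have u: "u \<noteq> 0" using that by (intro torus_nonzero) simp
    have "(SOME x. x \<in> hom_class u) \<in> hom_class u" 
      by (rule someI[of "\<lambda>x. x \<in> hom_class u", OF self_in_hom_class[OF u]])
    then obtain l where "l \<noteq> 0" "(SOME x. x \<in> hom_class u) = l *s u"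
      unfolding hom_class_eq[OF u] by blast
    then show ?thesis by (simp add: h'_def nu_smult)
  qed
  have "regular affine_space ?O (\<lambda>u. P (\<nu> u) * inverse (Q (\<nu> u)))"
    by (intro regular_affine_mult regular_affine_inverse Qn regular_affine_subset[OF Pn O_open]) blast
  then have h'_reg: "regular proj_space V h'"
    unfolding regular_proj_space[OF V] UV
    by (rule iffD1[OF regular_affine_cong, rotated]) (simp add: h'_eq)
  \<comment> \<open>By homogeneity of degree \<open>d\<close>, normalizing the image corresponds to
    scaling \<open>y\<close> so that its \<open>i\<close>-th coordinate becomes that of
    \<open>y0\<close>. Values at \<open>\<nu>\<close> of the image are thus averages at another
    representative of the same point.\<close>
  have nu_uhat: "\<nu> (uhat d q' y) = uhat d q' ((y0 $ i / y $ i) *s y)" if "y \<in> torus_cone" for y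
    using torus_cone_nth[OF y0(1)] torus_cone_nth[OF that]
    by (simp add: \<nu>_def uhat_smult power_divide)
  have scale: "(y0 $ i / y $ i) *s y \<in> torus_cone"
    "hom_class ((y0 $ i / y $ i) *s y) = hom_class y" if "y \<in> torus_cone" for y
  proof -
    have "y0 $ i / y $ i \<noteq> 0"
      using torus_cone_nth[OF y0(1), of i] torus_cone_nth[OF that, of i] by simp
    then show "(y0 $ i / y $ i) *s y \<in> torus_cone" "hom_class ((y0 $ i / y $ i) *s y) = hom_class y"
      by (rule torus_cone_smult[OF that], rule hom_class_smult[OF torus_cone_nonzero[OF that]])
  qed
  have umap_cone: "umap (hom_class y) = hom_class (uhat d q' y)" "uhat d q' y \<in> ?T"
    "uhat d q' y \<noteq> 0" if "y \<in> torus_cone" for y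
    using that uhat_nonzero[of y] by (simp_all add: umap_hom_class torus_cone_def)
  show thesis
  proof (rule that[OF V _ h'_reg])
    have "(y0 $ i / y0 $ i) *s y0 = y0" using torus_cone_nth[OF y0(1)] by simp
    then have "Q (\<nu> (uhat d q' y0)) \<noteq> 0" using S0 SQ[OF y0(1)] nu_uhat[OF y0(1)] by simp
    then have "uhat d q' y0 \<in> ?O" using umap_cone(2)[OF y0(1)] by simp
    then show "umap p0 \<in> V"
      unfolding V_def y0(2) umap_cone(1)[OF y0(1)] by (rule imageI)
    show "\<forall>p\<in>torus_part. umap p \<in> V \<longrightarrow> p \<in> U \<and> h' (umap p) = h p"
    proof (intro ballI impI)
      fix p assume p: "p \<in> torus_part" "umap p \<in> V"
      obtain y where y: "y \<in> torus_cone" "p = hom_class y" using p(1) by (rule torus_partE)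
      let ?x = "(y0 $ i / y $ i) *s y"
      have "V \<subseteq> points proj_space" using V by (simp add: openin_proj_space)
      then have "uhat d q' y \<in> ?O"
        using p(2) mem_Union_proj[of V "uhat d q' y"] umap_cone[OF y(1)] unfolding y(2) UV by simp
      then have Sx: "S ?x \<noteq> 0"
        using SQ[OF scale(1)[OF y(1)]] nu_uhat[OF y(1)] by simp
      have "p \<in> U" using SU[OF scale(1)[OF y(1)] Sx] scale(2)[OF y(1)] y(2) by simp
      moreover have "h' (umap p) = h p"
      proof -
        have "h' (umap p) = R ?x * inverse (S ?x)"
          using umap_cone[OF y(1)] SQ[OF scale(1)[OF y(1)]] RP[OF scale(1)[OF y(1)]]
          by (simp only: y(2) h'_eq nu_uhat[OF y(1)])
        also have "\<dots> = h p"
          using hS[OF scale(1)[OF y(1)]] Sx scale(2)[OF y(1)] y(2) by (simp flip: divide_inverse add: field_simps)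
        finally show ?thesis .
      qed
      ultimately show "p \<in> U \<and> h' (umap p) = h p" ..
    qed
  qed
qed

section \<open>The image is open in its closure\<close>

definition gdeg :: nat where "gdeg = nat (int d div weight_gcd)"

definition gexp :: "'n \<Rightarrow> nat" where "gexp j = nat (q' $ j div weight_gcd)"

text \<open>The equations of the image inside the torus. Both are homogeneous, the second because
  the \<open>gexp i\<close> sum to \<open>gdeg\<close>. With exponent \<open>d\<close> in place of
  \<open>d/g\<close> the second would allow values of \<open>u\<^sub>0\<close> that are not
  attained.\<close>

definition image_eqs :: "complex ^ 'n option \<Rightarrow> bool" where
  "image_eqs u \<longleftrightarrow> (\<Sum>i\<in>UNIV. u $ Some i) = 0 \<and> u $ None ^ gdeg = (\<Prod>i\<in>UNIV. u $ Some i ^ gexp i)"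

lemma gdeg_mult: "int gdeg * weight_gcd = int d" and gexp_mult: "int (gexp j) * weight_gcd = q' $ j"
proof -
  have "0 \<le> int d div weight_gcd" "0 \<le> q' $ j div weight_gcd"
    using weight_gcd_pos q'_pos[of j] by (simp_all add: pos_imp_zdiv_nonneg_iff less_imp_le)
  then show "int gdeg * weight_gcd = int d" "int (gexp j) * weight_gcd = q' $ j"
    using weight_gcd_dvd_d weight_gcd_dvd_q'[of j] by (simp_all add: gdeg_def gexp_def)
qed

lemma sum_gexp: "(\<Sum>j\<in>UNIV. gexp j) = gdeg"
proof -
  have "int (\<Sum>j\<in>UNIV. gexp j) * weight_gcd = int gdeg * weight_gcd"
    by (simp add: sum_distrib_right gexp_mult gdeg_mult sum_q')
  then have "int (\<Sum>j\<in>UNIV. gexp j) = int gdeg" using weight_gcd_pos by (simp del: of_nat_sum)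
  then show ?thesis by (simp only: of_nat_eq_iff)
qed

lemma image_eqs_smult:
  assumes "l \<noteq> 0"
  shows "image_eqs (l *s u) \<longleftrightarrow> image_eqs u"
proof -
  have "(\<Prod>i\<in>UNIV. (l *s u) $ Some i ^ gexp i) = l ^ gdeg * (\<Prod>i\<in>UNIV. u $ Some i ^ gexp i)"
    by (simp add: power_mult_distrib prod.distrib power_sum[symmetric] sum_gexp)
  then show ?thesis
    using assms by (simp add: image_eqs_def power_mult_distrib sum_distrib_left[symmetric])
qed

lemma prod_powi_power_gdeg:
  fixes y :: "complex ^ 'n"
  shows "(\<Prod>k\<in>UNIV. y $ k powi (q' $ k)) ^ gdeg = (\<Prod>k\<in>UNIV. (y $ k ^ d) ^ gexp k)"
  unfolding prod_power_distrib
proof (rule prod.cong[OF refl])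
  fix k
  have "(y $ k powi (q' $ k)) ^ gdeg = y $ k powi (q' $ k * int gdeg)"
    by (simp add: power_int_mult)
  also have "q' $ k * int gdeg = int (d * gexp k)"
    unfolding of_nat_mult gexp_mult[symmetric] gdeg_mult[symmetric] by simp
  also have "y $ k powi \<dots> = (y $ k ^ d) ^ gexp k"
    unfolding power_int_of_nat power_mult ..
  finally show "(y $ k powi (q' $ k)) ^ gdeg = (y $ k ^ d) ^ gexp k" .
qed

lemma image_eqs_uhat: "y \<in> torus_cone \<Longrightarrow> image_eqs (uhat d q' y)"
  by (simp add: image_eqs_def torus_cone_def prod_powi_power_gdeg)

text \<open>Arbitrary \<open>d\<close>-th roots of the coordinates \<open>Some i\<close> give the
  right image except possibly in \<open>None\<close>. The error there is a \<open>d/g\<close>-th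
  root of unity, hence \<open>z powi l\<close> with \<open>g\<close> dividing \<open>l\<close>, and
  a diagonal map can correct it.\<close>

lemma image_eqs_imp_uhat:
  assumes u: "\<forall>i. u $ i \<noteq> 0" and eqs: "image_eqs u"
  obtains y where "y \<in> torus_cone" "uhat d q' y = u"
proof -
  define y :: "complex ^ 'n" where "y = (\<chi> i. exp (Ln (u $ Some i) / of_nat d))"
  have yd: "y $ i ^ d = u $ Some i" for i
    using u d_pos by (simp add: y_def flip: exp_of_nat_mult)
  define w where "w = (\<Prod>k\<in>UNIV. y $ k powi (q' $ k))"
  have "w ^ gdeg = u $ None ^ gdeg"
    using eqs unfolding w_def prod_powi_power_gdeg yd image_eqs_def by simp
  then have om: "(w / u $ None) ^ gdeg = 1" using u by (simp add: power_divide)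
  have "int d = int (gdeg * nat weight_gcd)" using gdeg_mult weight_gcd_pos by simp
  then have dg: "d = gdeg * nat weight_gcd" by (simp only: of_nat_eq_iff)
  have "(w / u $ None) ^ d = ((w / u $ None) ^ gdeg) ^ nat weight_gcd" by (subst dg) (rule power_mult)
  then have "(w / u $ None) ^ d = 1" by (simp only: om power_one)
  then obtain l where l: "w / u $ None = z powi l" by (rule root_of_unity_powi)
  have "z powi (l * int gdeg) = 1" using om l by (simp add: power_int_mult)
  then have "int d dvd l * int gdeg" by (simp only: z_powi_eq_1_iff)
  then have "int gdeg * weight_gcd dvd int gdeg * l" unfolding gdeg_mult by (simp only: mult.commute)
  moreover have "int gdeg \<noteq> 0" using gdeg_mult d_pos by (metis mult_zero_left of_nat_0_less_iff less_irrefl)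
  ultimately have "weight_gcd dvd l" by (simp only: dvd_mult_cancel_left simp_thms)
  then obtain t where t: "l = weight_gcd * t" by blast
  obtain m where m: "(\<Sum>j\<in>UNIV. m j * q' $ j) = weight_gcd" by (rule weight_gcd_combination)
  \<comment> \<open>With \<open>l = g * t\<close> and the Bezout vector \<open>m\<close>, the vector
    \<open>- t * m\<close> pairs with \<open>q'\<close> to \<open>- l\<close>, which cancels the
    error factor \<open>z powi l\<close>.\<close>
  define k :: "int ^ 'n" where "k = (\<chi> j. - (t * m j))"
  have "(\<Sum>j\<in>UNIV. k $ j * q' $ j) = - l"
    unfolding t m[symmetric] k_def by (simp add: sum_negf sum_distrib_left sum_distrib_right mult_ac)
  then have "(\<Prod>j\<in>UNIV. g_map z k y $ j powi q' $ j) = z powi (- l) * w"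
    using power_int_sum_exponent[of UNIV z "\<lambda>j. k $ j * q' $ j"] z_nonzero
    by (simp add: w_def power_int_mult_distrib prod.distrib power_int_mult)
  also have "\<dots> = u $ None"
  proof -
    have "w = z powi l * u $ None" using l u by (simp add: field_simps)
    then show ?thesis using z_nonzero by (simp add: power_int_minus)
  qed
  finally have None: "uhat d q' (g_map z k y) $ None = u $ None" by simp
  have Some: "uhat d q' (g_map z k y) $ Some i = u $ Some i" for i
    by (simp only: uhat_nth g_map_power yd)
  have "uhat d q' (g_map z k y) $ i = u $ i" for i
    using None Some by (cases i) simp_all
  then have "uhat d q' (g_map z k y) = u" by (simp add: vec_eq_iff)
  moreover have "g_map z k y \<in> torus_cone"
  proof (rule g_map_torus_cone)
    show "y \<in> torus_cone"
      using eqs unfolding torus_cone_def mem_Collect_eq yd image_eqs_def by (simp add: y_def)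
  qed
  ultimately show thesis by (rule that[rotated])
qed

lemma umap_torus_part: "umap ` torus_part = hom_class ` uhat d q' ` torus_cone"
  unfolding torus_part_def image_image
  by (intro image_cong refl umap_hom_class) (simp add: torus_cone_def)

lemma umap_torus_part_subset: "umap ` torus_part \<subseteq> points proj_space"
  unfolding umap_torus_part
  using uhat_nonzero(2) by (auto simp: torus_cone_def intro!: hom_class_in_points)

lemma zariski_open_not_image_eqs: "zariski_open {u. u \<noteq> 0 \<and> \<not> image_eqs u}"
proof -
  let ?e1 = "\<lambda>u :: complex ^ 'n option. \<Sum>i\<in>UNIV. u $ Some i"
  let ?e2 = "\<lambda>u :: complex ^ 'n option. u $ None ^ gdeg - (\<Prod>i\<in>UNIV. u $ Some i ^ gexp i)"
  have "zariski_open {u. ?e1 u \<noteq> 0}"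
    by (intro zariski_open_nonzero poly_functions_sum poly_functions.coord finite)
  moreover have "zariski_open {u. ?e2 u \<noteq> 0}"
    by (intro zariski_open_nonzero poly_functions_diff poly_functions_prod
        poly_functions_power poly_functions.coord finite)
  ultimately have "zariski_open ({u. ?e1 u \<noteq> 0} \<union> {u. ?e2 u \<noteq> 0})"
    using openin_Un[of "topology zariski_open"] by simp
  then have "zariski_open (({u. ?e1 u \<noteq> 0} \<union> {u. ?e2 u \<noteq> 0}) \<inter> - {0})"
    by (intro zariski_open_Int zariski_open_minus_zero)
  moreover have "({u. ?e1 u \<noteq> 0} \<union> {u. ?e2 u \<noteq> 0}) \<inter> - {0} = {u. u \<noteq> 0 \<and> \<not> image_eqs u}"
    by (auto simp: image_eqs_def)
  ultimately show ?thesis by simp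
qed

text \<open>The equations are closed conditions, so they persist on the closure. Together with
  nonzero coordinates they force a point into the image.\<close>

lemma closure_Int_torus:
  "(topo proj_space closure_of (umap ` torus_part)) \<inter> hom_class ` {u. \<forall>i. u $ i \<noteq> 0} = umap ` torus_part"
proof (intro equalityI subsetI IntI)
  fix p assume p: "p \<in> (topo proj_space closure_of (umap ` torus_part)) \<inter> hom_class ` {u. \<forall>i. u $ i \<noteq> 0}"
  then obtain u where u: "\<forall>i. u $ i \<noteq> 0" "p = hom_class u" by blast
  let ?E = "{u. u \<noteq> 0 \<and> \<not> image_eqs u}"
  have "image_eqs u"
  proof (rule ccontr)
    assume "\<not> image_eqs u"
    then have pE: "p \<in> hom_class ` ?E" using u torus_nonzero[OF u(1)] by blast
    have E: "openin (topo proj_space) (hom_class ` ?E)"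
      by (rule openin_image_hom_class[OF zariski_open_not_image_eqs]) (auto simp: image_eqs_smult)
    have "\<forall>T. p \<in> T \<and> openin (topo proj_space) T \<longrightarrow> (\<exists>x. x \<in> umap ` torus_part \<and> x \<in> T)"
      using IntD1[OF p] unfolding in_closure_of by (rule conjunct2)
    from mp[OF spec[OF this] conjI[OF pE E]]
    obtain p' where p': "p' \<in> umap ` torus_part" "p' \<in> hom_class ` ?E" by (elim exE conjE)
    obtain y where y: "y \<in> torus_cone" "p' = hom_class (uhat d q' y)"
      using p'(1) unfolding umap_torus_part by (elim imageE) simp
    obtain v where v: "v \<noteq> 0" "\<not> image_eqs v" "p' = hom_class v"
      using p'(2) by (elim imageE CollectE conjE) simp
    have "uhat d q' y \<noteq> 0" using y(1) by (simp add: uhat_nonzero(2) torus_cone_def)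
    then obtain l where "l \<noteq> 0" "v = l *s uhat d q' y"
      using hom_class_eq_iff[of "uhat d q' y" v] v y(2) by auto
    then show False using v(2) image_eqs_uhat[OF y(1)] by (simp add: image_eqs_smult)
  qed
  then obtain y where "y \<in> torus_cone" "uhat d q' y = u" by (rule image_eqs_imp_uhat[OF u(1)])
  then show "p \<in> umap ` torus_part" unfolding umap_torus_part u(2) by blast
next
  fix p assume p: "p \<in> umap ` torus_part"
  then show "p \<in> topo proj_space closure_of (umap ` torus_part)"
    using closure_of_subset[OF umap_torus_part_subset] by blast
  show "p \<in> hom_class ` {u. \<forall>i. u $ i \<noteq> 0}"
    using p uhat_nonzero(1) unfolding umap_torus_part by (auto simp: torus_cone_def)
qed

definition image_closure :: "(complex ^ 'n option) set fspace" where
  "image_closure = subspace_of proj_space (topo proj_space closure_of (umap ` torus_part))"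

lemma dense_open_image: "dense_open image_closure (umap ` torus_part)"
proof -
  let ?C = "topo proj_space closure_of (umap ` torus_part)"
  have sub: "umap ` torus_part \<subseteq> ?C" by (rule closure_of_subset[OF umap_torus_part_subset])
  have "openin (topo proj_space) (hom_class ` {u :: complex ^ 'n option. \<forall>i. u $ i \<noteq> 0})"
    by (rule openin_image_hom_class[OF zariski_open_torus]) auto
  then have "openin (subtopology (topo proj_space) ?C) (umap ` torus_part)"
    unfolding openin_subtopology using closure_Int_torus by (metis Int_commute)
  moreover have "subtopology (topo proj_space) ?C closure_of (umap ` torus_part)
      = topspace (subtopology (topo proj_space) ?C)"
    using sub closure_of_subset_topspace[of "topo proj_space" "umap ` torus_part"]
    by (auto simp: closure_of_subtopology Int_absorb1)
  ultimately show ?thesis by (simp add: dense_open_def image_closure_def)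
qed

end

section \<open>Birational equivalence\<close>

lemma morphismD:
  assumes "morphism X Y f"
  shows "continuous_map (topo X) (topo Y) f"
    and "openin (topo Y) V \<Longrightarrow> regular Y V g \<Longrightarrow> regular X {x \<in> points X. f x \<in> V} (g \<circ> f)"
  using assms by (simp_all add: morphism_def)

text \<open>Regularity on \<open>U\<close> compares values only on \<open>W \<inter> S\<close>,
  which lies in \<open>U\<close>; values of the total function elsewhere do not count.\<close>

lemma regular_subspace_of_cong:
  assumes r: "regular (subspace_of X S) U f" and eq: "\<And>x. x \<in> U \<Longrightarrow> f x = g x"
  shows "regular (subspace_of X S) U g"
  unfolding regular_subspace_of
proof
  fix p assume p: "p \<in> U"
  obtain W k where W: "openin (topo X) W" "p \<in> W" "W \<inter> S \<subseteq> U" "regular X W k" "\<forall>x\<in>W \<inter> S. f x = k x"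
    by (rule regular_subspace_ofE[OF r p])
  have "\<forall>x\<in>W \<inter> S. g x = k x" using W(3,5) eq by (metis subsetD)
  then show "\<exists>V k. openin (topo X) V \<and> p \<in> V \<and> V \<inter> S \<subseteq> U \<and> regular X V k \<and> (\<forall>x\<in>V \<inter> S. g x = k x)"
    by (intro exI[of _ W] exI[of _ k] conjI W)
qed

lemma morphism_subspace_of_cong:
  assumes f: "morphism (subspace_of X S) Y f"
    and eq: "\<And>x. x \<in> points (subspace_of X S) \<Longrightarrow> f x = g x"
  shows "morphism (subspace_of X S) Y g"
  unfolding morphism_def
proof (intro conjI allI impI)
  show "continuous_map (topo (subspace_of X S)) (topo Y) g"
    by (rule continuous_map_eq[OF morphismD(1)[OF f]]) (rule eq)
next
  fix V h assume "openin (topo Y) V \<and> regular Y V h"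
  then have "regular (subspace_of X S) {x \<in> points (subspace_of X S). f x \<in> V} (h \<circ> f)"
    by (intro morphismD(2)[OF f]) simp_all
  moreover have "{x \<in> points (subspace_of X S). f x \<in> V} = {x \<in> points (subspace_of X S). g x \<in> V}"
    using eq by auto
  ultimately have "regular (subspace_of X S) {x \<in> points (subspace_of X S). g x \<in> V} (h \<circ> f)"
    by simp
  then show "regular (subspace_of X S) {x \<in> points (subspace_of X S). g x \<in> V} (h \<circ> g)"
    by (rule regular_subspace_of_cong) (simp add: eq)
qed

lemma regular_proj_space_subset:
  assumes V: "openin (topo proj_space) V" and W: "openin (topo proj_space) W" "W \<subseteq> V"
    and g: "regular proj_space V g"
  shows "regular proj_space W g"
proof -
  have W': "zariski_open (\<Union>W)" using W(1) by (simp add: openin_proj_space)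
  have "regular affine_space (\<Union>V) (\<lambda>x. g (hom_class x))"
    using g regular_proj_space[OF V] by simp
  then have "regular affine_space (\<Union>W) (\<lambda>x. g (hom_class x))"
    by (rule regular_affine_subset[OF _ W' Union_mono[OF W(2)]])
  then show ?thesis using regular_proj_space[OF W(1)] by simp
qed

lemma regular_proj_space_const:
  "openin (topo proj_space) V \<Longrightarrow> regular proj_space V (\<lambda>x. c)"
  by (simp add: regular_proj_space openin_proj_space regular_affine_const)

context fermat_weights
begin

section \<open>The orbit space and its torus part\<close>

abbreviation orb :: "(complex ^ 'n) set \<Rightarrow> (complex ^ 'n) set set" where
  "orb p \<equiv> orbit_rel d z q' `` {p}"

lemma points_fermat_quotient: "points (fermat_quotient d z q') = points (fermat d) // orbit_rel d z q'"
  by (simp add: fermat_quotient_def topspace_quotient equiv_orbit_rel)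

lemma openin_fermat_quotient:
  "openin (topo (fermat_quotient d z q')) V \<longleftrightarrow>
    V \<subseteq> points (fermat d) // orbit_rel d z q' \<and> openin (topo (fermat d)) (\<Union>V)"
  by (simp add: fermat_quotient_def openin_quotient equiv_orbit_rel)

lemma regular_fermat_quotient:
  "regular (fermat_quotient d z q') V f \<longleftrightarrow> regular (fermat d) (\<Union>V) (\<lambda>p. f (orb p))"
  by (simp add: fermat_quotient_def regular_quotient_space)

lemma orb_eq: "(p, p') \<in> orbit_rel d z q' \<Longrightarrow> orb p = orb p'"
  by (rule equiv_class_eq[OF equiv_orbit_rel])

lemma self_in_orb: "p \<in> points (fermat d) \<Longrightarrow> p \<in> orb p"
  by (rule equiv_class_self[OF equiv_orbit_rel])

lemma orb_in_quotient: "p \<in> points (fermat d) \<Longrightarrow> orb p \<in> points (fermat d) // orbit_rel d z q'"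
  by (rule quotientI)

lemma mem_Union_orb:
  assumes "V \<subseteq> points (fermat d) // orbit_rel d z q'" "p \<in> points (fermat d)"
  shows "p \<in> \<Union>V \<longleftrightarrow> orb p \<in> V"
proof
  assume "p \<in> \<Union>V"
  then obtain C where C: "C \<in> V" "p \<in> C" by blast
  moreover obtain x where "C = orb x" using C(1) assms(1) by (blast elim: quotientE)
  ultimately show "orb p \<in> V" using orb_eq by (metis Image_singleton_iff)
qed (use self_in_orb[OF assms(2)] in blast)

lemma Union_orb_saturated:
  assumes "V \<subseteq> points (fermat d) // orbit_rel d z q'" "(p, p') \<in> orbit_rel d z q'" "p \<in> \<Union>V"
  shows "p' \<in> \<Union>V"
proof -
  have "p \<in> points (fermat d)" "p' \<in> points (fermat d)"
    using assms(2) equiv_orbit_rel by (auto dest: equiv_type)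
  then show ?thesis using mem_Union_orb[OF assms(1)] orb_eq[OF assms(2)] assms(3) by simp
qed

lemma torus_part_saturated:
  assumes "p \<in> torus_part" "(p, p') \<in> orbit_rel d z q'"
  shows "p' \<in> torus_part"
proof -
  obtain y where y: "y \<in> torus_cone" "p = hom_class y" using assms(1) by (rule torus_partE)
  then have "y \<in> fermat_cone" using torus_cone_subset by blast
  then obtain k where "p' = hom_class (g_map z k y)"
    using assms(2) unfolding y(2) by (auto simp: orbit_rel_iff)
  then show ?thesis using g_map_torus_cone[OF y(1)] by (simp add: torus_part_def)
qed

lemma Union_orb_image:
  assumes "S \<subseteq> torus_part" "\<And>p p'. p \<in> S \<Longrightarrow> (p, p') \<in> orbit_rel d z q' \<Longrightarrow> p' \<in> S"
  shows "\<Union>(orb ` S) = S"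
  using assms self_in_orb torus_part_subset by blast

lemma orb_image_subset: "S \<subseteq> torus_part \<Longrightarrow> orb ` S \<subseteq> points (fermat d) // orbit_rel d z q'"
  using torus_part_subset orb_in_quotient by blast

abbreviation torus_quotient :: "(complex ^ 'n) set set set" where
  "torus_quotient \<equiv> orb ` torus_part"

lemma Union_torus_quotient: "\<Union>torus_quotient = torus_part"
  using torus_part_saturated by (intro Union_orb_image) auto

lemma dense_open_torus_quotient: "dense_open (fermat_quotient d z q') torus_quotient"
proof (rule dense_openI)
  show "openin (topo (fermat_quotient d z q')) torus_quotient"
    unfolding openin_fermat_quotient Union_torus_quotient
    using openin_torus_part orb_image_subset by blast
  fix V assume "openin (topo (fermat_quotient d z q')) V" "V \<noteq> {}"
  then have V: "V \<subseteq> points (fermat d) // orbit_rel d z q'" "openin (topo (fermat d)) (\<Union>V)" "V \<noteq> {}"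
    unfolding openin_fermat_quotient by auto
  obtain C where C: "C \<in> V" using V(3) by blast
  then obtain p where "C = orb p" "p \<in> points (fermat d)" using V(1) by (blast elim: quotientE)
  then have "p \<in> \<Union>V" using C self_in_orb by blast
  then have "p \<in> topo (fermat d) closure_of torus_part"
    using dense_open_torus_part openin_subset[OF V(2)] unfolding dense_open_def by blast
  then obtain p' where p': "p' \<in> torus_part" "p' \<in> \<Union>V"
    using V(2) \<open>p \<in> \<Union>V\<close> unfolding in_closure_of by blast
  then have "orb p' \<in> V" using mem_Union_orb[OF V(1)] torus_part_subset by blast
  then show "torus_quotient \<inter> V \<noteq> {}" using p'(1) by blast
qed

text \<open>A point of the orbit space is literally a set of projective points, so the fibre over
  \<open>u\<close> in the torus part serves as the value of the inverse.\<close>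

definition umap_inverse :: "(complex ^ 'n option) set \<Rightarrow> (complex ^ 'n) set set" where
  "umap_inverse u = {p \<in> torus_part. umap p = u}"

definition umap_orb :: "(complex ^ 'n) set set \<Rightarrow> (complex ^ 'n option) set" where
  "umap_orb C = umap (SOME p. p \<in> C)"

lemma umap_inverse_umap:
  assumes "p \<in> torus_part"
  shows "umap_inverse (umap p) = orb p"
proof -
  have "p' \<in> umap_inverse (umap p) \<longleftrightarrow> p' \<in> orb p" for p'
    using umap_eq_iff[OF assms, of p'] torus_part_saturated[OF assms, of p']
    unfolding umap_inverse_def by auto
  then show ?thesis by blast
qed

lemma umap_orb_orb:
  assumes "p \<in> torus_part"
  shows "umap_orb (orb p) = umap p"
proof -
  have "p \<in> orb p" using assms self_in_orb torus_part_subset by blast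
  then have "(SOME x. x \<in> orb p) \<in> orb p" by (rule someI[of "\<lambda>x. x \<in> orb p"])
  then have *: "(p, SOME x. x \<in> orb p) \<in> orbit_rel d z q'" by simp
  then show ?thesis
    using umap_eq_iff[OF assms torus_part_saturated[OF assms *]] by (simp add: umap_orb_def)
qed

section \<open>The isomorphism between the image and the torus part of the orbit space\<close>

lemma topo_image: "topo (subspace_of image_closure (umap ` torus_part)) = subtopology (topo proj_space) (umap ` torus_part)"
  using closure_of_subset[OF umap_torus_part_subset]
  by (simp add: image_closure_def subtopology_subtopology Int_absorb1)

lemma points_image: "points (subspace_of image_closure (umap ` torus_part)) = umap ` torus_part"
  unfolding topo_image using umap_torus_part_subset by auto

lemma regular_image:
  assumes "U \<subseteq> umap ` torus_part"
  shows "regular (subspace_of image_closure (umap ` torus_part)) U f \<longleftrightarrow>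
    regular (subspace_of proj_space (umap ` torus_part)) U f"
  unfolding image_closure_def
  using assms closure_of_subset[OF umap_torus_part_subset]
  by (intro regular_subspace_of_subspace_of) auto

lemma points_torus_quotient: "points (subspace_of (fermat_quotient d z q') torus_quotient) = torus_quotient"
  using orb_image_subset[OF order_refl] by (auto simp: points_fermat_quotient)

lemma openin_torus_quotient:
  "openin (subtopology (topo (fermat_quotient d z q')) torus_quotient) V \<longleftrightarrow>
    openin (topo (fermat_quotient d z q')) V \<and> V \<subseteq> torus_quotient"
  using dense_open_torus_quotient
  by (simp add: openin_open_subtopology dense_open_def)

text \<open>The torus part is open: intersecting each witnessing neighbourhood with
  \<open>torus_points\<close> makes it work for the whole Fermat variety.\<close>

lemma regular_fermat_torus_part:
  assumes r: "regular (subspace_of (fermat d) torus_part) U f" and U: "U \<subseteq> torus_part"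
  shows "regular (fermat d) U f"
proof -
  have "regular (subspace_of (subspace_of proj_space (points (fermat d))) torus_part) U f"
    using r fermat_eq by simp
  then have r': "regular (subspace_of proj_space torus_part) U f"
    using U torus_part_subset by (subst (asm) regular_subspace_of_subspace_of) auto
  have "regular (subspace_of proj_space (points (fermat d))) U f"
    unfolding regular_subspace_of
  proof
    fix p assume p: "p \<in> U"
    obtain V g where V: "openin (topo proj_space) V" "p \<in> V" "V \<inter> torus_part \<subseteq> U"
      "regular proj_space V g" "\<forall>x\<in>V \<inter> torus_part. f x = g x"
      by (rule regular_subspace_ofE[OF r' p])
    have o: "openin (topo proj_space) (V \<inter> torus_points)"
      by (intro openin_Int V openin_torus_points)
    have "V \<inter> torus_points \<inter> points (fermat d) = V \<inter> torus_part"
      by (auto simp: torus_part_eq)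
    moreover have "p \<in> V \<inter> torus_points" using p U V(2) by (auto simp: torus_part_eq)
    moreover have "regular proj_space (V \<inter> torus_points) g"
      by (rule regular_proj_space_subset[OF V(1) o _ V(4)]) simp
    ultimately show "\<exists>W g. openin (topo proj_space) W \<and> p \<in> W \<and> W \<inter> points (fermat d) \<subseteq> U \<and>
        regular proj_space W g \<and> (\<forall>x\<in>W \<inter> points (fermat d). f x = g x)"
      using o V(3,5) by (intro exI[of _ "V \<inter> torus_points"] exI[of _ g]) simp
  qed
  then show ?thesis using fermat_eq by simp
qed

lemma regular_fermat_cong:
  fixes U :: "(complex ^ 'n) set set"
  assumes "regular (fermat d) U f" and eq: "\<And>p. p \<in> U \<Longrightarrow> f p = h p"
  shows "regular (fermat d) U h"
proof -
  have "regular (subspace_of proj_space (points (fermat d))) U f" using assms(1) fermat_eq by simp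
  then have "regular (subspace_of proj_space (points (fermat d))) U h"
    by (rule regular_subspace_of_cong) (rule eq)
  then show ?thesis using fermat_eq by simp
qed

lemma regular_fermat_const:
  assumes U: "openin (topo (fermat d)) U"
  shows "regular (fermat d :: (complex ^ 'n) set fspace) U (\<lambda>p. c)"
proof -
  obtain V where V: "openin (topo proj_space) V" "U = V \<inter> points (fermat d)"
    using U unfolding openin_fermat by blast
  have "regular (subspace_of proj_space (points (fermat d :: (complex ^ 'n) set fspace))) U (\<lambda>p. c)"
    unfolding regular_subspace_of
    using V regular_proj_space_const[OF V(1), of c]
    by (intro ballI exI[of _ V] exI[of _ "\<lambda>p. c"]) simp
  then show ?thesis using fermat_eq by simp
qed

text \<open>\<open>fermat_local_inverse\<close> read on orbits: a function pulled back from the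
  orbit space is invariant, and the union of a set of orbits is saturated.\<close>

lemma umap_inverse_local:
  assumes V: "openin (topo (fermat_quotient d z q')) V"
    and k: "regular (fermat_quotient d z q') V k"
    and u: "u \<in> umap ` torus_part" "umap_inverse u \<in> V"
  obtains W h where "openin (topo proj_space) W" "u \<in> W" "regular proj_space W h"
    "\<forall>v\<in>W \<inter> umap ` torus_part. umap_inverse v \<in> V \<and> k (umap_inverse v) = h v"
proof -
  have V': "V \<subseteq> points (fermat d) // orbit_rel d z q'" "openin (topo (fermat d)) (\<Union>V)"
    using V by (simp_all add: openin_fermat_quotient)
  obtain p where p: "p \<in> torus_part" "u = umap p" using u(1) by blast
  have mem: "x \<in> \<Union>V \<longleftrightarrow> umap_inverse (umap x) \<in> V" if "x \<in> torus_part" for x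
    using mem_Union_orb[OF V'(1)] that torus_part_subset by (simp add: umap_inverse_umap subset_iff)
  have "p \<in> \<Union>V" using mem[OF p(1)] u(2) p(2) by simp
  obtain W h where W: "openin (topo proj_space) W" "umap p \<in> W" "regular proj_space W h"
    "\<forall>x\<in>torus_part. umap x \<in> W \<longrightarrow> x \<in> \<Union>V \<and> h (umap x) = k (orb x)"
  proof (rule fermat_local_inverse[OF V'(2) _ _ _ \<open>p \<in> \<Union>V\<close> p(1)])
    show "regular (fermat d) (\<Union>V) (\<lambda>x. k (orb x))" using k by (simp add: regular_fermat_quotient)
    show "k (orb x) = k (orb x')" if "(x, x') \<in> orbit_rel d z q'" for x x'
      using orb_eq[OF that] by simp
  qed (rule Union_orb_saturated[OF V'(1)])
  show thesis
  proof (rule that[OF W(1) _ W(3)])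
    show "u \<in> W" using W(2) p(2) by simp
    show "\<forall>v\<in>W \<inter> umap ` torus_part. umap_inverse v \<in> V \<and> k (umap_inverse v) = h v"
    proof
      fix v assume "v \<in> W \<inter> umap ` torus_part"
      then obtain x where x: "x \<in> torus_part" "v = umap x" "umap x \<in> W" by blast
      then have "x \<in> \<Union>V" "h (umap x) = k (orb x)" using W(4) by blast+
      then show "umap_inverse v \<in> V \<and> k (umap_inverse v) = h v"
        using mem[OF x(1)] umap_inverse_umap[OF x(1)] x(2) by simp
    qed
  qed
qed

lemma morphism_umap_inverse:
  "morphism (subspace_of image_closure (umap ` torus_part))
    (subspace_of (fermat_quotient d z q') torus_quotient) umap_inverse"
  unfolding morphism_def points_image
proof (intro conjI allI impI)
  show "continuous_map (topo (subspace_of image_closure (umap ` torus_part)))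
     (topo (subspace_of (fermat_quotient d z q') torus_quotient)) umap_inverse"
    unfolding continuous_map_def points_image points_torus_quotient
  proof (intro conjI allI impI)
    show "umap_inverse \<in> umap ` torus_part \<rightarrow> torus_quotient"
      by (auto simp: umap_inverse_umap)
    fix V assume "openin (topo (subspace_of (fermat_quotient d z q') torus_quotient)) V"
    then have V: "openin (topo (fermat_quotient d z q')) V" by (simp add: openin_torus_quotient)
    \<comment> \<open>Continuity is the case of a constant function in
      \<open>umap_inverse_local\<close>: only the open set \<open>W\<close> that it yields is
      used.\<close>
    have const: "regular (fermat_quotient d z q') V (\<lambda>_. 0)"
      using V by (simp add: regular_fermat_quotient regular_fermat_const openin_fermat_quotient)
    show "openin (topo (subspace_of image_closure (umap ` torus_part)))
        {u \<in> umap ` torus_part. umap_inverse u \<in> V}" (is "openin _ ?P")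
    proof (subst openin_subopen, intro ballI)
      fix u assume "u \<in> ?P"
      then have u: "u \<in> umap ` torus_part" "umap_inverse u \<in> V" by auto
      obtain W h where W: "openin (topo proj_space) W" "u \<in> W" "regular proj_space W h"
        "\<forall>v\<in>W \<inter> umap ` torus_part. umap_inverse v \<in> V \<and> 0 = h v"
        by (rule umap_inverse_local[OF V const u])
      have "openin (topo (subspace_of image_closure (umap ` torus_part))) (W \<inter> umap ` torus_part)"
        unfolding topo_image openin_subtopology using W(1) by blast
      then show "\<exists>T. openin (topo (subspace_of image_closure (umap ` torus_part))) T \<and> u \<in> T \<and> T \<subseteq> ?P"
        using W(2,4) u(1) by (intro exI[of _ "W \<inter> umap ` torus_part"]) auto
    qed
  qed
next
  fix V k
  assume "openin (topo (subspace_of (fermat_quotient d z q') torus_quotient)) V \<and>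
    regular (subspace_of (fermat_quotient d z q') torus_quotient) V k"
  then have V: "V \<subseteq> torus_quotient" and k: "regular (subspace_of (fermat_quotient d z q') torus_quotient) V k"
    by (auto simp: openin_torus_quotient)
  have "regular (subspace_of proj_space (umap ` torus_part))
      {u \<in> umap ` torus_part. umap_inverse u \<in> V} (k \<circ> umap_inverse)"
    unfolding regular_subspace_of
  proof
    fix u assume "u \<in> {u \<in> umap ` torus_part. umap_inverse u \<in> V}"
    then have u: "u \<in> umap ` torus_part" "umap_inverse u \<in> V" by auto
    obtain V' k' where V': "openin (topo (fermat_quotient d z q')) V'" "umap_inverse u \<in> V'"
      "V' \<inter> torus_quotient \<subseteq> V" "regular (fermat_quotient d z q') V' k'"
      "\<forall>x\<in>V' \<inter> torus_quotient. k x = k' x"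
      by (rule regular_subspace_ofE[OF k u(2)])
    obtain W h where W: "openin (topo proj_space) W" "u \<in> W" "regular proj_space W h"
      "\<forall>v\<in>W \<inter> umap ` torus_part. umap_inverse v \<in> V' \<and> k' (umap_inverse v) = h v"
      by (rule umap_inverse_local[OF V'(1,4) u(1) V'(2)])
    have "umap_inverse v \<in> V \<and> (k \<circ> umap_inverse) v = h v" if v: "v \<in> W \<inter> umap ` torus_part" for v
    proof -
      have "umap_inverse v \<in> torus_quotient" using v by (auto simp: umap_inverse_umap)
      then have "umap_inverse v \<in> V' \<inter> torus_quotient" using W(4) v by blast
      then show ?thesis using V'(3,5) W(4) v by auto
    qed
    then show "\<exists>W h. openin (topo proj_space) W \<and> u \<in> W \<and>
        W \<inter> umap ` torus_part \<subseteq> {u \<in> umap ` torus_part. umap_inverse u \<in> V} \<and>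
        regular proj_space W h \<and> (\<forall>v\<in>W \<inter> umap ` torus_part. (k \<circ> umap_inverse) v = h v)"
      using W(1-3) by (intro exI[of _ W] exI[of _ h]) auto
  qed
  then show "regular (subspace_of image_closure (umap ` torus_part))
      {u \<in> umap ` torus_part. umap_inverse u \<in> V} (k \<circ> umap_inverse)"
    by (subst regular_image) auto
qed

text \<open>Open sets and regular functions on the orbit space are defined by their pullbacks to the
  Fermat variety, where the pulled back map is \<open>umap\<close>. Hence
  \<open>morphism_umap\<close> gives both parts.\<close>

lemma morphism_umap_orb:
  "morphism (subspace_of (fermat_quotient d z q') torus_quotient)
    (subspace_of image_closure (umap ` torus_part)) umap_orb"
proof -
  have mor: "morphism (subspace_of (fermat d) torus_part) (subspace_of proj_space (umap ` torus_part)) umap"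
    by (rule morphism_umap[OF order_refl umap_torus_part_subset])
  have pts: "{p \<in> points (subspace_of (fermat d) torus_part). umap p \<in> V} = {p \<in> torus_part. umap p \<in> V}" for V
    using torus_part_subset by auto
  let ?P = "\<lambda>V. {C \<in> torus_quotient. umap_orb C \<in> V}"
  have P: "?P V = orb ` {p \<in> torus_part. umap p \<in> V}" for V
    by (auto simp: umap_orb_orb)
  have UP: "\<Union>(?P V) = {p \<in> torus_part. umap p \<in> V}" for V
    unfolding P
  proof (rule Union_orb_image)
    fix p p' assume *: "p \<in> {p \<in> torus_part. umap p \<in> V}" "(p, p') \<in> orbit_rel d z q'"
    then have "p' \<in> torus_part" using torus_part_saturated by blast
    then show "p' \<in> {p \<in> torus_part. umap p \<in> V}" using * umap_eq_iff[of p p'] by simp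
  qed simp
  have P_open: "openin (topo (subspace_of (fermat_quotient d z q') torus_quotient)) (?P V)"
    if V: "openin (subtopology (topo proj_space) (umap ` torus_part)) V" for V
  proof -
    have "openin (topo (subspace_of (fermat d) torus_part))
        {p \<in> points (subspace_of (fermat d) torus_part). umap p \<in> V}"
      by (rule openin_continuous_map_preimage[OF morphismD(1)[OF mor]]) (simp add: V)
    then have "openin (subtopology (topo (fermat d)) torus_part) {p \<in> torus_part. umap p \<in> V}"
      unfolding pts by simp
    then have "openin (topo (fermat d)) {p \<in> torus_part. umap p \<in> V}"
      using openin_open_subtopology[OF openin_torus_part] by blast
    moreover have "?P V \<subseteq> points (fermat d) // orbit_rel d z q'"
      using orb_image_subset[OF order_refl] by blast
    ultimately show ?thesis
      unfolding topo_subspace_of openin_torus_quotient openin_fermat_quotient UP by blast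
  qed
  show ?thesis
    unfolding morphism_def points_torus_quotient
  proof (intro conjI allI impI)
    show "continuous_map (topo (subspace_of (fermat_quotient d z q') torus_quotient))
        (topo (subspace_of image_closure (umap ` torus_part))) umap_orb"
      unfolding continuous_map_def points_torus_quotient points_image topo_image
      using P_open umap_torus_part_subset by (auto simp: umap_orb_orb image_subset_iff)
  next
    fix V h
    assume "openin (topo (subspace_of image_closure (umap ` torus_part))) V \<and>
      regular (subspace_of image_closure (umap ` torus_part)) V h"
    then have V: "openin (subtopology (topo proj_space) (umap ` torus_part)) V"
      and h: "regular (subspace_of image_closure (umap ` torus_part)) V h"
      unfolding topo_image by auto
    have "V \<subseteq> umap ` torus_part" using openin_subset[OF V] by simp
    from h have "regular (subspace_of proj_space (umap ` torus_part)) V h"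
      unfolding regular_image[OF \<open>V \<subseteq> umap ` torus_part\<close>] .
    then have "regular (subspace_of (fermat d) torus_part)
        {p \<in> points (subspace_of (fermat d) torus_part). umap p \<in> V} (h \<circ> umap)"
      by (rule morphismD(2)[OF mor, rotated]) (simp add: V)
    then have "regular (subspace_of (fermat d) torus_part) {p \<in> torus_part. umap p \<in> V} (h \<circ> umap)"
      unfolding pts .
    then have r: "regular (fermat d) {p \<in> torus_part. umap p \<in> V} (h \<circ> umap)"
      by (rule regular_fermat_torus_part) blast
    have "regular (fermat d) {p \<in> torus_part. umap p \<in> V} (\<lambda>p. (h \<circ> umap_orb) (orb p))"
      using r by (rule regular_fermat_cong) (simp add: umap_orb_orb)
    then have "regular (fermat_quotient d z q') (?P V) (h \<circ> umap_orb)"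
      unfolding regular_fermat_quotient UP .
    then show "regular (subspace_of (fermat_quotient d z q') torus_quotient) (?P V) (h \<circ> umap_orb)"
      unfolding regular_subspace_of using P_open[OF V]
      by (intro ballI exI[of _ "?P V"] exI[of _ "h \<circ> umap_orb"]) (auto simp: openin_torus_quotient)
  qed
qed

lemma isomorphism_umap_inverse:
  "isomorphism (subspace_of image_closure (umap ` torus_part))
    (subspace_of (fermat_quotient d z q') torus_quotient) umap_inverse"
  unfolding isomorphism_def points_image points_torus_quotient
  by (intro conjI exI[of _ umap_orb] morphism_umap_inverse morphism_umap_orb)
    (auto simp: umap_inverse_umap umap_orb_orb)

lemma morphism_orb: "morphism (subspace_of (fermat d) (points (fermat d))) (fermat_quotient d z q') orb"
proof -
  have P: "{p \<in> points (fermat d). orb p \<in> V} = \<Union>V" if "V \<subseteq> points (fermat d) // orbit_rel d z q'" for V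
    using mem_Union_orb[OF that] in_quotient_imp_subset[OF equiv_orbit_rel] that by blast
  show ?thesis
    unfolding morphism_def
  proof (intro conjI allI impI)
    show "continuous_map (topo (subspace_of (fermat d) (points (fermat d)))) (topo (fermat_quotient d z q')) orb"
      unfolding continuous_map_def points_fermat_quotient
      using orb_in_quotient P by (auto simp: openin_fermat_quotient)
  next
    fix V h
    assume "openin (topo (fermat_quotient d z q')) V \<and> regular (fermat_quotient d z q') V h"
    then have V: "V \<subseteq> points (fermat d) // orbit_rel d z q'" "openin (topo (fermat d)) (\<Union>V)"
      and h: "regular (fermat d) (\<Union>V) (h \<circ> orb)"
      by (auto simp: openin_fermat_quotient regular_fermat_quotient comp_def)
    have "{p \<in> points (subspace_of (fermat d) (points (fermat d))). orb p \<in> V} = \<Union>V"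
      using P[OF V(1)] by simp
    then show "regular (subspace_of (fermat d) (points (fermat d)))
        {p \<in> points (subspace_of (fermat d) (points (fermat d))). orb p \<in> V} (h \<circ> orb)"
      using V(2) h unfolding regular_subspace_of
      by (intro ballI exI[of _ "\<Union>V"] exI[of _ "h \<circ> orb"]) auto
  qed
qed

section \<open>The two rational maps and their equivalence\<close>

definition umap_rational :: "(complex ^ 'n) set \<rightharpoonup> (complex ^ 'n option) set" where
  "umap_rational p = (if p \<in> torus_part then Some (umap p) else None)"

lemma rational_map_umap: "rational_map (fermat d) image_closure umap_rational"
proof -
  have dom: "dom umap_rational = torus_part"
    by (auto simp: umap_rational_def split: if_splits)
  have "morphism (subspace_of (fermat d) torus_part) image_closure umap"
    unfolding image_closure_def
    by (intro morphism_umap closure_of_subset umap_torus_part_subset closure_of_subset_topspace)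
  then have "morphism (subspace_of (fermat d) torus_part) image_closure (\<lambda>p. the (umap_rational p))"
    by (rule morphism_subspace_of_cong) (use torus_part_subset in \<open>auto simp: umap_rational_def\<close>)
  then show ?thesis unfolding rational_map_def dom using dense_open_torus_part by blast
qed

lemma rational_map_orb:
  "rational_map (fermat d) (fermat_quotient d z q') (fermat_quotient_map d z q')"
proof -
  have dom: "dom (fermat_quotient_map d z q') = points (fermat d)"
    by (auto simp: fermat_quotient_map_def)
  have "morphism (subspace_of (fermat d) (points (fermat d))) (fermat_quotient d z q')
      (\<lambda>p. the (fermat_quotient_map d z q' p))"
    by (rule morphism_subspace_of_cong[OF morphism_orb]) (auto simp: fermat_quotient_map_def)
  then show ?thesis unfolding rational_map_def dom using dense_open_points by blast
qed

theorem birationally_equivalent_umap_orb: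
  "birationally_equivalent_maps (fermat d) image_closure (fermat_quotient d z q')
     umap_rational (fermat_quotient_map d z q')"
  unfolding birationally_equivalent_maps_def
proof (intro conjI rational_map_umap rational_map_orb exI[of _ torus_part]
    exI[of _ "umap ` torus_part"] exI[of _ torus_quotient] exI[of _ umap_inverse]
    dense_open_torus_part dense_open_image dense_open_torus_quotient isomorphism_umap_inverse)
  show "torus_part \<subseteq> dom umap_rational \<inter> dom (fermat_quotient_map d z q')"
    using torus_part_subset by (auto simp: umap_rational_def fermat_quotient_map_def)
  show "\<forall>p\<in>torus_part. the (umap_rational p) \<in> umap ` torus_part \<and>
      umap_inverse (the (umap_rational p)) = the (fermat_quotient_map d z q' p)"
    using torus_part_subset
    by (auto simp: umap_rational_def fermat_quotient_map_def umap_inverse_umap)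
qed

theorem birational_fermat_quotient_image_closure: "birational (fermat_quotient d z q') image_closure"
  using isomorphism_sym[OF isomorphism_umap_inverse] dense_open_torus_quotient dense_open_image
  unfolding birational_def by blast

end

section \<open>The maps attached to a matrix\<close>

lemma rat_multiple_in_Ints: "\<exists>m::nat. 0 < m \<and> of_nat m * (x::rat) \<in> \<int>"
proof -
  obtain a b where "quotient_of x = (a, b)" by (cases "quotient_of x")
  then have ab: "x = of_int a / of_int b" "b > 0"
    using quotient_of_div quotient_of_denom_pos by auto
  have "of_nat (nat b) * x = of_int a" using ab by simp
  then show ?thesis using ab(2) by (intro exI[of _ "nat b"]) simp
qed

locale matrix_data =
  fixes A :: "nat ^ 'n ^ 'n"
  assumes det_nonzero: "det (map_matrix of_nat A :: rat ^ 'n ^ 'n) \<noteq> 0"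
    and sum_A_inv: "(\<Sum>i\<in>UNIV. \<Sum>j\<in>UNIV. A_inv A $ i $ j) = 1"
begin

abbreviation d :: nat where "d \<equiv> d_of A"
abbreviation B :: "int ^ 'n ^ 'n" where "B \<equiv> B_of A"

text \<open>The least number in \<open>d_of\<close> is meaningful only once a common denominator
  exists; the product of denominators of all entries is one.\<close>

lemma d_of_properties: "0 < d \<and> (\<forall>i j. of_nat d * A_inv A $ i $ j \<in> \<int>)"
  unfolding d_of_def
proof (rule LeastI_ex)
  have "\<forall>i j. \<exists>m::nat. 0 < m \<and> of_nat m * A_inv A $ i $ j \<in> \<int>"
    using rat_multiple_in_Ints by blast
  then obtain m :: "'n \<Rightarrow> 'n \<Rightarrow> nat" where m: "\<And>i j. 0 < m i j" "\<And>i j. of_nat (m i j) * A_inv A $ i $ j \<in> \<int>"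
    by metis
  let ?M = "\<Prod>(i, j)\<in>UNIV. m i j"
  have "of_nat ?M * A_inv A $ i $ j \<in> \<int>" for i j
  proof -
    have "?M = m i j * (\<Prod>(i, j)\<in>UNIV - {(i, j)}. m i j)"
      by (subst prod.remove[of _ "(i, j)"]) auto
    then have "of_nat ?M * A_inv A $ i $ j
        = of_nat (\<Prod>(i, j)\<in>UNIV - {(i, j)}. m i j) * (of_nat (m i j) * A_inv A $ i $ j)"
      by simp
    also have "\<dots> \<in> \<int>" by (rule Ints_mult[OF Ints_of_nat m(2)])
    finally show ?thesis .
  qed
  moreover have "0 < ?M" using m(1) by (intro prod_pos) auto
  ultimately show "\<exists>d. 0 < d \<and> (\<forall>i j. of_nat d * A_inv A $ i $ j \<in> \<int>)" by blast
qed

lemma of_int_B: "of_int (B $ i $ j) = of_nat d * A_inv A $ i $ j"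
  using d_of_properties by (simp add: B_of_def)

text \<open>\<open>A ** B = d\<close> times the identity. The nonzero determinant makes
  \<open>matrix_inv\<close> a genuine inverse over the rationals, and the identity returns to the
  integers by injectivity of \<open>of_int\<close>.\<close>

lemma A_mult_B: "(\<Sum>j\<in>UNIV. int (A $ i $ j) * B $ j $ k) = (if i = k then int d else 0)"
proof -
  let ?A = "map_matrix of_nat A :: rat ^ 'n ^ 'n"
  have "?A ** A_inv A = mat 1"
    using det_nonzero someI_ex[of "\<lambda>X. ?A ** X = mat 1 \<and> X ** ?A = mat 1"]
    by (simp add: A_inv_def matrix_inv_def invertible_det_nz[symmetric] invertible_def)
  then have "(?A ** A_inv A) $ i $ k = (if i = k then 1 else 0)"
    by (simp add: mat_def)
  then have "(\<Sum>j\<in>UNIV. of_nat (A $ i $ j) * A_inv A $ j $ k) = (if i = k then 1 else (0::rat))"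
    by (simp add: matrix_matrix_mult_def map_matrix_def)
  then have "of_nat d * (\<Sum>j\<in>UNIV. of_nat (A $ i $ j) * A_inv A $ j $ k)
      = (if i = k then of_nat d else (0::rat))" by simp
  then have "(of_int (\<Sum>j\<in>UNIV. int (A $ i $ j) * B $ j $ k) :: rat)
      = of_int (if i = k then int d else 0)"
    by (simp add: of_int_B sum_distrib_left mult.left_commute)
  then show ?thesis by (simp only: of_int_eq_iff)
qed

lemma q_of_nth: "q_of A $ j = (\<Sum>k\<in>UNIV. B $ j $ k)"
  by (simp add: q_of_def matrix_vector_mult_def)

lemma q'_of_nth: "q'_of A $ k = (\<Sum>j\<in>UNIV. B $ j $ k)"
  by (simp add: q'_of_def matrix_vector_mult_def transpose_def)

lemma sum_q_of: "(\<Sum>j\<in>UNIV. q_of A $ j) = int d"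
proof -
  have "of_int (\<Sum>j\<in>UNIV. q_of A $ j) = (of_nat d * (\<Sum>i\<in>UNIV. \<Sum>j\<in>UNIV. A_inv A $ i $ j) :: rat)"
    by (simp add: q_of_nth of_int_B sum_distrib_left)
  then have "of_int (\<Sum>j\<in>UNIV. q_of A $ j) = (of_int (int d) :: rat)" by (simp add: sum_A_inv)
  then show ?thesis by (simp only: of_int_eq_iff)
qed

lemma sum_q'_of: "(\<Sum>k\<in>UNIV. q'_of A $ k) = int d"
  unfolding sum_q_of[symmetric] q_of_nth q'_of_nth by (rule sum.swap)

text \<open>\<open>q\<close> is \<open>B\<close> applied to the vector of ones, so \<open>A\<close>
  sends it to \<open>d\<close> times that vector: each monomial of \<open>F_poly\<close> has
  weighted degree \<open>d\<close>.\<close>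

lemma A_mult_q: "(\<Sum>j\<in>UNIV. int (A $ i $ j) * q_of A $ j) = int d"
proof -
  have "(\<Sum>j\<in>UNIV. int (A $ i $ j) * q_of A $ j) = (\<Sum>k\<in>UNIV. \<Sum>j\<in>UNIV. int (A $ i $ j) * B $ j $ k)"
    unfolding q_of_nth sum_distrib_left by (rule sum.swap)
  then show ?thesis by (simp add: A_mult_B)
qed

definition xmap :: "complex ^ 'n \<Rightarrow> complex ^ 'n" where
  "xmap y = (\<chi> j. \<Prod>k\<in>UNIV. y $ k powi (B $ j $ k))"

lemma xmap_nonzero: "\<forall>k. y $ k \<noteq> 0 \<Longrightarrow> xmap y $ j \<noteq> 0"
  by (simp add: xmap_def)

text \<open>Composing monomial maps multiplies exponent matrices. The rows of \<open>A ** B\<close>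
  leave \<open>y $ i ^ d\<close>, and the product of all coordinates has as exponents the column
  sums of \<open>B\<close>, which are \<open>q'\<close>.\<close>

lemma u_coords_xmap:
  assumes y: "\<forall>k. y $ k \<noteq> 0"
  shows "u_coords A (xmap y) = uhat d (q'_of A) y"
proof -
  have "u_coords A (xmap y) $ i = uhat d (q'_of A) y $ i" for i
  proof (cases i)
    case None
    have "(\<Prod>j\<in>UNIV. \<Prod>k\<in>UNIV. y $ k powi (B $ j $ k)) = (\<Prod>k\<in>UNIV. \<Prod>j\<in>UNIV. y $ k powi (B $ j $ k))"
      by (rule prod.swap)
    also have "\<dots> = (\<Prod>k\<in>UNIV. y $ k powi (q'_of A $ k))"
      using y by (simp add: q'_of_nth power_int_sum_exponent)
    finally show ?thesis by (simp add: None u_coords_def xmap_def)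
  next
    case (Some i)
    have "(\<Prod>j\<in>UNIV. (\<Prod>k\<in>UNIV. y $ k powi (B $ j $ k)) ^ (A $ i $ j))
        = (\<Prod>j\<in>UNIV. \<Prod>k\<in>UNIV. y $ k powi (int (A $ i $ j) * B $ j $ k))"
      unfolding prod_power_distrib by (simp add: power_int_mult mult.commute)
    also have "\<dots> = (\<Prod>k\<in>UNIV. \<Prod>j\<in>UNIV. y $ k powi (int (A $ i $ j) * B $ j $ k))"
      by (rule prod.swap)
    also have "\<dots> = (\<Prod>k\<in>UNIV. y $ k powi (\<Sum>j\<in>UNIV. int (A $ i $ j) * B $ j $ k))"
      using y by (simp add: power_int_sum_exponent)
    also have "\<dots> = (\<Prod>k\<in>UNIV. if k = i then y $ k ^ d else 1)"
      unfolding A_mult_B by (intro prod.cong) auto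
    finally show ?thesis by (simp add: Some u_coords_def xmap_def)
  qed
  then show ?thesis by (simp add: vec_eq_iff)
qed

text \<open>All coordinates have weighted degree \<open>d\<close>: \<open>None\<close> because the
  weights sum to \<open>d\<close>, the others by \<open>A_mult_q\<close>. This makes
  \<open>q_A\<close> independent of the representative.\<close>

lemma u_coords_weighted:
  assumes "l \<noteq> 0" "\<And>j. x' $ j = l powi (q_of A $ j) * x $ j"
  shows "u_coords A x' = l ^ d *s u_coords A x"
proof -
  have "u_coords A x' $ i = (l ^ d *s u_coords A x) $ i" for i
  proof (cases i)
    case None
    have "(\<Prod>j\<in>UNIV. l powi (q_of A $ j)) = l ^ d"
      using power_int_sum_exponent[of UNIV l "\<lambda>j. q_of A $ j"] assms(1) by (simp add: sum_q_of)
    then show ?thesis by (simp add: None u_coords_def assms(2) prod.distrib)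
  next
    case (Some i)
    have "(\<Prod>j\<in>UNIV. (l powi (q_of A $ j)) ^ (A $ i $ j)) = l powi (\<Sum>j\<in>UNIV. int (A $ i $ j) * q_of A $ j)"
      using assms(1) by (simp add: power_int_sum_exponent power_int_mult mult.commute)
    then have "(\<Prod>j\<in>UNIV. (l powi (q_of A $ j)) ^ (A $ i $ j)) = l ^ d"
      by (simp add: A_mult_q)
    then show ?thesis by (simp add: Some u_coords_def assms(2) prod.distrib power_mult_distrib)
  qed
  then show ?thesis by (simp add: vec_eq_iff)
qed

text \<open>The row sums of \<open>B\<close> are the weights \<open>q\<close>, so scalar multiples
  of \<open>y\<close> go to equivalent vectors of the weighted space.\<close>

lemma xmap_smult:
  assumes "l \<noteq> 0"
  shows "xmap (l *s y) $ j = l powi (q_of A $ j) * xmap y $ j"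
  using power_int_sum_exponent[of UNIV l "\<lambda>k. B $ j $ k"] assms
  by (simp add: xmap_def power_int_mult_distrib prod.distrib q_of_nth)

lemma phi_A_hom_class:
  assumes "y \<noteq> 0"
  shows "phi_A A (hom_class y) =
    (if \<forall>k. y $ k \<noteq> 0 then Some (weighted_rel (q_of A) `` {xmap y}) else None)"
proof -
  have iff: "(\<forall>x\<in>hom_class y. \<forall>k. x $ k \<noteq> 0) \<longleftrightarrow> (\<forall>k. y $ k \<noteq> 0)"
    using self_in_hom_class[OF assms] by (auto simp: hom_class_eq[OF assms])
  have class_eq: "weighted_rel (q_of A) `` (xmap ` hom_class y) = weighted_rel (q_of A) `` {xmap y}"
    if y: "\<forall>k. y $ k \<noteq> 0"
  proof -
    have "weighted_rel (q_of A) `` (xmap ` hom_class y)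
        = (\<Union>x\<in>hom_class y. weighted_rel (q_of A) `` {xmap x})" by blast
    also have "\<dots> = (\<Union>x\<in>hom_class y. weighted_rel (q_of A) `` {xmap y})"
    proof (rule SUP_cong[OF refl])
      fix x assume "x \<in> hom_class y"
      then obtain l where l: "l \<noteq> 0" "x = l *s y" unfolding hom_class_eq[OF assms] by blast
      have "xmap y \<noteq> 0" "xmap x \<noteq> 0"
        using xmap_nonzero[OF y] l y by (auto intro!: torus_nonzero xmap_nonzero)
      then have "(xmap y, xmap x) \<in> weighted_rel (q_of A)"
        unfolding weighted_rel_def using l xmap_smult[OF l(1)] by blast
      then show "weighted_rel (q_of A) `` {xmap x} = weighted_rel (q_of A) `` {xmap y}"
        using equiv_class_eq[OF equiv_weighted_rel] by blast
    qed
    also have "\<dots> = weighted_rel (q_of A) `` {xmap y}"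
      using self_in_hom_class[OF assms] by blast
    finally show ?thesis .
  qed
  show ?thesis
  proof (cases "\<forall>k. y $ k \<noteq> 0")
    case True
    then have "phi_A A (hom_class y) = Some (weighted_rel (q_of A) `` (xmap ` hom_class y))"
      unfolding phi_A_def iff xmap_def[abs_def] using hom_class_in_points[OF assms] by simp
    then show ?thesis using True class_eq[OF True] by simp
  next
    case False
    then show ?thesis unfolding phi_A_def iff by meson
  qed
qed

lemma q_A_weighted_class:
  assumes "\<forall>j. x $ j \<noteq> 0" "u_coords A x \<noteq> 0"
  shows "q_A A (weighted_rel (q_of A) `` {x}) = Some (hom_class (u_coords A x))"
proof -
  let ?C = "weighted_rel (q_of A) `` {x}"
  have x: "x \<noteq> 0" using assms(1) by (rule torus_nonzero)
  have C: "?C \<in> points (weighted_proj (q_of A))"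
    unfolding points_weighted_proj using x by (auto intro: quotientI)
  have u: "\<exists>l. l \<noteq> 0 \<and> u_coords A x' = l ^ d *s u_coords A x" if x': "x' \<in> ?C" for x'
  proof -
    obtain l where "l \<noteq> 0" "\<forall>j. x' $ j = l powi (q_of A $ j) * x $ j"
      using x' by (auto simp: weighted_rel_def)
    then show ?thesis using u_coords_weighted[of l x' x] by blast
  qed
  have "x \<in> ?C" using equiv_class_self[OF equiv_weighted_rel] x by blast
  have nz: "\<forall>x'\<in>?C. u_coords A x' \<noteq> 0"
  proof
    fix x' assume "x' \<in> ?C"
    then obtain l where l: "l \<noteq> 0" "u_coords A x' = l ^ d *s u_coords A x" using u by blast
    then show "u_coords A x' \<noteq> 0" using assms(2) by simp
  qed
  have "weighted_rel 1 `` (u_coords A ` ?C) = (\<Union>x'\<in>?C. hom_class (u_coords A x'))"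
    by (auto simp: hom_class_def)
  also have "\<dots> = (\<Union>x'\<in>?C. hom_class (u_coords A x))"
  proof (rule SUP_cong[OF refl])
    fix x' assume "x' \<in> ?C"
    then obtain l where l: "l \<noteq> 0" "u_coords A x' = l ^ d *s u_coords A x" using u by blast
    then show "hom_class (u_coords A x') = hom_class (u_coords A x)"
      using assms(2) by (simp add: hom_class_smult)
  qed
  also have "\<dots> = hom_class (u_coords A x)" using \<open>x \<in> ?C\<close> by blast
  finally show ?thesis unfolding q_A_def using C nz by simp
qed

end

theorem theorem3p1:
  fixes A :: "nat ^ 'n ^ 'n" and z :: complex
  assumes "det (map_matrix of_nat A :: rat ^ 'n ^ 'n) \<noteq> 0"
    and "(\<Sum>i\<in>UNIV. \<Sum>j\<in>UNIV. A_inv A $ i $ j) = 1"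
    and "\<forall>j. q_of A $ j > 0"
    and "\<forall>k. q'_of A $ k > 0"
    and "irreducible_space (X_A A)"
    and "primitive_root (d_of A) z"
  shows "birationally_equivalent_maps (fermat (d_of A)) (shioda_quotient A)
           (fermat_quotient (d_of A) z (q'_of A))
           (shioda_map A) (fermat_quotient_map (d_of A) z (q'_of A))
       \<and> birational (fermat_quotient (d_of A) z (q'_of A)) (shioda_quotient A)"
proof -
  interpret matrix_data A using assms(1,2) by unfold_locales
  interpret fermat_weights "d_of A" z "q'_of A"
    using d_of_properties assms(4,6) sum_q'_of by unfold_locales auto
  \<comment> \<open>Equality of partial functions includes equality of domains: \<open>phi_A\<close>
    excludes exactly the points with a zero coordinate, and \<open>q_A\<close> is defined at every
    value that it takes.\<close>
  have map: "shioda_map A = umap_rational"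
  proof
    fix p
    show "shioda_map A p = umap_rational p"
    proof (cases "p \<in> points (fermat (d_of A))")
      case True
      then obtain y where y: "y \<in> fermat_cone" "p = hom_class y"
        unfolding points_fermat by (rule imageE)
      then have y0: "y \<noteq> 0" by (simp add: fermat_cone_def)
      show ?thesis
      proof (cases "\<forall>k. y $ k \<noteq> 0")
        case y': True
        then have "p \<in> torus_part"
          using y by (simp add: torus_part_def torus_cone_def fermat_cone_def)
        moreover have "shioda_map A p = q_A A (weighted_rel (q_of A) `` {xmap y})"
          using True y0 y' by (simp add: shioda_map_def map_comp_def y(2) phi_A_hom_class)
        moreover have "\<dots> = Some (hom_class (u_coords A (xmap y)))"
          using y' xmap_nonzero uhat_nonzero(2)
          by (intro q_A_weighted_class) (simp_all add: u_coords_xmap)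
        ultimately show ?thesis
          using y' by (simp add: umap_rational_def y(2) umap_hom_class u_coords_xmap)
      next
        case y': False
        have "p \<notin> torus_part"
        proof
          assume "p \<in> torus_part"
          then obtain x where x: "x \<in> torus_cone" "p = hom_class x" by (rule torus_partE)
          then obtain l where "l \<noteq> 0" "y = l *s x"
            using hom_class_eq_iff[of x y] y0 y(2) torus_cone_nonzero[OF x(1)] by auto
          then show False using y' torus_cone_nth[OF x(1)] by auto
        qed
        moreover have "phi_A A p = None"
          unfolding y(2) phi_A_hom_class[OF y0] using y' by (rule if_not_P)
        ultimately show ?thesis
          using True by (simp add: shioda_map_def map_comp_def umap_rational_def)
      qed
    next
      case False
      then show ?thesis
        using torus_part_subset by (auto simp: shioda_map_def map_comp_def umap_rational_def)
    qed
  qed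
  have "ran umap_rational = umap ` torus_part"
    by (auto simp: ran_def umap_rational_def)
  then have "shioda_quotient A = image_closure"
    by (simp add: shioda_quotient_def image_closure_def map)
  then show ?thesis
    using birationally_equivalent_umap_orb birational_fermat_quotient_image_closure map by simp
qed

end
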